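(* Let $E$ and $F$ be proper BSFs on some set $X$ with $E\subset F$. Then there exists an RKHS $H$ over $X$ such that $$E\hookrightarrow H\hookrightarrow F$$ if one of the following two conditions is satisfied: (i) The inclusion map $\mathrm{id}:E\to F$ is 2-summing. (ii) $E$ is of type 2 and $F$ is of cotype 2.
   Context: Let $X\neq\emptyset$ be a set. A Banach space of functions (BSF) on $X$ is a Banach space whose elements are functions $X\to\mathbb{R}$. A BSF $E$ on $X$ is proper if for every $x\in X$ the evaluation functional $\delta_x:E\to\mathbb{R}$, $f\mapsto f(x)$, is continuous. A reproducing kernel Hilbert space (RKHS) on (over) $X$ is a proper BSF on $X$ whose norm is a Hilbert space norm. $E\hookrightarrow H$ means that $E\subset H$ (as sets of functions) and the inclusion map is continuous. A bounded linear operator $A:E\to F$ between Banach spaces is 2-summing if there is a constant $C\ge 0$ such that for all $n\in\mathbb{N}$ and $x_1,\dots,x_n\in E$ one has $\bigl(\sum_{i=1}^n\|Ax_i\|_F^2\bigr)^{1/2}\le C\sup_{x'\in E',\,\|x'\|\le 1}\bigl(\sum_{i=1}^n|x'(x_i)|^2\bigr)^{1/2}$. Let $(\varepsilon_i)$ be a Rademacher sequence, i.e. i.i.d. random variables with $\mathbb{P}(\varepsilon_1=1)=\mathbb{P}(\varepsilon_1=-1)=1/2$. A bounded linear operator $A:E\to F$ is of type 2 if there is $C\ge0$ with $\mathbb{E}\|\sum_{i=1}^n\varepsilon_iAx_i\|_F\le C\bigl(\sum_{i=1}^n\|x_i\|_E^2\bigr)^{1/2}$ for all $n\in\mathbb{N}$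 and $x_1,\dots,x_n\in E$; it is of cotype 2 if there is $C\ge0$ with $\bigl(\sum_{i=1}^n\|Ax_i\|_F^2\bigr)^{1/2}\le C\,\mathbb{E}\|\sum_{i=1}^n\varepsilon_ix_i\|_E$ for all such $n$ and $x_i$. A Banach space is of type 2 (resp. cotype 2) if its identity map is of type 2 (resp. cotype 2). *)

theory Defs
  imports "HOL-Probability.Probability" "HOL-Library.Function_Algebras"
begin

text \<open>
  The distribution provides pointwise addition of functions; we add pointwise scalar
  multiplication, so that the functions on \<open>X\<close> form a real vector space.  The nonempty
  set \<open>X\<close> is a type (all types are nonempty).
\<close>

instantiation "fun" :: (type, real_vector) real_vector
begin

definition scaleR_fun :: "real \<Rightarrow> ('a \<Rightarrow> 'b) \<Rightarrow> 'a \<Rightarrow> 'b"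
  where "scaleR_fun c f = (\<lambda>x. c *\<^sub>R f x)"

instance
  by standard (simp_all add: scaleR_fun_def fun_eq_iff scaleR_add_right scaleR_add_left)

end

lemma scaleR_fun_apply [simp]: "(c *\<^sub>R f) x = c *\<^sub>R f x"
  by (simp add: scaleR_fun_def)

section \<open>Banach spaces with explicit carrier and norm\<close>

text \<open>
  The spaces considered are subspaces of an ambient vector space, each with a norm of its own,
  so they cannot be rendered by the type class \<open>banach\<close>.  Values of
  \<open>nrm\<close> outside \<open>vecs\<close> are irrelevant.
\<close>

record 'a nspace =
  vecs :: "'a set"
  nrm :: "'a \<Rightarrow> real"

definition normed_space :: "'a::real_vector nspace \<Rightarrow> bool" where
  "normed_space E \<longleftrightarrow> subspace (vecs E) \<and>
     (\<forall>f\<in>vecs E. 0 \<le> nrm E f \<and> (nrm E f = 0 \<longleftrightarrow> f = 0)) \<and>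
     (\<forall>c. \<forall>f\<in>vecs E. nrm E (c *\<^sub>R f) = \<bar>c\<bar> * nrm E f) \<and>
     (\<forall>f\<in>vecs E. \<forall>g\<in>vecs E. nrm E (f + g) \<le> nrm E f + nrm E g)"

definition ndist :: "'a::real_vector nspace \<Rightarrow> 'a \<Rightarrow> 'a \<Rightarrow> real" where
  "ndist E f g = (if f \<in> vecs E \<and> g \<in> vecs E then nrm E (f - g) else 0)"

text \<open>
  The locale \<open>Metric_space\<close> demands symmetry and nonnegativity on the whole type, hence the
  value 0 off the carrier; its notions only use the distance on \<open>vecs E\<close>.
\<close>

lemma Metric_space_ndist:
  assumes "normed_space E"
  shows "Metric_space (vecs E) (ndist E)"
proof
  have "subspace (vecs E)"
    and pos: "\<forall>f\<in>vecs E. 0 \<le> nrm E f \<and> (nrm E f = 0 \<longleftrightarrow> f = 0)"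
    and scale: "\<forall>c. \<forall>f\<in>vecs E. nrm E (c *\<^sub>R f) = \<bar>c\<bar> * nrm E f"
    and tri: "\<forall>f\<in>vecs E. \<forall>g\<in>vecs E. nrm E (f + g) \<le> nrm E f + nrm E g"
    using assms unfolding normed_space_def by - (elim conjE, assumption)+
  then have sub: "f - g \<in> vecs E" if "f \<in> vecs E" "g \<in> vecs E" for f g
    using that by (intro subspace_diff)
  fix f g h
  show "0 \<le> ndist E f g"
    using bspec[OF pos sub[of f g]] by (simp add: ndist_def)
  have "nrm E (g - f) = nrm E (f - g)" if "f \<in> vecs E" "g \<in> vecs E"
    using bspec[OF spec[OF scale, of "-1"] sub[OF that]] by simp
  then show "ndist E f g = ndist E g f"
    by (simp add: ndist_def)
  show "ndist E f g = 0 \<longleftrightarrow> f = g" if "f \<in> vecs E" "g \<in> vecs E"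
    using bspec[OF pos sub[OF that]] that by (simp add: ndist_def)
  show "ndist E f h \<le> ndist E f g + ndist E g h"
    if "f \<in> vecs E" "g \<in> vecs E" "h \<in> vecs E"
    using bspec[OF bspec[OF tri sub[OF that(1,2)]] sub[OF that(2,3)]] that by (simp add: ndist_def)
qed

definition ntopology :: "'a::real_vector nspace \<Rightarrow> 'a topology" where
  "ntopology E = Metric_space.mtopology (vecs E) (ndist E)"

definition banach_space :: "'a::real_vector nspace \<Rightarrow> bool" where
  "banach_space E \<longleftrightarrow> normed_space E \<and> Metric_space.mcomplete (vecs E) (ndist E)"

definition hilbert_norm :: "'a::real_vector nspace \<Rightarrow> bool" where
  "hilbert_norm E \<longleftrightarrow> (\<exists>ip :: 'a \<Rightarrow> 'a \<Rightarrow> real.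
     (\<forall>f\<in>vecs E. \<forall>g\<in>vecs E. ip f g = ip g f) \<and>
     (\<forall>f\<in>vecs E. \<forall>g\<in>vecs E. \<forall>h\<in>vecs E. ip (f + g) h = ip f h + ip g h) \<and>
     (\<forall>c. \<forall>f\<in>vecs E. \<forall>g\<in>vecs E. ip (c *\<^sub>R f) g = c * ip f g) \<and>
     (\<forall>f\<in>vecs E. 0 \<le> ip f f \<and> (ip f f = 0 \<longleftrightarrow> f = 0)) \<and>
     (\<forall>f\<in>vecs E. nrm E f = sqrt (ip f f)))"

section \<open>Banach spaces of functions\<close>

definition proper_bsf :: "('x \<Rightarrow> real) nspace \<Rightarrow> bool" where
  "proper_bsf E \<longleftrightarrow> banach_space E \<and>
     (\<forall>x. continuous_map (ntopology E) euclideanreal (\<lambda>f. f x))"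

definition rkhs :: "('x \<Rightarrow> real) nspace \<Rightarrow> bool" where
  "rkhs H \<longleftrightarrow> proper_bsf H \<and> hilbert_norm H"

definition embedded :: "'a::real_vector nspace \<Rightarrow> 'a nspace \<Rightarrow> bool"  (infix "\<hookrightarrow>" 50) where
  "E \<hookrightarrow> F \<longleftrightarrow> vecs E \<subseteq> vecs F \<and> continuous_map (ntopology E) (ntopology F) id"

section \<open>Bounded and 2-summing operators\<close>

text \<open>Operators are functions on the ambient type, of which only the values on \<open>vecs E\<close> matter.\<close>

definition bounded_operator ::
    "'a::real_vector nspace \<Rightarrow> 'b::real_vector nspace \<Rightarrow> ('a \<Rightarrow> 'b) \<Rightarrow> bool" where
  "bounded_operator E F A \<longleftrightarrow> A ` vecs E \<subseteq> vecs F \<and>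
     (\<forall>f\<in>vecs E. \<forall>g\<in>vecs E. A (f + g) = A f + A g) \<and>
     (\<forall>c. \<forall>f\<in>vecs E. A (c *\<^sub>R f) = c *\<^sub>R A f) \<and>
     (\<exists>C. \<forall>f\<in>vecs E. nrm F (A f) \<le> C * nrm E f)"

definition dual :: "'a::real_vector nspace \<Rightarrow> ('a \<Rightarrow> real) set" where
  "dual E = {\<phi>. bounded_operator E \<lparr>vecs = UNIV, nrm = norm\<rparr> \<phi>}"

definition dual_norm :: "'a::real_vector nspace \<Rightarrow> ('a \<Rightarrow> real) \<Rightarrow> real" where
  "dual_norm E \<phi> = (SUP f\<in>{f\<in>vecs E. nrm E f \<le> 1}. \<bar>\<phi> f\<bar>)"

definition two_summing ::
    "'a::real_vector nspace \<Rightarrow> 'b::real_vector nspace \<Rightarrow> ('a \<Rightarrow> 'b) \<Rightarrow> bool" where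
  "two_summing E F A \<longleftrightarrow> bounded_operator E F A \<and>
     (\<exists>C\<ge>0. \<forall>(n::nat) x. (\<forall>i<n. x i \<in> vecs E) \<longrightarrow>
        sqrt (\<Sum>i<n. (nrm F (A (x i)))\<^sup>2) \<le>
        C * (SUP \<phi>\<in>{\<phi>\<in>dual E. dual_norm E \<phi> \<le> 1}. sqrt (\<Sum>i<n. \<bar>\<phi> (x i)\<bar>\<^sup>2)))"

section \<open>Type 2 and cotype 2\<close>

text \<open>
  The Rademacher sequence is realised as the sequence of coordinates \<open>\<lambda>\<omega>. \<omega> i\<close> on a
  countable product of fair coins.
\<close>

definition rademacher :: "(nat \<Rightarrow> real) measure" where
  "rademacher = (\<Pi>\<^sub>M i\<in>UNIV. uniform_count_measure {-1, 1})"

lemma prob_space_coin: "prob_space (uniform_count_measure {-1, 1 :: real})"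
  by (rule prob_space_uniform_count_measure) auto

lemma prob_space_rademacher: "prob_space rademacher"
  unfolding rademacher_def by (intro prob_space_PiM prob_space_coin)

lemma distr_rademacher:
  "distr rademacher (uniform_count_measure {-1, 1}) (\<lambda>\<omega>. \<omega> i) = uniform_count_measure {-1, 1}"
  unfolding rademacher_def by (rule distr_PiM_component) (rule prob_space_coin, rule UNIV_I)

lemma measurable_rademacher: "(\<lambda>\<omega>. \<omega> i) \<in> rademacher \<rightarrow>\<^sub>M uniform_count_measure {-1, 1}"
  unfolding rademacher_def by (rule measurable_component_singleton) (rule UNIV_I)

lemma indep_vars_rademacher:
  "prob_space.indep_vars rademacher (\<lambda>_. borel) (\<lambda>i \<omega>. \<omega> i) UNIV"
proof -
  interpret prob_space rademacher by (rule prob_space_rademacher)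
  let ?p = "uniform_count_measure {-1, 1 :: real}"
  have "indep_vars (\<lambda>_. ?p) (\<lambda>i \<omega>. \<omega> i) UNIV"
  proof (subst indep_vars_iff_distr_eq_PiM)
    have "distr rademacher (Pi\<^sub>M UNIV (\<lambda>_. ?p)) (\<lambda>\<omega>. restrict \<omega> UNIV) = rademacher"
      unfolding rademacher_def restrict_UNIV by (rule distr_id2) (rule refl)
    then show "distr rademacher (Pi\<^sub>M UNIV (\<lambda>_. ?p)) (\<lambda>x. \<lambda>i\<in>UNIV. x i) =
        Pi\<^sub>M UNIV (\<lambda>i. distr rademacher ?p (\<lambda>\<omega>. \<omega> i))"
      unfolding distr_rademacher by (simp only: rademacher_def)
  qed (simp, rule measurable_rademacher)
  moreover have "(\<lambda>x. x) \<in> ?p \<rightarrow>\<^sub>M borel"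
    by (rule measurableI) (simp_all add: space_uniform_count_measure sets_uniform_count_measure)
  ultimately show ?thesis
    using indep_vars_compose2[of "\<lambda>_. ?p" "\<lambda>i \<omega>. \<omega> i" UNIV "\<lambda>_ x. x" "\<lambda>_. borel"] by simp
qed

lemma prob_rademacher:
  assumes "c \<in> {-1, 1}"
  shows "measure rademacher {\<omega>\<in>space rademacher. \<omega> i = c} = 1/2"
proof -
  let ?p = "uniform_count_measure {-1, 1 :: real}"
  have "{\<omega>\<in>space rademacher. \<omega> i = c} = (\<lambda>\<omega>. \<omega> i) -` {c} \<inter> space rademacher"
    by blast
  then have "measure rademacher {\<omega>\<in>space rademacher. \<omega> i = c} =
      measure (distr rademacher ?p (\<lambda>\<omega>. \<omega> i)) {c}"
    using measure_distr[OF measurable_rademacher, of "{c}" i] assms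
    by (simp add: sets_uniform_count_measure)
  also have "\<dots> = measure ?p {c}"
    by (simp only: distr_rademacher)
  also have "\<dots> = 1/2"
    using assms by (subst measure_uniform_count_measure) auto
  finally show ?thesis .
qed

definition type_2_operator ::
    "'a::real_vector nspace \<Rightarrow> 'b::real_vector nspace \<Rightarrow> ('a \<Rightarrow> 'b) \<Rightarrow> bool" where
  "type_2_operator E F A \<longleftrightarrow> bounded_operator E F A \<and>
     (\<exists>C\<ge>0. \<forall>(n::nat) x. (\<forall>i<n. x i \<in> vecs E) \<longrightarrow>
        (\<integral>\<omega>. nrm F (\<Sum>i<n. \<omega> i *\<^sub>R A (x i)) \<partial>rademacher) \<le> C * sqrt (\<Sum>i<n. (nrm E (x i))\<^sup>2))"

definition cotype_2_operator ::
    "'a::real_vector nspace \<Rightarrow> 'b::real_vector nspace \<Rightarrow> ('a \<Rightarrow> 'b) \<Rightarrow> bool" where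
  "cotype_2_operator E F A \<longleftrightarrow> bounded_operator E F A \<and>
     (\<exists>C\<ge>0. \<forall>(n::nat) x. (\<forall>i<n. x i \<in> vecs E) \<longrightarrow>
        sqrt (\<Sum>i<n. (nrm F (A (x i)))\<^sup>2) \<le> C * (\<integral>\<omega>. nrm E (\<Sum>i<n. \<omega> i *\<^sub>R x i) \<partial>rademacher))"

definition type_2 :: "'a::real_vector nspace \<Rightarrow> bool" where
  "type_2 E \<longleftrightarrow> type_2_operator E E id"

definition cotype_2 :: "'a::real_vector nspace \<Rightarrow> bool" where
  "cotype_2 E \<longleftrightarrow> cotype_2_operator E E id"

end

theory Submission
  imports Defs
begin

text \<open>
  Both hypotheses imply one inequality between finite families in \<open>E\<close>, called Gram domination
  below: whenever \<open>\<Sum>i<n. x i s * x i t = \<Sum>i<n. y i s * y i t\<close> for all points \<open>s\<close>, \<open>t\<close>, then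
  \<open>\<Sum>i<n. (nrm F (y i))\<^sup>2 \<le> K * (\<Sum>i<n. (nrm E (x i))\<^sup>2)\<close>.  The theorem follows from this inequality
  in two steps.

  \<^item> By Hahn--Banach, Gram domination yields a linear functional on the functions of two variables
    whose value at the kernel \<open>(s, t) \<mapsto> f s * f t\<close> lies between \<open>(nrm F f)\<^sup>2\<close> and
    \<open>K * (nrm E f)\<^sup>2\<close>, for each \<open>f\<close> in \<open>E\<close>.  Since elements of \<open>E\<close> are functions, such kernels play
    the role of the tensors \<open>f \<otimes> f\<close>, so no tensor product has to be built.  The functional is an
    inner product \<open>B\<close> on \<open>E\<close> whose norm is at least that of \<open>F\<close> and at most \<open>sqrt K\<close> times that of
    \<open>E\<close>.

  \<^item> The completion of \<open>E\<close> for \<open>B\<close> need not inject into \<open>F\<close>.  The space \<open>H\<close> is its image, and the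
    square of the quotient norm on \<open>H\<close> is the lower semicontinuous envelope in \<open>F\<close> of the quadratic
    form \<open>B f f\<close>.  The envelope satisfies the parallelogram law, so that sequences which
    attain it can be added, and the inner product of \<open>H\<close> is a limit of values of \<open>B\<close>
    along such sequences.  Completeness of \<open>H\<close> follows from that of \<open>F\<close> and lower semicontinuity.

  Gram domination rests on one fact of linear algebra: two families with the same Gram matrix can be
  moved by plane rotations and sign changes to the same family
  (\<open>equal_gram_imp_common_rotation\<close>).  If the inclusion is 2-summing, then
  \<open>\<Sum>i<n. (\<phi> (x i))\<^sup>2 = \<Sum>i<n. (\<phi> (y i))\<^sup>2\<close> for every functional \<open>\<phi>\<close>, because both sides are invariant
  under rotations, and the 2-summing inequality for \<open>y\<close> is bounded by the norms of the \<open>x i\<close>.  If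
  \<open>E\<close> has type 2 and \<open>F\<close> has cotype 2, then averages over Rademacher signs are not
  invariant under rotations, but averages over independent Gaussian coefficients are.  Applying the
  type and cotype inequalities to the vectors \<open>g i *\<^sub>R x i\<close> and integrating over Gaussian \<open>g\<close> turns
  them into inequalities for the Gaussian average, since a Gaussian average does not change
  when its vectors are multiplied by signs.  To pass from the Gaussian average in \<open>F\<close> to the one in \<open>E\<close> the
  inclusion has to be bounded, which is the closed graph theorem for spaces with continuous point
  evaluations (\<open>inclusion_bounded\<close>).
\<close>

section \<open>Normed spaces with an explicit carrier\<close>

lemma normed_space_mem:
  assumes "normed_space E"
  shows normed_space_subspace: "subspace (vecs E)"
    and normed_space_zero: "0 \<in> vecs E"
    and normed_space_add: "f \<in> vecs E \<Longrightarrow> g \<in> vecs E \<Longrightarrow> f + g \<in> vecs E"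
    and normed_space_diff: "f \<in> vecs E \<Longrightarrow> g \<in> vecs E \<Longrightarrow> f - g \<in> vecs E"
    and normed_space_minus: "f \<in> vecs E \<Longrightarrow> - f \<in> vecs E"
    and normed_space_scale: "f \<in> vecs E \<Longrightarrow> c *\<^sub>R f \<in> vecs E"
    and normed_space_sum: "(\<And>i. i \<in> I \<Longrightarrow> x i \<in> vecs E) \<Longrightarrow> (\<Sum>i\<in>I. x i) \<in> vecs E"
proof -
  show S: "subspace (vecs E)"
    using assms by (simp add: normed_space_def)
  show "0 \<in> vecs E"
    and "f \<in> vecs E \<Longrightarrow> g \<in> vecs E \<Longrightarrow> f + g \<in> vecs E"
    and "f \<in> vecs E \<Longrightarrow> g \<in> vecs E \<Longrightarrow> f - g \<in> vecs E"
    and "f \<in> vecs E \<Longrightarrow> - f \<in> vecs E"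
    and "f \<in> vecs E \<Longrightarrow> c *\<^sub>R f \<in> vecs E"
    and "(\<And>i. i \<in> I \<Longrightarrow> x i \<in> vecs E) \<Longrightarrow> (\<Sum>i\<in>I. x i) \<in> vecs E"
    using S by (auto intro: subspace_0 subspace_add subspace_diff subspace_neg subspace_scale subspace_sum)
qed

lemma normed_space_nrm:
  assumes "normed_space E"
  shows nrm_nonneg: "f \<in> vecs E \<Longrightarrow> 0 \<le> nrm E f"
    and nrm_eq_0: "f \<in> vecs E \<Longrightarrow> nrm E f = 0 \<longleftrightarrow> f = 0"
    and nrm_scale: "f \<in> vecs E \<Longrightarrow> nrm E (c *\<^sub>R f) = \<bar>c\<bar> * nrm E f"
    and nrm_add: "f \<in> vecs E \<Longrightarrow> g \<in> vecs E \<Longrightarrow> nrm E (f + g) \<le> nrm E f + nrm E g"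
  using assms by (auto simp: normed_space_def)

lemma nrm_zero: "normed_space E \<Longrightarrow> nrm E 0 = 0"
  by (simp add: nrm_eq_0 normed_space_zero)

lemma nrm_minus: "normed_space E \<Longrightarrow> f \<in> vecs E \<Longrightarrow> nrm E (- f) = nrm E f"
  using nrm_scale[of E f "-1"] by simp

lemma nrm_commute:
  "normed_space E \<Longrightarrow> f \<in> vecs E \<Longrightarrow> g \<in> vecs E \<Longrightarrow> nrm E (f - g) = nrm E (g - f)"
  using nrm_minus[of E "f - g"] by (simp add: normed_space_diff)

lemma nrm_diff_le:
  assumes "normed_space E" "f \<in> vecs E" "g \<in> vecs E"
  shows "nrm E (f - g) \<le> nrm E f + nrm E g"
  using nrm_add[OF assms(1), of f "- g"] assms by (simp add: nrm_minus normed_space_minus)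

lemma nrm_diff_triangle:
  assumes "normed_space E" "f \<in> vecs E" "g \<in> vecs E" "h \<in> vecs E"
  shows "nrm E (f - h) \<le> nrm E (f - g) + nrm E (g - h)"
  using nrm_add[OF assms(1), of "f - g" "g - h"] assms by (simp add: normed_space_diff)

lemma nrm_le_add_diff:
  assumes "normed_space E" "f \<in> vecs E" "g \<in> vecs E"
  shows "nrm E f \<le> nrm E g + nrm E (f - g)"
  using nrm_add[OF assms(1), of g "f - g"] assms by (simp add: normed_space_diff)

lemma abs_nrm_diff_le:
  assumes "normed_space E" "f \<in> vecs E" "g \<in> vecs E"
  shows "\<bar>nrm E f - nrm E g\<bar> \<le> nrm E (f - g)"
  using nrm_le_add_diff[OF assms] nrm_le_add_diff[OF assms(1,3,2)] nrm_commute[OF assms] by linarith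

lemma nrm_sum_le:
  assumes "normed_space E" "\<And>i. i \<in> I \<Longrightarrow> x i \<in> vecs E"
  shows "nrm E (\<Sum>i\<in>I. x i) \<le> (\<Sum>i\<in>I. nrm E (x i))"
  using assms(2)
proof (induction I rule: infinite_finite_induct)
  case (insert i I)
  then have "nrm E (x i + (\<Sum>i\<in>I. x i)) \<le> nrm E (x i) + nrm E (\<Sum>i\<in>I. x i)"
    by (intro nrm_add normed_space_sum assms(1)) auto
  with insert show ?case by fastforce
qed (simp_all add: nrm_zero assms(1))

lemma limitin_ntopology:
  assumes E: "normed_space E" and u: "\<And>n. u n \<in> vecs E"
  shows "limitin (ntopology E) u f sequentially \<longleftrightarrow>
    f \<in> vecs E \<and> (\<lambda>n. nrm E (u n - f)) \<longlonglongrightarrow> 0"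
proof -
  interpret Metric_space "vecs E" "ndist E" by (rule Metric_space_ndist[OF E])
  show ?thesis
    unfolding ntopology_def limitin_metric_dist_null using u by (auto simp: ndist_def)
qed

lemma banach_space_iff:
  "banach_space E \<longleftrightarrow> normed_space E \<and>
    (\<forall>u. (\<forall>n. u n \<in> vecs E) \<and> (\<forall>e>0. \<exists>N. \<forall>m\<ge>N. \<forall>n\<ge>N. nrm E (u m - u n) < e)
      \<longrightarrow> (\<exists>f\<in>vecs E. (\<lambda>n. nrm E (u n - f)) \<longlonglongrightarrow> 0))"
proof (cases "normed_space E")
  case True
  interpret Metric_space "vecs E" "ndist E" by (rule Metric_space_ndist[OF True])
  have "MCauchy u \<longleftrightarrow>
      (\<forall>n. u n \<in> vecs E) \<and> (\<forall>e>0. \<exists>N. \<forall>m\<ge>N. \<forall>n\<ge>N. nrm E (u m - u n) < e)" for u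
    unfolding MCauchy_def by (auto simp: ndist_def image_subset_iff; metis)
  moreover have "(\<forall>n. u n \<in> vecs E) \<Longrightarrow> limitin mtopology u f sequentially \<longleftrightarrow>
      f \<in> vecs E \<and> (\<lambda>n. nrm E (u n - f)) \<longlonglongrightarrow> 0" for u f
    using limitin_ntopology[OF True, of u f] by (simp add: ntopology_def)
  ultimately have "(MCauchy u \<longrightarrow> (\<exists>f. limitin mtopology u f sequentially)) \<longleftrightarrow> ((\<forall>n. u n \<in> vecs E) \<and>
      (\<forall>e>0. \<exists>N. \<forall>m\<ge>N. \<forall>n\<ge>N. nrm E (u m - u n) < e)
      \<longrightarrow> (\<exists>f\<in>vecs E. (\<lambda>n. nrm E (u n - f)) \<longlonglongrightarrow> 0))" for u
    by auto
  then have "mcomplete \<longleftrightarrow> (\<forall>u. (\<forall>n. u n \<in> vecs E) \<and>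
      (\<forall>e>0. \<exists>N. \<forall>m\<ge>N. \<forall>n\<ge>N. nrm E (u m - u n) < e)
      \<longrightarrow> (\<exists>f\<in>vecs E. (\<lambda>n. nrm E (u n - f)) \<longlonglongrightarrow> 0))"
    unfolding mcomplete_def by (intro iff_allI)
  with True show ?thesis by (simp add: banach_space_def)
qed (simp add: banach_space_def)

lemma banach_limit_exists:
  assumes "banach_space E" "\<And>n. u n \<in> vecs E"
    and "\<And>e. e > 0 \<Longrightarrow> \<exists>N. \<forall>m\<ge>N. \<forall>n\<ge>N. nrm E (u m - u n) < e"
  shows "\<exists>f\<in>vecs E. (\<lambda>n. nrm E (u n - f)) \<longlonglongrightarrow> 0"
  using assms unfolding banach_space_iff by blast

lemma embeddedI:
  assumes E: "normed_space E" and F: "normed_space F" and sub: "vecs E \<subseteq> vecs F"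
    and le: "\<And>f. f \<in> vecs E \<Longrightarrow> nrm F f \<le> C * nrm E f"
  shows "E \<hookrightarrow> F"
proof -
  interpret E: Metric_space "vecs E" "ndist E" by (rule Metric_space_ndist[OF E])
  have "\<exists>\<delta>>0. \<forall>g. g \<in> vecs E \<and> ndist E f g < \<delta> \<longrightarrow> ndist F (id f) (id g) < e"
    if f: "f \<in> vecs E" and e: "e > 0" for f e
  proof (intro exI[of _ "e / (\<bar>C\<bar> + 1)"] conjI allI impI)
    show "0 < e / (\<bar>C\<bar> + 1)" using e by simp
    fix g assume "g \<in> vecs E \<and> ndist E f g < e / (\<bar>C\<bar> + 1)"
    then have g: "g \<in> vecs E" and d: "nrm E (f - g) < e / (\<bar>C\<bar> + 1)"
      using f by (auto simp: ndist_def)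
    have fg: "f - g \<in> vecs E" using E f g by (rule normed_space_diff)
    have "nrm F (f - g) \<le> C * nrm E (f - g)" by (rule le[OF fg])
    also have "\<dots> \<le> (\<bar>C\<bar> + 1) * nrm E (f - g)"
      using nrm_nonneg[OF E fg] by (intro mult_right_mono) auto
    also have "\<dots> < e" using d by (simp add: pos_less_divide_eq mult.commute)
    finally show "ndist F (id f) (id g) < e" using f g sub by (auto simp: ndist_def)
  qed
  then show ?thesis
    unfolding embedded_def ntopology_def E.metric_continuous_map[OF Metric_space_ndist[OF F]]
    using sub by (auto simp: image_subset_iff)
qed

lemma proper_bsf_tendsto:
  assumes E: "proper_bsf E" and u: "\<And>n. u n \<in> vecs E" and f: "f \<in> vecs E"
    and lim: "(\<lambda>n. nrm E (u n - f)) \<longlonglongrightarrow> 0"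
  shows "(\<lambda>n. u n x) \<longlonglongrightarrow> f x"
proof -
  have "normed_space E" and "continuous_map (ntopology E) euclideanreal (\<lambda>f. f x)"
    using E by (auto simp: proper_bsf_def banach_space_def)
  with continuous_map_limit[OF this(2), of u f sequentially] limitin_ntopology[of E u f] u f lim
  show ?thesis by (simp add: o_def)
qed

lemma proper_bsf_embedded:
  assumes F: "proper_bsf F" and H: "banach_space H" and sub: "H \<hookrightarrow> F"
  shows "proper_bsf H"
proof -
  have "continuous_map (ntopology H) euclideanreal ((\<lambda>f. f x) \<circ> id)" for x
    using F sub unfolding proper_bsf_def embedded_def
    by (intro continuous_map_compose[of _ "ntopology F"]) auto
  with H show ?thesis by (simp add: proper_bsf_def o_def)
qed

section \<open>The Hahn--Banach theorem\<close>

definition sublinear :: "('a::real_vector \<Rightarrow> real) \<Rightarrow> bool" where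
  "sublinear p \<longleftrightarrow> (\<forall>u v. p (u + v) \<le> p u + p v) \<and> (\<forall>c\<ge>0. \<forall>u. p (c *\<^sub>R u) = c * p u)"

lemma sublinearD:
  assumes "sublinear p"
  shows "p (u + v) \<le> p u + p v" and "c \<ge> 0 \<Longrightarrow> p (c *\<^sub>R u) = c * p u" and "p 0 = 0"
    and "- p (- u) \<le> p u"
proof -
  show "p (u + v) \<le> p u + p v" and *: "c \<ge> 0 \<Longrightarrow> p (c *\<^sub>R u) = c * p u" for u v c
    using assms by (auto simp: sublinear_def)
  from *[of 0 0] show "p 0 = 0" by simp
  then show "- p (- u) \<le> p u"
    using assms[unfolded sublinear_def, THEN conjunct1, rule_format, of u "- u"] by simp
qed

text \<open>The homogeneity inequality for \<open>inverse c\<close> is the reverse of the one for \<open>c\<close>.\<close>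

lemma sublinearI:
  assumes add: "\<And>u v. p (u + v) \<le> p u + p v" and zero: "p 0 = 0"
    and scale: "\<And>c u. c > 0 \<Longrightarrow> p (c *\<^sub>R u) \<le> c * p u"
  shows "sublinear p"
proof -
  have "p (c *\<^sub>R u) = c * p u" if "c > 0" for c u
  proof (rule antisym)
    have "p (inverse c *\<^sub>R c *\<^sub>R u) \<le> inverse c * p (c *\<^sub>R u)"
      using that by (intro scale) simp
    with that show "c * p u \<le> p (c *\<^sub>R u)" by (simp add: field_simps)
  qed (rule scale[OF that])
  with add zero show ?thesis by (fastforce simp: sublinear_def le_less)
qed

text \<open>
  A chain of sublinear functionals below \<open>p\<close> is bounded below by \<open>\<lambda>u. - p (- u)\<close>, so that its
  pointwise infimum exists; this is the chain condition for Zorn's lemma.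
\<close>

lemma sublinear_INF_chain:
  fixes p :: "'a::real_vector \<Rightarrow> real"
  assumes ne: "C \<noteq> {}" and sub: "\<And>q. q \<in> C \<Longrightarrow> sublinear q \<and> q \<le> p"
    and chain: "\<And>q r. q \<in> C \<Longrightarrow> r \<in> C \<Longrightarrow> q \<le> r \<or> r \<le> q"
  defines "m \<equiv> \<lambda>u. INF q\<in>C. q u"
  shows "sublinear m" and "\<And>q. q \<in> C \<Longrightarrow> m \<le> q"
proof -
  have m: "m u = (INF q\<in>C. q u)" for u
    by (simp add: m_def)
  have bdd: "bdd_below ((\<lambda>q. q u) ` C)" for u
  proof (rule bdd_belowI2)
    fix q assume "q \<in> C"
    then show "- p (- u) \<le> q u"
      using sub[of q] sublinearD(4)[of q u] by (auto simp: le_fun_def intro: order_trans[OF le_imp_neg_le])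
  qed
  have lower: "m u \<le> q u" if "q \<in> C" for q u
    unfolding m by (rule cINF_lower[OF bdd that])
  then show "m \<le> q" if "q \<in> C" for q
    using that by (simp add: le_fun_def)
  show "sublinear m"
  proof (rule sublinearI)
    show "m (u + v) \<le> m u + m v" for u v
    proof -
      have "m (u + v) - q u \<le> r v" if q: "q \<in> C" and r: "r \<in> C" for q r
      proof -
        obtain s where s: "s \<in> C" "s \<le> q" "s \<le> r" using chain[OF q r] q r by blast
        have "m (u + v) \<le> s u + s v"
          using lower[OF s(1)] sublinearD(1)[of s u v] sub[OF s(1)] by (meson order_trans)
        also have "\<dots> \<le> q u + r v" using s by (intro add_mono) (auto simp: le_fun_def)
        finally show ?thesis by simp
      qed
      then have "m (u + v) - q u \<le> m v" if "q \<in> C" for q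
        using that ne unfolding m[of v] by (intro cINF_greatest) auto
      then have "m (u + v) - m v \<le> q u" if "q \<in> C" for q
        using that by (smt (verit))
      then have "m (u + v) - m v \<le> m u"
        using ne unfolding m[of u] by (intro cINF_greatest) auto
      then show ?thesis by simp
    qed
    have "m 0 = (INF q\<in>C. 0)"
      unfolding m by (rule INF_cong) (simp_all add: sub sublinearD(3))
    then show "m 0 = 0" using ne by simp
    show "m (c *\<^sub>R u) \<le> c * m u" if c: "c > 0" for c u
    proof -
      have "m (c *\<^sub>R u) / c \<le> m u"
        unfolding m[of u]
      proof (rule cINF_greatest[OF ne])
        fix q assume "q \<in> C"
        then show "m (c *\<^sub>R u) / c \<le> q u"
          using lower[of q "c *\<^sub>R u"] sublinearD(2)[of q c u] sub c by (simp add: field_simps)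
      qed
      with c show ?thesis by (simp add: field_simps)
    qed
  qed
qed

text \<open>
  For a direction \<open>w\<close>, the functional \<open>u \<mapsto> INF t\<ge>0. q (u + t *\<^sub>R w) - t * q w\<close> is sublinear and below \<open>q\<close>.
  By minimality it is \<open>q\<close>, and its value at \<open>- w\<close>, estimated with \<open>t = 1\<close>, gives \<open>q (- w) \<le> - q w\<close>.
  A sublinear functional that is odd is linear.
\<close>

lemma minimal_sublinear_imp_linear:
  assumes q: "sublinear q" and min: "\<And>r. sublinear r \<Longrightarrow> r \<le> q \<Longrightarrow> r = q"
  shows "linear q"
proof -
  have neg: "q (- w) = - q w" for w
  proof -
    define r where "r = (\<lambda>u. INF t\<in>{0..}. q (u + t *\<^sub>R w) - t * q w)"
    have low: "- q (- u) \<le> q (u + t *\<^sub>R w) - t * q w" if "t \<ge> 0" for u t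
      using sublinearD(1)[OF q, of "u + t *\<^sub>R w" "- u"] sublinearD(2)[OF q that, of w] by simp
    have bdd: "bdd_below ((\<lambda>t. q (u + t *\<^sub>R w) - t * q w) ` {0..})" for u
      by (rule bdd_belowI2[of _ "- q (- u)"]) (auto intro: low)
    have lower: "r u \<le> q (u + t *\<^sub>R w) - t * q w" if "t \<ge> 0" for u t
      unfolding r_def by (rule cINF_lower[OF bdd]) (use that in auto)
    have "sublinear r"
    proof (rule sublinearI)
      show "r (u + v) \<le> r u + r v" for u v
      proof -
        have "r (u + v) - (q (u + s *\<^sub>R w) - s * q w) \<le> q (v + t *\<^sub>R w) - t * q w"
          if "s \<ge> 0" "t \<ge> 0" for s t
          using lower[of "s + t" "u + v"] sublinearD(1)[OF q, of "u + s *\<^sub>R w" "v + t *\<^sub>R w"] that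
          by (simp add: algebra_simps)
        then have "r (u + v) - (q (u + s *\<^sub>R w) - s * q w) \<le> r v" if "s \<ge> 0" for s
          using that unfolding r_def by (intro cINF_greatest) auto
        then have "r (u + v) - r v \<le> q (u + s *\<^sub>R w) - s * q w" if "s \<ge> 0" for s
          using that by (smt (verit))
        then have "r (u + v) - r v \<le> r u"
          unfolding r_def by (intro cINF_greatest) auto
        then show ?thesis by simp
      qed
      show "r 0 = 0"
      proof (rule antisym)
        show "r 0 \<le> 0" using lower[of 0 0] sublinearD(3)[OF q] by simp
        show "0 \<le> r 0" unfolding r_def
          by (intro cINF_greatest) (use low[of _ 0] sublinearD(3)[OF q] in auto)
      qed
      show "r (c *\<^sub>R u) \<le> c * r u" if c: "c > 0" for c u
      proof -
        have "r (c *\<^sub>R u) / c \<le> q (u + t *\<^sub>R w) - t * q w" if t: "t \<ge> 0" for t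
          using lower[of "c * t" "c *\<^sub>R u"] sublinearD(2)[OF q, of c "u + t *\<^sub>R w"] c t
          by (simp add: field_simps scaleR_add_right)
        then have "r (c *\<^sub>R u) / c \<le> r u"
          unfolding r_def by (intro cINF_greatest) auto
        with c show ?thesis by (simp add: field_simps)
      qed
    qed
    moreover have "r \<le> q"
      using lower[of 0] by (simp add: le_fun_def)
    ultimately have "r = q" by (rule min)
    then have "q (- w) \<le> - q w"
      using lower[of 1 "- w"] sublinearD(3)[OF q] by simp
    then show ?thesis using sublinearD(4)[OF q, of w] by simp
  qed
  show ?thesis
  proof (rule linearI)
    fix u v
    have "q u \<le> q (u + v) + q (- v)"
      using sublinearD(1)[OF q, of "u + v" "- v"] by simp
    then show "q (u + v) = q u + q v"
      using sublinearD(1)[OF q, of u v] neg[of v] by simp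
  next
    fix c u
    show "q (c *\<^sub>R u) = c *\<^sub>R q u"
      using sublinearD(2)[OF q, of c u] sublinearD(2)[OF q, of "- c" u] neg[of "c *\<^sub>R u"]
      by (cases "c \<ge> 0") auto
  qed
qed

lemma Hahn_Banach:
  fixes p :: "'a::real_vector \<Rightarrow> real"
  assumes p: "sublinear p"
  obtains l where "linear l" "\<And>u. l u \<le> p u"
proof -
  define A where "A = {q. sublinear q \<and> q \<le> p}"
  \<comment> \<open>Zorn's lemma for the reversed order, so that a maximal element is a minimal functional\<close>
  have "\<exists>m\<in>A. \<forall>a\<in>A. a \<le> m \<longrightarrow> a = m"
  proof (rule predicate_Zorn)
    show "partial_order_on A (relation_of (\<lambda>x y. y \<le> x) A)"
      by (rule partial_order_on_relation_ofI) auto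
    fix C assume C: "C \<in> Chains (relation_of (\<lambda>x y. y \<le> x) A)"
    then have CA: "\<And>q. q \<in> C \<Longrightarrow> sublinear q \<and> q \<le> p"
      and chain: "\<And>q r. q \<in> C \<Longrightarrow> r \<in> C \<Longrightarrow> q \<le> r \<or> r \<le> q"
      by (auto simp: Chains_def relation_of_def A_def)
    show "\<exists>u\<in>A. \<forall>a\<in>C. u \<le> a"
    proof (cases "C = {}")
      case True
      with p show ?thesis by (auto simp: A_def)
    next
      case False
      have m: "sublinear (\<lambda>u. INF q\<in>C. q u)" "\<And>q. q \<in> C \<Longrightarrow> (\<lambda>u. INF q\<in>C. q u) \<le> q"
        using sublinear_INF_chain[OF False, of p] CA chain by blast+
      from False obtain q where "q \<in> C" by blast
      with m(2)[OF this] CA have "(\<lambda>u. INF q\<in>C. q u) \<le> p" by (meson order_trans)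
      with m show ?thesis by (intro bexI[of _ "\<lambda>u. INF q\<in>C. q u"]) (auto simp: A_def)
    qed
  qed
  then obtain m where m: "sublinear m" "m \<le> p" and min: "\<And>a. a \<in> A \<Longrightarrow> a \<le> m \<Longrightarrow> a = m"
    by (auto simp: A_def)
  have "linear m"
    using m by (intro minimal_sublinear_imp_linear min) (auto simp: A_def)
  with m show thesis by (intro that) (auto simp: le_fun_def)
qed

text \<open>
  A separation form of the Hahn--Banach theorem.  The majorant is \<open>t \<mapsto> Inf {r. (t, r) \<in> C}\<close>, which is
  finite only on the projection \<open>D\<close> of the cone; composing it with a linear projection onto \<open>D\<close>
  makes it sublinear on the whole space.
\<close>

lemma linear_below_convex_cone:
  fixes C :: "('a::real_vector \<times> real) set"
  assumes add: "\<And>t r t' r'. (t, r) \<in> C \<Longrightarrow> (t', r') \<in> C \<Longrightarrow> (t + t', r + r') \<in> C"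
    and scale: "\<And>c t r. c > 0 \<Longrightarrow> (t, r) \<in> C \<Longrightarrow> (c *\<^sub>R t, c * r) \<in> C"
    and zero: "(0, 0) \<in> C" and nonneg: "\<And>r. (0, r) \<in> C \<Longrightarrow> r \<ge> 0"
    and sym: "\<And>t r. (t, r) \<in> C \<Longrightarrow> \<exists>r'. (- t, r') \<in> C"
  obtains l where "linear l" "\<And>t r. (t, r) \<in> C \<Longrightarrow> l t \<le> r"
proof -
  define D where "D = fst ` C"
  have D: "t \<in> D \<longleftrightarrow> (\<exists>r. (t, r) \<in> C)" for t
    by (force simp: D_def)
  have sc: "c *\<^sub>R t \<in> D" if "t \<in> D" for c t
  proof -
    consider "c > 0" | "c = 0" | "c < 0" by linarith
    then show ?thesis
    proof cases
      case 3
      with that obtain r' where "(- t, r') \<in> C" using sym by (auto simp: D)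
      with scale[of "- c" "- t" r'] 3 show ?thesis by (auto simp: D)
    qed (use that scale zero in \<open>auto simp: D\<close>)
  qed
  have subD: "subspace D"
  proof (rule subspaceI)
    show "0 \<in> D" using zero unfolding D by blast
    show "s + t \<in> D" if "s \<in> D" "t \<in> D" for s t using that add unfolding D by blast
  qed (rule sc)
  define p0 where "p0 t = Inf {r. (t, r) \<in> C}" for t
  have bdd: "bdd_below {r. (t, r) \<in> C}" if "t \<in> D" for t
  proof -
    from that sym obtain r' where r': "(- t, r') \<in> C" by (auto simp: D)
    show ?thesis
      by (rule bdd_belowI[of _ "- r'"]) (use add[OF _ r'] nonneg[of "_ + r'"] in fastforce)
  qed
  have low: "p0 t \<le> r" if "(t, r) \<in> C" for t r
    unfolding p0_def using that by (intro cInf_lower bdd) (auto simp: D)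
  have great: "b \<le> p0 t" if "t \<in> D" "\<And>r. (t, r) \<in> C \<Longrightarrow> b \<le> r" for b t
    unfolding p0_def using that by (intro cInf_greatest) (auto simp: D)
  obtain \<pi> where \<pi>: "range \<pi> \<subseteq> D" "linear \<pi>" "\<And>t. t \<in> D \<Longrightarrow> \<pi> t = t"
    using linear_exists_left_inverse_on[OF linear_id subD] by (auto simp: inj_on_def)
  have "sublinear (p0 \<circ> \<pi>)"
  proof (rule sublinearI)
    fix u v
    have uv: "\<pi> u \<in> D" "\<pi> v \<in> D" using \<pi>(1) by auto
    have "p0 (\<pi> u + \<pi> v) - r \<le> r'" if "(\<pi> u, r) \<in> C" "(\<pi> v, r') \<in> C" for r r'
      using low[OF add[OF that]] by simp
    then have "p0 (\<pi> u + \<pi> v) - r \<le> p0 (\<pi> v)" if "(\<pi> u, r) \<in> C" for r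
      using that uv by (intro great) auto
    then have "p0 (\<pi> u + \<pi> v) - p0 (\<pi> v) \<le> p0 (\<pi> u)"
      using uv by (intro great) (auto simp: algebra_simps)
    then show "(p0 \<circ> \<pi>) (u + v) \<le> (p0 \<circ> \<pi>) u + (p0 \<circ> \<pi>) v"
      by (simp add: linear_add[OF \<pi>(2)])
    have "p0 0 = 0"
      by (rule antisym[OF low[OF zero] great]) (use nonneg zero in \<open>auto simp: D\<close>)
    then show "(p0 \<circ> \<pi>) 0 = 0" by (simp add: linear_0[OF \<pi>(2)])
    fix c :: real assume c: "c > 0"
    have "p0 (c *\<^sub>R \<pi> u) / c \<le> p0 (\<pi> u)"
      using uv(1) low[OF scale[OF c]] c by (intro great) (auto simp: field_simps)
    with c show "(p0 \<circ> \<pi>) (c *\<^sub>R u) \<le> c * (p0 \<circ> \<pi>) u"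
      by (simp add: linear_scale[OF \<pi>(2)] field_simps)
  qed
  then obtain l where l: "linear l" "\<And>u. l u \<le> (p0 \<circ> \<pi>) u"
    by (rule Hahn_Banach) blast
  show thesis
  proof (rule that[OF l(1)])
    fix t r assume tr: "(t, r) \<in> C"
    then have "\<pi> t = t" by (intro \<pi>(3)) (auto simp: D)
    with l(2)[of t] low[OF tr] show "l t \<le> r" by simp
  qed
qed

section \<open>The closed graph theorem for spaces of functions\<close>

text \<open>
  The sublevel sets \<open>D n\<close> of \<open>p\<close> cover the complete space, so by Baire's theorem the closure of one of
  them contains a ball.  As the sublevel sets are convex and symmetric, the ball can be moved to
  the origin.
\<close>

lemma seminorm_level_dense_in_ball:
  assumes E: "banach_space E"
    and add: "\<And>f g. f \<in> vecs E \<Longrightarrow> g \<in> vecs E \<Longrightarrow> p (f + g) \<le> p f + p g"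
    and scale: "\<And>c f. f \<in> vecs E \<Longrightarrow> p (c *\<^sub>R f) = \<bar>c\<bar> * p f"
  shows "\<exists>(n::nat) r. r > 0 \<and> (\<forall>g\<in>vecs E. nrm E g < r \<longrightarrow>
    (\<forall>e>0. \<exists>d\<in>vecs E. p d \<le> real n \<and> nrm E (g - d) < e))"
proof -
  have N: "normed_space E" and mc: "Metric_space.mcomplete (vecs E) (ndist E)"
    using E by (auto simp: banach_space_def)
  interpret Metric_space "vecs E" "ndist E" by (rule Metric_space_ndist[OF N])
  note mem = normed_space_zero[OF N] normed_space_add[OF N] normed_space_diff[OF N] normed_space_minus[OF N] normed_space_scale[OF N]
  define D where "D n = {f \<in> vecs E. p f \<le> real n}" for n :: nat
  have cover: "(\<Union>n. mtopology closure_of D n) = vecs E"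
  proof
    show "(\<Union>n. mtopology closure_of D n) \<subseteq> vecs E"
      using closure_of_subset_topspace[of mtopology] by fastforce
    have "f \<in> mtopology closure_of D (nat \<lceil>p f\<rceil>)" if "f \<in> vecs E" for f
    proof -
      have "D (nat \<lceil>p f\<rceil>) \<subseteq> mtopology closure_of D (nat \<lceil>p f\<rceil>)"
        by (intro closure_of_subset) (auto simp: D_def)
      moreover have "f \<in> D (nat \<lceil>p f\<rceil>)" using that by (simp add: D_def real_nat_ceiling_ge)
      ultimately show ?thesis by blast
    qed
    then show "vecs E \<subseteq> (\<Union>n. mtopology closure_of D n)" by blast
  qed
  have "\<exists>n. mtopology interior_of (mtopology closure_of D n) \<noteq> {}"
  proof (rule ccontr)
    assume "\<not> ?thesis"
    then have "mtopology interior_of (\<Union>(range (\<lambda>n. mtopology closure_of D n))) = {}"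
      by (intro metric_Baire_category_alt[OF mc]) auto
    then have "mtopology interior_of (vecs E) = {}" by (simp add: cover)
    moreover have "mtopology interior_of (topspace mtopology) = topspace mtopology"
      by (rule interior_of_topspace)
    ultimately show False using mem(1) by auto
  qed
  then obtain n f0 where f0: "f0 \<in> mtopology interior_of (mtopology closure_of D n)" by blast
  then obtain r where r: "r > 0" "mball f0 r \<subseteq> mtopology closure_of D n"
    using openin_interior_of[of mtopology "mtopology closure_of D n"]
      interior_of_subset[of mtopology "mtopology closure_of D n"]
    unfolding openin_mtopology by blast
  have f0E: "f0 \<in> vecs E"
    using f0 interior_of_subset_topspace[of mtopology "mtopology closure_of D n"] by auto
  have near: "\<exists>d\<in>vecs E. p d \<le> real n \<and> nrm E (f0 + g - d) < e"
    if g: "g \<in> vecs E" "nrm E g < r" and e: "e > 0" for g e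
  proof -
    have "nrm E (f0 - (f0 + g)) = nrm E g"
      using nrm_minus[OF N g(1)] by simp
    then have "f0 + g \<in> mball f0 r"
      using g f0E by (simp add: in_mball ndist_def mem)
    then have "\<forall>e>0. \<exists>y\<in>D n. y \<in> mball (f0 + g) e"
      using r(2) unfolding metric_closure_of by blast
    with e obtain d where "d \<in> D n" "d \<in> mball (f0 + g) e" by blast
    then show ?thesis
      by (intro bexI[of _ d]) (auto simp: D_def in_mball ndist_def split: if_splits)
  qed
  show ?thesis
  proof (intro exI[of _ n] exI[of _ r] conjI r(1) ballI impI allI)
    fix g and e :: real assume g: "g \<in> vecs E" "nrm E g < r" and e: "e > 0"
    obtain d where d: "d \<in> vecs E" "p d \<le> real n" "nrm E (f0 + g - d) < e"
      using near[OF g e] by blast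
    have "nrm E (-1 *\<^sub>R g) < r" using g nrm_scale[OF N g(1), of "-1"] by simp
    from near[OF _ this e] g obtain d' where d': "d' \<in> vecs E" "p d' \<le> real n" "nrm E (f0 - g - d') < e"
      using normed_space_minus[OF N g(1)] by auto
    \<comment> \<open>averaging an approximation of \<open>f0 + g\<close> with the negative of one of \<open>f0 - g\<close> removes \<open>f0\<close>\<close>
    define h where "h = (1/2) *\<^sub>R (d + -1 *\<^sub>R d')"
    have h: "h \<in> vecs E" using d d' by (simp add: h_def mem)
    have "p (d + -1 *\<^sub>R d') \<le> p d + p d'"
      using add[of d "-1 *\<^sub>R d'"] scale[of d' "-1"] d d' by (simp add: mem)
    then have ph: "p h \<le> real n"
      using scale[of "d + -1 *\<^sub>R d'" "1/2"] d d' by (simp add: h_def mem)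
    have gh: "g - h = (1/2) *\<^sub>R ((f0 + g - d) - (f0 - g - d'))"
      by (simp add: h_def algebra_simps flip: scaleR_add_left)
    have "nrm E ((f0 + g - d) - (f0 - g - d')) \<le> nrm E (f0 + g - d) + nrm E (f0 - g - d')"
      using f0E g d d' by (intro nrm_diff_le[OF N]) (auto simp: mem)
    then have "nrm E (g - h) < e"
      unfolding gh using nrm_scale[OF N, of "(f0 + g - d) - (f0 - g - d')" "1/2"] f0E g d d'
      by (simp add: mem)
    with h ph show "\<exists>d\<in>vecs E. p d \<le> real n \<and> nrm E (g - d) < e" by blast
  qed
qed

text \<open>
  Zabreiko's lemma.  By the preceding density, every vector of a small ball is the sum of a series
  whose terms have geometrically decreasing \<open>p\<close>, and the last hypothesis bounds \<open>p\<close> of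
  the sum.
\<close>

lemma countably_subadditive_seminorm_bounded:
  assumes E: "banach_space E"
    and add: "\<And>f g. f \<in> vecs E \<Longrightarrow> g \<in> vecs E \<Longrightarrow> p (f + g) \<le> p f + p g"
    and scale: "\<And>c f. f \<in> vecs E \<Longrightarrow> p (c *\<^sub>R f) = \<bar>c\<bar> * p f"
    and series: "\<And>f u a. f \<in> vecs E \<Longrightarrow> (\<And>k. u k \<in> vecs E) \<Longrightarrow> (\<And>k. p (u k) \<le> a * (1/2)^k) \<Longrightarrow>
      (\<lambda>n. nrm E ((\<Sum>k<n. u k) - f)) \<longlonglongrightarrow> 0 \<Longrightarrow> p f \<le> 2 * a"
  shows "\<exists>C\<ge>0. \<forall>f\<in>vecs E. p f \<le> C * nrm E f"
proof -
  have N: "normed_space E" using E by (simp add: banach_space_def)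
  note mem = normed_space_zero[OF N] normed_space_add[OF N] normed_space_diff[OF N] normed_space_minus[OF N] normed_space_scale[OF N]
  obtain n :: nat and r :: real where r: "r > 0"
    and dense: "\<And>g e. g \<in> vecs E \<Longrightarrow> nrm E g < r \<Longrightarrow> e > 0 \<Longrightarrow>
      \<exists>d\<in>vecs E. p d \<le> real n \<and> nrm E (g - d) < e"
  proof -
    have "\<exists>(n::nat) r. r > 0 \<and> (\<forall>g\<in>vecs E. nrm E g < r \<longrightarrow>
        (\<forall>e>0. \<exists>d\<in>vecs E. p d \<le> real n \<and> nrm E (g - d) < e))"
      by (rule seminorm_level_dense_in_ball[OF E]) (simp_all add: add scale)
    with that show thesis by metis
  qed
  have dense_scaled: "\<exists>d\<in>vecs E. p d \<le> real n * (1/2)^k \<and> nrm E (g - d) < r * (1/2)^Suc k"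
    if g: "g \<in> vecs E" "nrm E g < r * (1/2)^k" for g k
  proof -
    have "nrm E (2^k *\<^sub>R g) < r"
      using g nrm_scale[OF N g(1), of "2^k"] by (simp add: field_simps power_divide)
    from dense[OF _ this, of "r/2"] g r obtain d where
      d: "d \<in> vecs E" "p d \<le> real n" "nrm E (2^k *\<^sub>R g - d) < r/2"
      by (auto simp: mem)
    have "g - (1/2)^k *\<^sub>R d = (1/2)^k *\<^sub>R (2^k *\<^sub>R g - d)"
      by (simp add: scaleR_diff_right flip: power_mult_distrib)
    then have "nrm E (g - (1/2)^k *\<^sub>R d) = (1/2)^k * nrm E (2^k *\<^sub>R g - d)"
      using nrm_scale[OF N, of "2^k *\<^sub>R g - d" "(1/2)^k"] g d by (simp add: mem)
    also have "\<dots> < (1/2)^k * (r/2)" using d by (intro mult_strict_left_mono) auto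
    finally have "nrm E (g - (1/2)^k *\<^sub>R d) < r * (1/2)^Suc k"
      by (simp add: mult.commute)
    moreover have "p ((1/2)^k *\<^sub>R d) \<le> real n * (1/2)^k"
      using scale[of d "(1/2)^k"] d by (simp add: mult.commute)
    ultimately show ?thesis using d by (intro bexI[of _ "(1/2)^k *\<^sub>R d"]) (auto simp: mem)
  qed
  have small: "p f \<le> 2 * real n" if f: "f \<in> vecs E" "nrm E f < r" for f
  proof -
    \<comment> \<open>\<open>g k\<close> is the part of \<open>f\<close> that remains after \<open>k\<close> terms of the series\<close>
    have "\<exists>g. \<forall>k. (g k \<in> vecs E \<and> nrm E (g k) < r * (1/2)^k \<and> (k = 0 \<longrightarrow> g k = f)) \<and>
        (g k - g (Suc k) \<in> vecs E \<and> p (g k - g (Suc k)) \<le> real n * (1/2)^k)"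
    proof (rule dependent_nat_choice)
      show "\<exists>x. x \<in> vecs E \<and> nrm E x < r * (1/2)^0 \<and> (0 = 0 \<longrightarrow> x = f)" using f by auto
      fix x and k :: nat assume "x \<in> vecs E \<and> nrm E x < r * (1/2)^k \<and> (k = 0 \<longrightarrow> x = f)"
      then have x: "x \<in> vecs E" "nrm E x < r * (1/2)^k" by auto
      from dense_scaled[OF this] obtain d where
        "d \<in> vecs E" "p d \<le> real n * (1/2)^k" "nrm E (x - d) < r * (1/2)^Suc k" by blast
      with x show "\<exists>y. (y \<in> vecs E \<and> nrm E y < r * (1/2)^Suc k \<and> (Suc k = 0 \<longrightarrow> y = f)) \<and>
          x - y \<in> vecs E \<and> p (x - y) \<le> real n * (1/2)^k"
        by (intro exI[of _ "x - d"]) (auto simp: mem)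
    qed
    then obtain g where g: "\<And>k. g k \<in> vecs E" "\<And>k. nrm E (g k) < r * (1/2)^k" "g 0 = f"
      "\<And>k. p (g k - g (Suc k)) \<le> real n * (1/2)^k" by blast
    have "(\<Sum>k<m. g k - g (Suc k)) - f = - g m" for m
      by (subst sum_lessThan_telescope') (simp add: g(3))
    then have eq: "nrm E ((\<Sum>k<m. g k - g (Suc k)) - f) = nrm E (g m)" for m
      using nrm_minus[OF N g(1)] by simp
    have "(\<lambda>k. r * (1/2)^k) \<longlonglongrightarrow> r * 0"
      by (intro tendsto_intros LIMSEQ_power_zero) simp
    then have "(\<lambda>m. nrm E ((\<Sum>k<m. g k - g (Suc k)) - f)) \<longlonglongrightarrow> 0"
      unfolding eq using g(2) nrm_nonneg[OF N g(1)]
      by (intro tendsto_sandwich[OF _ _ tendsto_const, of _ "\<lambda>m. nrm E (g m)"])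
        (auto intro: always_eventually less_imp_le)
    then show ?thesis
      using g f by (intro series[of f "\<lambda>k. g k - g (Suc k)"]) (auto simp: mem)
  qed
  show ?thesis
  proof (intro exI[of _ "4 * real n / r"] conjI ballI)
    show "0 \<le> 4 * real n / r" using r by simp
    fix f assume f: "f \<in> vecs E"
    show "p f \<le> 4 * real n / r * nrm E f"
    proof (cases "f = 0")
      case True
      then show ?thesis using scale[of 0 0] mem(1) by (simp add: nrm_zero[OF N])
    next
      case False
      then have pos: "nrm E f > 0" using nrm_nonneg[OF N f] nrm_eq_0[OF N f] by linarith
      define t where "t = r / (2 * nrm E f)"
      have t: "t > 0" "t * nrm E f < r" using pos r by (auto simp: t_def)
      have "p (t *\<^sub>R f) \<le> 2 * real n"
        using t f nrm_scale[OF N f, of t] by (intro small) (auto simp: mem)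
      then have "t * p f \<le> 2 * real n" using scale[OF f, of t] t by simp
      then show ?thesis using pos r by (simp add: t_def field_simps)
    qed
  qed
qed

text \<open>
  The norm of \<open>F\<close> is countably subadditive on \<open>E\<close>: a series that converges in both spaces has the same
  sum in both, because point evaluations are continuous in each.
\<close>

lemma inclusion_bounded:
  assumes E: "proper_bsf E" and F: "proper_bsf F" and sub: "vecs E \<subseteq> vecs F"
  shows "\<exists>C\<ge>0. \<forall>f\<in>vecs E. nrm F f \<le> C * nrm E f"
proof (rule countably_subadditive_seminorm_bounded)
  have NE: "normed_space E" and NF: "normed_space F" and BF: "banach_space F"
    using E F by (auto simp: proper_bsf_def banach_space_def)
  show "banach_space E" using E by (simp add: proper_bsf_def)
  show "nrm F (c *\<^sub>R f) = \<bar>c\<bar> * nrm F f" if "f \<in> vecs E" for f c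
    using that sub nrm_scale[OF NF] by blast
  show "nrm F (f + g) \<le> nrm F f + nrm F g" if "f \<in> vecs E" "g \<in> vecs E" for f g
    using that sub nrm_add[OF NF] by blast
  fix f u a
  assume f: "f \<in> vecs E" and u: "\<And>k. u k \<in> vecs E" and a: "\<And>k. nrm F (u k) \<le> a * (1/2)^k"
    and lim: "(\<lambda>n. nrm E ((\<Sum>k<n. u k) - f)) \<longlonglongrightarrow> 0"
  define S where "S n = (\<Sum>k<n. u k)" for n
  have SE: "S n \<in> vecs E" for n unfolding S_def by (intro normed_space_sum[OF NE] u)
  then have SF: "S n \<in> vecs F" for n using sub by blast
  have geo: "(\<Sum>k\<in>{m..<n}. (1/2)^k) \<le> (2::real) * (1/2)^m" for m n :: nat
  proof (cases "m \<le> n")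
    case True
    then have "(\<Sum>k\<in>{m..<n}. (1/2::real)^k) = 2 * (1/2)^m - 2 * (1/2)^n"
      by (induction rule: dec_induct) simp_all
    then show ?thesis by simp
  qed simp
  have a0: "a \<ge> 0" using a[of 0] nrm_nonneg[OF NF, of "u 0"] u sub by force
  have tail: "nrm F (S n - S m) \<le> a * (2 * (1/2)^m)" if "m \<le> n" for m n
  proof -
    have "S n - S m = (\<Sum>k\<in>{m..<n}. u k)"
      using that sum_diff_nat_ivl[of 0 m n u] by (simp add: S_def lessThan_atLeast0)
    then have "nrm F (S n - S m) \<le> (\<Sum>k\<in>{m..<n}. nrm F (u k))"
      using nrm_sum_le[OF NF, of "{m..<n}" u] u sub by auto
    also have "\<dots> \<le> (\<Sum>k\<in>{m..<n}. a * (1/2)^k)" by (intro sum_mono a)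
    also have "\<dots> = a * (\<Sum>k\<in>{m..<n}. (1/2)^k)" by (simp only: sum_distrib_left)
    also have "\<dots> \<le> a * (2 * (1/2)^m)" by (intro mult_left_mono geo a0)
    finally show ?thesis .
  qed
  have "\<exists>M. \<forall>m\<ge>M. \<forall>n\<ge>M. nrm F (S m - S n) < e" if e: "e > 0" for e
  proof -
    have "(\<lambda>m. a * (2 * (1/2)^m)) \<longlonglongrightarrow> a * (2 * 0)"
      by (intro tendsto_intros LIMSEQ_power_zero) simp
    then obtain M where M: "\<And>m. m \<ge> M \<Longrightarrow> a * (2 * (1/2)^m) < e"
      using order_tendstoD(2)[of _ 0 sequentially e] e by (auto simp: eventually_sequentially)
    have "nrm F (S m - S n) < e" if "m \<ge> M" "n \<ge> M" for m n
    proof (cases "n \<le> m")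
      case True
      with tail[of n m] M[OF that(2)] show ?thesis by simp
    next
      case False
      with tail[of m n] M[OF that(1)] nrm_commute[OF NF SF SF, of m n] show ?thesis by simp
    qed
    then show ?thesis by blast
  qed
  then obtain l where l: "l \<in> vecs F" "(\<lambda>n. nrm F (S n - l)) \<longlonglongrightarrow> 0"
    using banach_limit_exists[OF BF, of S] SF by blast
  have "f = l"
  proof
    fix x
    have "(\<lambda>n. S n x) \<longlonglongrightarrow> f x"
      using proper_bsf_tendsto[OF E SE f] lim by (simp add: S_def)
    moreover have "(\<lambda>n. S n x) \<longlonglongrightarrow> l x" by (rule proper_bsf_tendsto[OF F SF l])
    ultimately show "f x = l x" by (rule LIMSEQ_unique)
  qed
  have "nrm F f \<le> 2 * a + nrm F (S n - f)" for n
  proof -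
    have "nrm F f \<le> nrm F (S n) + nrm F (f - S n)"
      using l(1) SF \<open>f = l\<close> by (intro nrm_le_add_diff[OF NF]) auto
    then show ?thesis
      using tail[of 0 n] nrm_commute[OF NF SF, of f n] l(1) \<open>f = l\<close> by (simp add: S_def)
  qed
  moreover have "(\<lambda>n. 2 * a + nrm F (S n - f)) \<longlonglongrightarrow> 2 * a + 0"
    using l(2) \<open>f = l\<close> by (intro tendsto_intros) simp
  ultimately show "nrm F f \<le> 2 * a"
    by (intro LIMSEQ_le_const[of _ "2 * a"]) auto
qed

section \<open>The lower semicontinuous envelope of a Hilbert form\<close>

text \<open>
  A form \<open>B\<close> on a subspace \<open>V\<close> of a Banach space \<open>F\<close> whose norm is stronger than that of \<open>F\<close>.  A
  nonzero vector of the completion of \<open>V\<close> for \<open>B\<close> may be sent to 0 in \<open>F\<close>; the constructions below use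
  limits in \<open>F\<close> only and so divide by such vectors.
\<close>

locale dominating_form =
  fixes F :: "'a::real_vector nspace" and V :: "'a set" and B :: "'a \<Rightarrow> 'a \<Rightarrow> real"
  assumes banach: "banach_space F" and V: "subspace V" and VF: "V \<subseteq> vecs F"
    and B_sym: "f \<in> V \<Longrightarrow> g \<in> V \<Longrightarrow> B f g = B g f"
    and B_add: "f \<in> V \<Longrightarrow> g \<in> V \<Longrightarrow> h \<in> V \<Longrightarrow> B (f + g) h = B f h + B g h"
    and B_scale: "f \<in> V \<Longrightarrow> g \<in> V \<Longrightarrow> B (c *\<^sub>R f) g = c * B f g"
    and dominates: "f \<in> V \<Longrightarrow> (nrm F f)\<^sup>2 \<le> B f f"
begin

lemma F: "normed_space F"
  using banach by (simp add: banach_space_def)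

lemma VD: "f \<in> V \<Longrightarrow> f \<in> vecs F"
  using VF by blast

lemmas F_mem = normed_space_zero[OF F] normed_space_add[OF F] normed_space_diff[OF F]
  normed_space_scale[OF F] VD
lemmas V_mem = subspace_0[OF V] subspace_add[OF V] subspace_diff[OF V] subspace_scale[OF V]

abbreviation Q :: "'a \<Rightarrow> real" where "Q f \<equiv> B f f"

lemma B_add_right: "f \<in> V \<Longrightarrow> g \<in> V \<Longrightarrow> h \<in> V \<Longrightarrow> B h (f + g) = B h f + B h g"
  using B_add[of f g h] B_sym by (simp add: V_mem)

lemma B_scale_right: "f \<in> V \<Longrightarrow> g \<in> V \<Longrightarrow> B g (c *\<^sub>R f) = c * B g f"
  using B_scale[of f g c] B_sym by (simp add: V_mem)

lemma Q_add: "f \<in> V \<Longrightarrow> g \<in> V \<Longrightarrow> Q (f + g) = Q f + 2 * B f g + Q g"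
  by (simp add: B_add B_add_right V_mem B_sym)

lemma Q_scale: "f \<in> V \<Longrightarrow> Q (c *\<^sub>R f) = c\<^sup>2 * Q f"
  by (simp add: B_scale B_scale_right V_mem power2_eq_square)

lemma Q_diff: "f \<in> V \<Longrightarrow> g \<in> V \<Longrightarrow> Q (f - g) = Q f - 2 * B f g + Q g"
  using Q_add[of f "-1 *\<^sub>R g"] Q_scale[of g "-1"] B_scale_right[of g f "-1"] V_mem(4)[of g "-1"] by simp

lemma Q_nonneg: "f \<in> V \<Longrightarrow> 0 \<le> Q f"
  using dominates[of f] zero_le_power2 order_trans by blast

text \<open>
  \<open>f\<close> is a limit in \<open>F\<close> of vectors of \<open>V\<close> whose form is at most \<open>M\<close> in the limit.  With the slack \<open>e\<close> in
  the bound, the set of levels \<open>M\<close> of a given \<open>f\<close> is closed, so that the infimum \<open>N f\<close> is attained.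
\<close>

definition approx_level :: "'a \<Rightarrow> real \<Rightarrow> bool" where
  "approx_level f M \<longleftrightarrow> (\<forall>e>0. \<exists>u\<in>V. nrm F (f - u) < e \<and> Q u < M + e)"

definition H :: "'a set" where
  "H = {f \<in> vecs F. \<exists>M. approx_level f M}"

definition N :: "'a \<Rightarrow> real" where
  "N f = Inf {M. approx_level f M}"

definition minimizing :: "'a \<Rightarrow> (nat \<Rightarrow> 'a) \<Rightarrow> bool" where
  "minimizing f u \<longleftrightarrow> (\<forall>n. u n \<in> V) \<and> (\<lambda>n. nrm F (f - u n)) \<longlonglongrightarrow> 0 \<and> (\<lambda>n. Q (u n)) \<longlonglongrightarrow> N f"

lemma approx_level_nonneg: "approx_level f M \<Longrightarrow> 0 \<le> M"
  unfolding approx_level_def by (meson Q_nonneg field_le_epsilon less_imp_le order_trans)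

lemma N_le: "approx_level f M \<Longrightarrow> N f \<le> M"
  unfolding N_def
  by (rule cInf_lower) (auto intro: bdd_belowI[of _ 0] approx_level_nonneg)

lemma approx_level_N:
  assumes "f \<in> H"
  shows "approx_level f (N f)"
  unfolding approx_level_def
proof (intro allI impI)
  fix e :: real assume e: "e > 0"
  from assms have "{M. approx_level f M} \<noteq> {}" by (auto simp: H_def)
  from cInf_lessD[OF this, of "N f + e / 2"] e
  obtain M where M: "approx_level f M" "M < N f + e / 2" by (auto simp: N_def)
  then obtain u where "u \<in> V" "nrm F (f - u) < e / 2" "Q u < M + e / 2"
    using e unfolding approx_level_def by (meson half_gt_zero)
  with M e show "\<exists>u\<in>V. nrm F (f - u) < e \<and> Q u < N f + e"
    by (intro bexI[of _ u]) auto
qed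

lemma N_nonneg: "f \<in> H \<Longrightarrow> 0 \<le> N f"
  by (intro approx_level_nonneg[of f] approx_level_N)

lemma HF: "f \<in> H \<Longrightarrow> f \<in> vecs F"
  by (simp add: H_def)

lemma V_approx_level: "f \<in> V \<Longrightarrow> approx_level f (Q f)"
  unfolding approx_level_def by (auto intro!: bexI[of _ f] simp: nrm_zero[OF F])

lemma VH: "f \<in> V \<Longrightarrow> f \<in> H"
  using V_approx_level by (auto simp: H_def VD)

lemma N_le_Q: "f \<in> V \<Longrightarrow> N f \<le> Q f"
  by (intro N_le V_approx_level)

text \<open>
  Near \<open>f\<close> the form cannot drop much below \<open>N f\<close>: otherwise a smaller level would be
  approximable.
\<close>

lemma N_lower_semicontinuous:
  assumes "d > 0"
  obtains e where "e > 0" "\<And>u. u \<in> V \<Longrightarrow> nrm F (f - u) < e \<Longrightarrow> N f - d < Q u"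
proof -
  have "\<not> approx_level f (N f - d)" using N_le[of f "N f - d"] assms by auto
  then obtain e where "e > 0" "\<forall>u\<in>V. nrm F (f - u) < e \<longrightarrow> Q u \<ge> N f - d + e"
    unfolding approx_level_def by (meson not_less)
  with that[of e] show thesis by force
qed

lemma eventually_Q_gt:
  assumes "\<And>n. u n \<in> V" "(\<lambda>n. nrm F (f - u n)) \<longlonglongrightarrow> 0" "d > 0"
  shows "eventually (\<lambda>n. N f - d < Q (u n)) sequentially"
proof -
  obtain e where e: "e > 0" "\<And>u. u \<in> V \<Longrightarrow> nrm F (f - u) < e \<Longrightarrow> N f - d < Q u"
    using N_lower_semicontinuous[OF assms(3)] by blast
  from order_tendstoD(2)[OF assms(2) e(1)] show ?thesis
    by eventually_elim (use e assms in auto)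
qed

lemma minimizing_exists:
  assumes f: "f \<in> H"
  obtains u where "minimizing f u"
proof -
  have "\<forall>n. \<exists>u\<in>V. nrm F (f - u) < inverse (real (Suc n)) \<and> Q u < N f + inverse (real (Suc n))"
    using approx_level_N[OF f] unfolding approx_level_def by simp
  then obtain u where u: "\<And>n. u n \<in> V" "\<And>n. nrm F (f - u n) < inverse (real (Suc n))"
      "\<And>n. Q (u n) < N f + inverse (real (Suc n))"
    by metis
  have lim: "(\<lambda>n. nrm F (f - u n)) \<longlonglongrightarrow> 0"
  proof (rule tendsto_sandwich[OF _ _ tendsto_const LIMSEQ_inverse_real_of_nat])
    show "eventually (\<lambda>n. 0 \<le> nrm F (f - u n)) sequentially"
      using u f by (intro always_eventually allI nrm_nonneg[OF F]) (simp add: F_mem HF)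
    show "eventually (\<lambda>n. nrm F (f - u n) \<le> inverse (real (Suc n))) sequentially"
      using u(2) by (simp add: less_imp_le)
  qed
  have "(\<lambda>n. Q (u n)) \<longlonglongrightarrow> N f"
  proof (rule order_tendstoI)
    fix a assume "a < N f"
    then show "eventually (\<lambda>n. a < Q (u n)) sequentially"
      using eventually_Q_gt[OF u(1) lim, of "N f - a"] by simp
  next
    fix a assume a: "N f < a"
    have "(\<lambda>n. N f + inverse (real (Suc n))) \<longlonglongrightarrow> N f + 0"
      by (intro tendsto_intros LIMSEQ_inverse_real_of_nat)
    then have "eventually (\<lambda>n. N f + inverse (real (Suc n)) < a) sequentially"
      using a by (intro order_tendstoD(2)) auto
    then show "eventually (\<lambda>n. Q (u n) < a) sequentially"
      by eventually_elim (use u(3) in \<open>force intro: less_trans\<close>)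
  qed
  with u lim that show thesis by (auto simp: minimizing_def)
qed

lemma nrm_le_N:
  assumes f: "f \<in> H"
  shows "(nrm F f)\<^sup>2 \<le> N f"
proof -
  obtain u where u: "\<And>n. u n \<in> V" "(\<lambda>n. nrm F (f - u n)) \<longlonglongrightarrow> 0" "(\<lambda>n. Q (u n)) \<longlonglongrightarrow> N f"
    using minimizing_exists[OF f] by (auto simp: minimizing_def)
  have "(\<lambda>n. sqrt (Q (u n)) + nrm F (f - u n)) \<longlonglongrightarrow> sqrt (N f) + 0"
    using u by (intro tendsto_intros)
  moreover have "nrm F f \<le> sqrt (Q (u n)) + nrm F (f - u n)" for n
    using nrm_le_add_diff[OF F HF[OF f] VD[OF u(1)], of n] real_le_rsqrt[OF dominates[OF u(1)], of n]
    by linarith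
  ultimately have "nrm F f \<le> sqrt (N f)"
    by (intro LIMSEQ_le_const[of _ "sqrt (N f)"]) auto
  then show ?thesis
    using nrm_nonneg[OF F HF[OF f]] N_nonneg[OF f] by (metis power2_le_iff_abs_le sqrt_le_D abs_of_nonneg real_sqrt_pow2 power_mono)
qed

lemma approx_level_add:
  assumes f: "f \<in> H" and g: "g \<in> H"
  shows "approx_level (f + g) (2 * N f + 2 * N g)"
  unfolding approx_level_def
proof (intro allI impI)
  fix e :: real assume e: "e > 0"
  obtain u where u: "u \<in> V" "nrm F (f - u) < e / 4" "Q u < N f + e / 4"
    using approx_level_N[OF f] e unfolding approx_level_def by (meson divide_pos_pos zero_less_numeral)
  obtain v where v: "v \<in> V" "nrm F (g - v) < e / 4" "Q v < N g + e / 4"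
    using approx_level_N[OF g] e unfolding approx_level_def by (meson divide_pos_pos zero_less_numeral)
  have "nrm F (f + g - (u + v)) \<le> nrm F (f - u) + nrm F (g - v)"
    using nrm_add[OF F, of "f - u" "g - v"] f g u v by (simp add: F_mem HF add_diff_add)
  moreover have "Q (u + v) \<le> 2 * Q u + 2 * Q v"
    using Q_nonneg[of "u - v"] u v by (simp add: Q_add Q_diff V_mem)
  ultimately show "\<exists>w\<in>V. nrm F (f + g - w) < e \<and> Q w < 2 * N f + 2 * N g + e"
    using u v e by (intro bexI[of _ "u + v"]) (auto simp: V_mem)
qed

lemma approx_level_scale:
  assumes f: "f \<in> H"
  shows "approx_level (c *\<^sub>R f) (c\<^sup>2 * N f)"
  unfolding approx_level_def
proof (intro allI impI)
  fix e :: real assume e: "e > 0"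
  define d where "d = e / (1 + \<bar>c\<bar> + c\<^sup>2)"
  have pos: "1 + \<bar>c\<bar> + c\<^sup>2 > 0" by (smt (verit) zero_le_power2)
  then have d: "d > 0" using e by (simp add: d_def)
  have ed: "d + \<bar>c\<bar> * d + c\<^sup>2 * d = e"
  proof -
    have "d + \<bar>c\<bar> * d + c\<^sup>2 * d = d * (1 + \<bar>c\<bar> + c\<^sup>2)" by (simp add: algebra_simps)
    with pos show ?thesis by (simp add: d_def)
  qed
  obtain u where u: "u \<in> V" "nrm F (f - u) < d" "Q u < N f + d"
    using approx_level_N[OF f] d unfolding approx_level_def by blast
  have "nrm F (c *\<^sub>R f - c *\<^sub>R u) = \<bar>c\<bar> * nrm F (f - u)"
    using nrm_scale[OF F, of "f - u" c] f u by (simp add: F_mem HF scaleR_diff_right)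
  also have "\<dots> \<le> \<bar>c\<bar> * d" using u by (intro mult_left_mono) auto
  finally have 1: "nrm F (c *\<^sub>R f - c *\<^sub>R u) < e"
    using ed d by (smt (verit) mult_nonneg_nonneg zero_le_power2)
  have "Q (c *\<^sub>R u) \<le> c\<^sup>2 * (N f + d)"
    unfolding Q_scale[OF u(1)] using u by (intro mult_left_mono) auto
  then have 2: "Q (c *\<^sub>R u) < c\<^sup>2 * N f + e"
    using ed d by (smt (verit) mult_nonneg_nonneg abs_ge_zero distrib_left)
  from 1 2 u show "\<exists>w\<in>V. nrm F (c *\<^sub>R f - w) < e \<and> Q w < c\<^sup>2 * N f + e"
    by (intro bexI[of _ "c *\<^sub>R u"]) (auto simp: V_mem)
qed

lemma subspace_H: "subspace H"
proof (rule subspaceI)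
  show "0 \<in> H" by (intro VH V_mem)
  show "f + g \<in> H" if "f \<in> H" "g \<in> H" for f g
    using approx_level_add[OF that] that by (auto simp: H_def F_mem)
  show "c *\<^sub>R f \<in> H" if "f \<in> H" for c f
    using approx_level_scale[OF that] that by (auto simp: H_def F_mem)
qed

lemmas H_mem = subspace_0[OF subspace_H] subspace_add[OF subspace_H] subspace_diff[OF subspace_H]
  subspace_scale[OF subspace_H] HF VH

lemma N_zero: "N 0 = 0"
  using N_le_Q[of 0] Q_scale[of 0 0] N_nonneg[of 0] by (simp add: V_mem H_mem)

lemma N_scale:
  assumes f: "f \<in> H"
  shows "N (c *\<^sub>R f) = c\<^sup>2 * N f"
proof (cases "c = 0")
  case False
  have "N (inverse c *\<^sub>R c *\<^sub>R f) \<le> (inverse c)\<^sup>2 * N (c *\<^sub>R f)"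
    using f by (intro N_le approx_level_scale H_mem(4))
  with False have "c\<^sup>2 * N f \<le> N (c *\<^sub>R f)"
    by (simp add: field_simps power_inverse)
  with N_le[OF approx_level_scale[OF f]] show ?thesis by (meson antisym)
qed (simp add: N_zero)

lemma tendsto_nrm_add:
  assumes "f \<in> vecs F" "g \<in> vecs F" "\<And>n. u n \<in> V" "\<And>n. v n \<in> V"
    and "(\<lambda>n. nrm F (f - u n)) \<longlonglongrightarrow> 0" "(\<lambda>n. nrm F (g - v n)) \<longlonglongrightarrow> 0"
  shows "(\<lambda>n. nrm F (f + g - (u n + v n))) \<longlonglongrightarrow> 0"
proof (rule tendsto_sandwich[where f = "\<lambda>_. 0" and h = "\<lambda>n. nrm F (f - u n) + nrm F (g - v n)"])
  show "(\<lambda>n. nrm F (f - u n) + nrm F (g - v n)) \<longlonglongrightarrow> 0"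
    using tendsto_add[OF assms(5,6)] by simp
  show "(\<lambda>n. 0) \<longlonglongrightarrow> (0::real)" by (rule tendsto_const)
  have "nrm F (f + g - (u n + v n)) \<le> nrm F (f - u n) + nrm F (g - v n)" for n
    using nrm_add[OF F, of "f - u n" "g - v n"] assms by (simp add: F_mem add_diff_add)
  then show "eventually (\<lambda>n. nrm F (f + g - (u n + v n)) \<le> nrm F (f - u n) + nrm F (g - v n)) sequentially"
    by simp
  show "eventually (\<lambda>n. 0 \<le> nrm F (f + g - (u n + v n))) sequentially"
    using assms by (intro always_eventually allI nrm_nonneg[OF F]) (simp add: F_mem)
qed

lemma tendsto_nrm_scale:
  assumes "f \<in> vecs F" "\<And>n. u n \<in> V" "(\<lambda>n. nrm F (f - u n)) \<longlonglongrightarrow> 0"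
  shows "(\<lambda>n. nrm F (c *\<^sub>R f - c *\<^sub>R u n)) \<longlonglongrightarrow> 0"
proof -
  have "(\<lambda>n. \<bar>c\<bar> * nrm F (f - u n)) \<longlonglongrightarrow> \<bar>c\<bar> * 0" by (intro tendsto_intros assms)
  moreover have "nrm F (c *\<^sub>R f - c *\<^sub>R u n) = \<bar>c\<bar> * nrm F (f - u n)" for n
    using nrm_scale[OF F, of "f - u n" c] assms by (simp add: F_mem scaleR_diff_right)
  ultimately show ?thesis by simp
qed

lemma minimizing_scale:
  assumes f: "f \<in> H" and u: "minimizing f u"
  shows "minimizing (c *\<^sub>R f) (\<lambda>n. c *\<^sub>R u n)"
proof -
  have "(\<lambda>n. c\<^sup>2 * Q (u n)) \<longlonglongrightarrow> c\<^sup>2 * N f"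
    using u by (intro tendsto_intros) (auto simp: minimizing_def)
  with u f show ?thesis
    by (auto simp: minimizing_def V_mem tendsto_nrm_scale HF Q_scale N_scale)
qed

text \<open>
  For sequences \<open>u\<close>, \<open>v\<close> minimizing for \<open>f\<close>, \<open>g\<close>, the sums \<open>u n + v n\<close> and differences \<open>u n - v n\<close>
  approximate \<open>f + g\<close> and \<open>f - g\<close>.  The parallelogram law of \<open>B\<close> and lower semicontinuity give the
  inequality in the limit.
\<close>

lemma N_parallelogram_le:
  assumes f: "f \<in> H" and g: "g \<in> H"
  shows "N (f + g) + N (f - g) \<le> 2 * N f + 2 * N g"
proof (rule field_le_epsilon)
  fix e :: real assume e: "e > 0"
  obtain u v where u: "minimizing f u" and v: "minimizing g v"
    using minimizing_exists f g by metis
  have mv: "minimizing (-1 *\<^sub>R g) (\<lambda>n. -1 *\<^sub>R v n)" by (rule minimizing_scale[OF g v])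
  have uv: "u n \<in> V" "v n \<in> V" for n using u v by (auto simp: minimizing_def)
  have "(\<lambda>n. nrm F (f + g - (u n + v n))) \<longlonglongrightarrow> 0"
    using u v f g by (intro tendsto_nrm_add) (auto simp: minimizing_def HF)
  from eventually_Q_gt[OF _ this, of "e/2"] e uv
  have 1: "eventually (\<lambda>n. N (f + g) - e/2 < Q (u n + v n)) sequentially"
    by (simp add: V_mem)
  have "(\<lambda>n. nrm F (f + -1 *\<^sub>R g - (u n + -1 *\<^sub>R v n))) \<longlonglongrightarrow> 0"
    using u mv f H_mem(4)[OF g, of "-1"] by (intro tendsto_nrm_add) (auto simp: minimizing_def HF)
  from eventually_Q_gt[OF _ this, of "e/2"] e uv
  have 2: "eventually (\<lambda>n. N (f - g) - e/2 < Q (u n - v n)) sequentially"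
    by (simp add: V_mem)
  have 3: "(\<lambda>n. 2 * Q (u n) + 2 * Q (v n) + e) \<longlonglongrightarrow> 2 * N f + 2 * N g + e"
    using u v by (intro tendsto_intros) (auto simp: minimizing_def)
  have "eventually (\<lambda>n. N (f + g) + N (f - g) \<le> 2 * Q (u n) + 2 * Q (v n) + e) sequentially"
    using 1 2 by eventually_elim (use uv in \<open>simp add: Q_add Q_diff\<close>)
  then show "N (f + g) + N (f - g) \<le> 2 * N f + 2 * N g + e"
    using tendsto_lowerbound[OF 3] by simp
qed

text \<open>
  The reverse inequality is the same one applied to \<open>f + g\<close> and \<open>f - g\<close>.
\<close>

lemma N_parallelogram:
  assumes f: "f \<in> H" and g: "g \<in> H"
  shows "N (f + g) + N (f - g) = 2 * N f + 2 * N g"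
proof -
  have 1: "(f + g) + (f - g) = 2 *\<^sub>R f" "(f + g) - (f - g) = 2 *\<^sub>R g"
    by (simp_all add: scaleR_2)
  have "N (2 *\<^sub>R f) + N (2 *\<^sub>R g) \<le> 2 * N (f + g) + 2 * N (f - g)"
    unfolding 1[symmetric] by (intro N_parallelogram_le H_mem(2,3) f g)
  with N_parallelogram_le[OF f g] show ?thesis by (simp add: N_scale f g)
qed

text \<open>
  In the limit, \<open>Q (u n + v n)\<close> and \<open>Q (u n - v n)\<close> are at least \<open>N (f + g)\<close> and \<open>N (f - g)\<close>, while their
  sum tends to \<open>N (f + g) + N (f - g)\<close> by the parallelogram laws.  So neither can exceed its lower
  bound.
\<close>

lemma minimizing_add:
  assumes f: "f \<in> H" and g: "g \<in> H" and u: "minimizing f u" and v: "minimizing g v"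
  shows "minimizing (f + g) (\<lambda>n. u n + v n)"
proof -
  have mv: "minimizing (-1 *\<^sub>R g) (\<lambda>n. -1 *\<^sub>R v n)" by (rule minimizing_scale[OF g v])
  have uv: "u n \<in> V" "v n \<in> V" for n using u v by (auto simp: minimizing_def)
  have plus: "(\<lambda>n. nrm F (f + g - (u n + v n))) \<longlonglongrightarrow> 0"
    using u v f g by (intro tendsto_nrm_add) (auto simp: minimizing_def HF)
  have minus: "(\<lambda>n. nrm F (f + -1 *\<^sub>R g - (u n + -1 *\<^sub>R v n))) \<longlonglongrightarrow> 0"
    using u mv f H_mem(4)[OF g, of "-1"] by (intro tendsto_nrm_add) (auto simp: minimizing_def HF)
  have "(\<lambda>n. Q (u n + v n)) \<longlonglongrightarrow> N (f + g)"
  proof (rule order_tendstoI)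
    fix a assume "a < N (f + g)"
    then show "eventually (\<lambda>n. a < Q (u n + v n)) sequentially"
      using eventually_Q_gt[OF _ plus, of "N (f + g) - a"] uv by (simp add: V_mem)
  next
    fix a assume "N (f + g) < a"
    define d where "d = (a - N (f + g)) / 2"
    have d: "d > 0" "2 * N f + 2 * N g < N (f - g) + N (f + g) + d"
      using \<open>N (f + g) < a\<close> N_parallelogram[OF f g] by (simp_all add: d_def field_simps)
    from eventually_Q_gt[OF _ minus d(1)] uv
    have 1: "eventually (\<lambda>n. N (f - g) - d < Q (u n - v n)) sequentially"
      by (simp add: V_mem)
    have "(\<lambda>n. 2 * Q (u n) + 2 * Q (v n)) \<longlonglongrightarrow> 2 * N f + 2 * N g"
      using u v by (intro tendsto_intros) (auto simp: minimizing_def)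
    from order_tendstoD(2)[OF this d(2)] 1
    show "eventually (\<lambda>n. Q (u n + v n) < a) sequentially"
      by eventually_elim (use uv in \<open>simp add: Q_add Q_diff d_def field_simps\<close>)
  qed
  with plus uv show ?thesis by (auto simp: minimizing_def V_mem)
qed

text \<open>
  Polarization of \<open>N\<close>.  Along minimizing sequences this is a limit of values of \<open>B\<close> and
  therefore inherits bilinearity.
\<close>

definition ip :: "'a \<Rightarrow> 'a \<Rightarrow> real" where
  "ip f g = (N (f + g) - N (f - g)) / 4"

lemma ip_self: "f \<in> H \<Longrightarrow> ip f f = N f"
  using N_scale[of f 2] by (simp add: ip_def N_zero flip: scaleR_2)

lemma tendsto_ip:
  assumes f: "f \<in> H" and g: "g \<in> H" and u: "minimizing f u" and v: "minimizing g v"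
  shows "(\<lambda>n. B (u n) (v n)) \<longlonglongrightarrow> ip f g"
proof -
  have uv: "u n \<in> V" "v n \<in> V" for n using u v by (auto simp: minimizing_def)
  have "minimizing (f + -1 *\<^sub>R g) (\<lambda>n. u n + -1 *\<^sub>R v n)"
    using f g u v by (intro minimizing_add minimizing_scale H_mem(4))
  then have "(\<lambda>n. (Q (u n + v n) - Q (u n - v n)) / 4) \<longlonglongrightarrow> (N (f + g) - N (f - g)) / 4"
    using minimizing_add[OF assms] by (intro tendsto_intros) (auto simp: minimizing_def)
  moreover have "B (u n) (v n) = (Q (u n + v n) - Q (u n - v n)) / 4" for n
    using uv by (simp add: Q_add Q_diff)
  ultimately show ?thesis by (simp only: ip_def)
qed

lemma ip_commute:
  assumes "f \<in> H" "g \<in> H"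
  shows "ip f g = ip g f"
  using N_scale[OF H_mem(3)[OF assms], of "-1"] by (simp add: ip_def add.commute)

lemma ip_add:
  assumes f: "f \<in> H" and g: "g \<in> H" and h: "h \<in> H"
  shows "ip (f + g) h = ip f h + ip g h"
proof -
  obtain u v w where m: "minimizing f u" "minimizing g v" "minimizing h w"
    using minimizing_exists f g h by metis
  then have V: "u n \<in> V" "v n \<in> V" "w n \<in> V" for n by (auto simp: minimizing_def)
  have "(\<lambda>n. B (u n + v n) (w n)) \<longlonglongrightarrow> ip (f + g) h"
    by (intro tendsto_ip minimizing_add m H_mem(2) f g h)
  moreover have "(\<lambda>n. B (u n) (w n) + B (v n) (w n)) \<longlonglongrightarrow> ip f h + ip g h"
    by (intro tendsto_add tendsto_ip m f g h)
  ultimately show ?thesis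
    using V by (simp add: B_add) (rule LIMSEQ_unique)
qed

lemma ip_scale:
  assumes f: "f \<in> H" and g: "g \<in> H"
  shows "ip (c *\<^sub>R f) g = c * ip f g"
proof -
  obtain u v where m: "minimizing f u" "minimizing g v"
    using minimizing_exists f g by metis
  then have V: "u n \<in> V" "v n \<in> V" for n by (auto simp: minimizing_def)
  have "(\<lambda>n. B (c *\<^sub>R u n) (v n)) \<longlonglongrightarrow> ip (c *\<^sub>R f) g"
    by (intro tendsto_ip minimizing_scale m H_mem(4) f g)
  moreover have "(\<lambda>n. c * B (u n) (v n)) \<longlonglongrightarrow> c * ip f g"
    by (intro tendsto_mult_left tendsto_ip m f g)
  ultimately show ?thesis
    using V by (simp add: B_scale) (rule LIMSEQ_unique)
qed

lemma N_triangle: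
  assumes f: "f \<in> H" and g: "g \<in> H"
  shows "sqrt (N (f + g)) \<le> sqrt (N f) + sqrt (N g)"
proof -
  have exp: "N (f + t *\<^sub>R g) = N f + 2 * t * ip f g + t\<^sup>2 * N g" for t
  proof -
    have tg: "t *\<^sub>R g \<in> H" using g by (rule H_mem)
    have "4 * ip f (t *\<^sub>R g) = 4 * (t * ip f g)"
      using ip_scale[OF g f, of t] ip_commute[OF f tg] ip_commute[OF f g] by simp
    moreover have "4 * ip f (t *\<^sub>R g) = N (f + t *\<^sub>R g) - N (f - t *\<^sub>R g)"
      by (simp add: ip_def)
    ultimately show ?thesis
      using N_parallelogram[OF f tg] N_scale[OF g, of t] by simp
  qed
  have "ip f g \<le> sqrt (N f) * sqrt (N g)"
  proof -
    have nn: "0 \<le> N f + 2 * t * ip f g + t\<^sup>2 * N g" for t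
      using N_nonneg[of "f + t *\<^sub>R g"] f g by (simp add: exp H_mem)
    have "(ip f g)\<^sup>2 \<le> N f * N g"
    proof (cases "N g = 0")
      case True
      have "ip f g = 0"
      proof (rule ccontr)
        assume "ip f g \<noteq> 0"
        \<comment> \<open>at this \<open>t\<close> the affine function \<open>N f + 2 * t * ip f g\<close> takes the value -1\<close>
        with nn[of "- (N f + 1) / (2 * ip f g)"] True show False by (simp add: field_simps)
      qed
      with True show ?thesis by simp
    next
      case False
      then have "N g > 0" using N_nonneg[OF g] by simp
      with nn[of "- ip f g / N g"] show ?thesis
        by (simp add: field_simps power2_eq_square)
    qed
    then show ?thesis by (simp add: real_le_rsqrt flip: real_sqrt_mult)
  qed
  then have "N (f + g) \<le> (sqrt (N f) + sqrt (N g))\<^sup>2"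
    using exp[of 1] N_nonneg f g by (simp add: power2_sum)
  then show ?thesis
    by (intro real_le_lsqrt) (auto simp: N_nonneg f g)
qed

text \<open>
  Sublevel sets of \<open>N\<close> are closed in \<open>F\<close>; the completeness of \<open>H\<close> is an application of this to the
  differences of a Cauchy sequence.
\<close>

lemma approx_level_limit:
  assumes g: "\<And>m. g m \<in> H" and lim: "(\<lambda>m. nrm F (f - g m)) \<longlonglongrightarrow> 0"
    and f: "f \<in> vecs F" and M: "eventually (\<lambda>m. N (g m) \<le> M) sequentially"
  shows "approx_level f M"
  unfolding approx_level_def
proof (intro allI impI)
  fix e :: real assume e: "e > 0"
  then have "eventually (\<lambda>m. nrm F (f - g m) < e / 2) sequentially"
    by (intro order_tendstoD(2)[OF lim]) simp
  from eventually_happens'[OF sequentially_bot eventually_conj[OF this M]]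
  obtain m where m: "nrm F (f - g m) < e / 2" "N (g m) \<le> M" by blast
  obtain u where u: "u \<in> V" "nrm F (g m - u) < e / 2" "Q u < N (g m) + e / 2"
    using approx_level_N[OF g, of m] e unfolding approx_level_def by (meson half_gt_zero)
  have "nrm F (f - u) \<le> nrm F (f - g m) + nrm F (g m - u)"
    using f g u by (intro nrm_diff_triangle[OF F]) (auto simp: F_mem HF)
  with m u e show "\<exists>u\<in>V. nrm F (f - u) < e \<and> Q u < M + e"
    by (intro bexI[of _ u]) auto
qed

definition Hspace :: "'a nspace" where
  "Hspace = \<lparr>vecs = H, nrm = (\<lambda>f. sqrt (N f))\<rparr>"

lemma Hspace_simps [simp]: "vecs Hspace = H" "nrm Hspace f = sqrt (N f)"
  by (simp_all add: Hspace_def)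

lemma N_eq_0: "f \<in> H \<Longrightarrow> N f = 0 \<longleftrightarrow> f = 0"
  using nrm_le_N[of f] nrm_eq_0[OF F, of f] by (auto simp: N_zero HF)

lemma normed_space_Hspace: "normed_space Hspace"
  unfolding normed_space_def
  using subspace_H N_nonneg N_eq_0 N_triangle by (simp add: N_scale real_sqrt_mult)

lemma hilbert_norm_Hspace: "hilbert_norm Hspace"
  unfolding hilbert_norm_def
  by (rule exI[of _ ip])
    (auto simp: ip_commute ip_add ip_scale ip_self N_nonneg N_eq_0)

lemma banach_space_Hspace: "banach_space Hspace"
  unfolding banach_space_iff
proof (intro conjI normed_space_Hspace allI impI, elim conjE)
  fix h :: "nat \<Rightarrow> 'a"
  assume h: "\<forall>n. h n \<in> vecs Hspace"
    and "\<forall>e>0. \<exists>K. \<forall>m\<ge>K. \<forall>n\<ge>K. nrm Hspace (h m - h n) < e"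
  then have hH: "h n \<in> H"
    and Cauchy: "e > 0 \<Longrightarrow> \<exists>K. \<forall>m\<ge>K. \<forall>n\<ge>K. sqrt (N (h m - h n)) < e" for e n
    by auto
  have le: "nrm F f \<le> sqrt (N f)" if "f \<in> H" for f
    using nrm_le_N[OF that] by (rule real_le_rsqrt)
  have "\<exists>K. \<forall>m\<ge>K. \<forall>n\<ge>K. nrm F (h m - h n) < e" if "e > 0" for e
    using Cauchy[OF that] le[OF H_mem(3)[OF hH hH]] by (meson le_less_trans)
  then obtain f where f: "f \<in> vecs F" "(\<lambda>n. nrm F (h n - f)) \<longlonglongrightarrow> 0"
    using banach_limit_exists[OF banach, of h] HF hH by blast
  have lev: "approx_level (f - h k) M"
    if "eventually (\<lambda>m. N (h m - h k) \<le> M) sequentially" for k M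
  proof (rule approx_level_limit[OF _ _ _ that])
    show "(\<lambda>m. nrm F (f - h k - (h m - h k))) \<longlonglongrightarrow> 0"
      using f(2) nrm_commute[OF F f(1) HF[OF hH]] by simp
  qed (use hH f(1) in \<open>auto simp: F_mem H_mem\<close>)
  have key: "\<exists>K. \<forall>k\<ge>K. f - h k \<in> H \<and> N (f - h k) \<le> e\<^sup>2" if e: "e > 0" for e
  proof -
    obtain K where K: "\<And>m k. m \<ge> K \<Longrightarrow> k \<ge> K \<Longrightarrow> sqrt (N (h m - h k)) < e"
      using Cauchy[OF e] by blast
    show ?thesis
    proof (intro exI[of _ K] allI impI)
      fix k assume k: "k \<ge> K"
      have "N (h m - h k) \<le> e\<^sup>2" if "m \<ge> K" for m
        using K[OF that k] by (intro sqrt_le_D) simp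
      then have "eventually (\<lambda>m. N (h m - h k) \<le> e\<^sup>2) sequentially"
        by (auto simp: eventually_sequentially)
      from lev[OF this] show "f - h k \<in> H \<and> N (f - h k) \<le> e\<^sup>2"
        using f(1) hH by (auto simp: H_def N_le F_mem)
    qed
  qed
  have "f \<in> H"
    using key[of 1] H_mem(2)[OF _ hH] by (metis diff_add_cancel order_refl zero_less_one)
  moreover have "(\<lambda>n. nrm Hspace (h n - f)) \<longlonglongrightarrow> 0"
  proof (rule LIMSEQ_I)
    fix e :: real assume "e > 0"
    then obtain K where K: "\<And>k. k \<ge> K \<Longrightarrow> N (f - h k) \<le> (e/2)\<^sup>2"
      using key[of "e/2"] by auto
    have "norm (nrm Hspace (h k - f) - 0) < e" if "k \<ge> K" for k
    proof -
      have "sqrt (N (f - h k)) \<le> e / 2"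
        using K[OF that] \<open>e > 0\<close> by (intro real_le_lsqrt) (auto intro!: N_nonneg H_mem(3) hH \<open>f \<in> H\<close>)
      then show ?thesis
        using nrm_commute[OF normed_space_Hspace, of "h k" f] hH \<open>f \<in> H\<close> \<open>e > 0\<close> N_nonneg[of "f - h k"]
        by (simp add: H_mem)
    qed
    then show "\<exists>K. \<forall>k\<ge>K. norm (nrm Hspace (h k - f) - 0) < e" by blast
  qed
  ultimately show "\<exists>f\<in>vecs Hspace. (\<lambda>n. nrm Hspace (h n - f)) \<longlonglongrightarrow> 0" by auto
qed

end

section \<open>Families with equal Gram matrix\<close>

definition rotate2 :: "nat \<Rightarrow> nat \<Rightarrow> real \<Rightarrow> real \<Rightarrow> (nat \<Rightarrow> 'a::real_vector) \<Rightarrow> nat \<Rightarrow> 'a" where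
  "rotate2 i j c s x = x(i := c *\<^sub>R x i + s *\<^sub>R x j, j := c *\<^sub>R x j - s *\<^sub>R x i)"

text \<open>
  The case \<open>s = 0\<close> of a rotation is excluded so that a rotation is a product of three shears, which is
  how the invariance of Lebesgue measure is shown below.  Sign changes have determinant -1 and hence
  form a second kind of step.
\<close>

inductive orth_step :: "nat set \<Rightarrow> (nat \<Rightarrow> 'a::real_vector) \<Rightarrow> (nat \<Rightarrow> 'a) \<Rightarrow> bool"
  for I where
  rot: "i \<in> I \<Longrightarrow> j \<in> I \<Longrightarrow> i \<noteq> j \<Longrightarrow> c\<^sup>2 + s\<^sup>2 = 1 \<Longrightarrow> s \<noteq> 0 \<Longrightarrow> orth_step I x (rotate2 i j c s x)"
| flip: "i \<in> I \<Longrightarrow> orth_step I x (x(i := - x i))"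

abbreviation orth_equiv :: "nat set \<Rightarrow> (nat \<Rightarrow> 'a::real_vector) \<Rightarrow> (nat \<Rightarrow> 'a) \<Rightarrow> bool" where
  "orth_equiv I \<equiv> (orth_step I)\<^sup>*\<^sup>*"

lemma orth_step_mono: "orth_step I x y \<Longrightarrow> I \<subseteq> J \<Longrightarrow> orth_step J x y"
  by (induction rule: orth_step.induct) (auto intro: orth_step.intros)

lemma orth_equiv_mono: "orth_equiv I x y \<Longrightarrow> I \<subseteq> J \<Longrightarrow> orth_equiv J x y"
  by (erule rtranclp_mono[THEN predicate2D, rotated]) (auto intro: orth_step_mono)

lemma orth_step_outside: "orth_step I x y \<Longrightarrow> k \<notin> I \<Longrightarrow> y k = x k"
  by (induction rule: orth_step.induct) (auto simp: rotate2_def)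

lemma orth_equiv_outside: "orth_equiv I x y \<Longrightarrow> k \<notin> I \<Longrightarrow> y k = x k"
  by (induction rule: rtranclp_induct) (auto simp: orth_step_outside)

lemma orth_step_in_subspace:
  "orth_step I x y \<Longrightarrow> subspace V \<Longrightarrow> \<forall>i\<in>I. x i \<in> V \<Longrightarrow> \<forall>i\<in>I. y i \<in> V"
  by (induction rule: orth_step.induct)
    (auto simp: rotate2_def intro!: subspace_add subspace_diff subspace_scale subspace_neg)

text \<open>
  The values of \<open>\<Phi>\<close> are compared only along families in \<open>V\<close>, so that \<open>\<Phi>\<close> may involve a norm that is
  meaningless outside \<open>V\<close>.
\<close>

lemma orth_equiv_invariant:
  assumes "orth_equiv I x y" and V: "subspace V" and x: "\<forall>i\<in>I. x i \<in> V"
    and step: "\<And>x y. orth_step I x y \<Longrightarrow> \<forall>i\<in>I. x i \<in> V \<Longrightarrow> \<Phi> x = \<Phi> y"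
  shows "(\<forall>i\<in>I. y i \<in> V) \<and> \<Phi> y = \<Phi> x"
  using assms(1)
proof (induction rule: rtranclp_induct)
  case (step y z)
  then show ?case using assms(4) orth_step_in_subspace[OF _ V] by metis
qed (simp add: x)

definition gram :: "nat set \<Rightarrow> (nat \<Rightarrow> 'x \<Rightarrow> real) \<Rightarrow> 'x \<Rightarrow> 'x \<Rightarrow> real" where
  "gram I x s t = (\<Sum>i\<in>I. x i s * x i t)"

lemma orth_step_gram:
  assumes "orth_step I x y" "finite I"
  shows "gram I x s t = gram I y s t"
  using assms
proof (induction rule: orth_step.induct)
  case (rot i j c r x)
  let ?y = "rotate2 i j c r x"
  have "gram I z s t = z i s * z i t + z j s * z j t + (\<Sum>k\<in>I-{i}-{j}. z k s * z k t)" for z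
    using rot by (simp add: gram_def sum.remove[of I i] sum.remove[of "I-{i}" j])
  moreover have "?y i s * ?y i t + ?y j s * ?y j t = x i s * x i t + x j s * x j t"
  proof -
    have "?y i s * ?y i t + ?y j s * ?y j t = (c\<^sup>2 + r\<^sup>2) * (x i s * x i t + x j s * x j t)"
      using rot(3) by (simp add: rotate2_def power2_eq_square algebra_simps)
    with rot(4) show ?thesis by simp
  qed
  moreover have "(\<Sum>k\<in>I-{i}-{j}. ?y k s * ?y k t) = (\<Sum>k\<in>I-{i}-{j}. x k s * x k t)"
    by (rule sum.cong) (auto simp: rotate2_def)
  ultimately show ?case by simp
next
  case (flip i x)
  then show ?case unfolding gram_def by (intro sum.cong) auto
qed

lemma orth_equiv_gram:
  assumes "orth_equiv I x y" "finite I"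
  shows "gram I y s t = gram I x s t"
  using assms by (induction rule: rtranclp_induct) (auto simp: orth_step_gram)

text \<open>
  Rotating in the plane of the coordinates \<open>i\<close> and \<open>j\<close> moves the values at \<open>s\<close> of both to coordinate \<open>i\<close>;
  this is one column of a QR factorization by Givens rotations.
\<close>

lemma rotate_onto_coordinate:
  fixes x :: "nat \<Rightarrow> 'x \<Rightarrow> real"
  assumes "finite J" "i \<notin> J"
  shows "\<exists>z. orth_equiv (insert i J) x z \<and> (\<forall>j\<in>J. z j s = 0)"
  using assms
proof (induction J)
  case (insert j J)
  then obtain z where z: "orth_equiv (insert i J) x z" "\<forall>k\<in>J. z k s = 0" by auto
  from z(1) have z1: "orth_equiv (insert i (insert j J)) x z" by (rule orth_equiv_mono) auto
  show ?case
  proof (cases "z j s = 0")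
    case False
    define r where "r = sqrt ((z i s)\<^sup>2 + (z j s)\<^sup>2)"
    define w where "w = rotate2 i j (z i s / r) (z j s / r) z"
    have r: "r > 0" "r\<^sup>2 = (z i s)\<^sup>2 + (z j s)\<^sup>2"
      using False by (auto simp: r_def sum_power2_gt_zero_iff)
    have "(z i s / r)\<^sup>2 + (z j s / r)\<^sup>2 = 1"
      using r(1) unfolding power_divide add_divide_distrib[symmetric] r(2)[symmetric] by simp
    then have "orth_step (insert i (insert j J)) z w"
      unfolding w_def using insert False r by (intro orth_step.rot) auto
    moreover have "w k s = 0" if "k \<in> insert j J" for k
      using that insert z(2) by (auto simp: w_def rotate2_def)
    ultimately show ?thesis using z1 by (intro exI[of _ w]) auto
  qed (use z(2) z1 in auto)
qed auto

text \<open>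
  Once only coordinate \<open>i\<close> is nonzero at \<open>s\<close>, the Gram matrix at \<open>(s, t)\<close> is the single product
  \<open>z i s * z i t\<close>.  If the value \<open>z i s\<close> is nonzero, the Gram matrix therefore determines the function
  \<open>z i\<close>.
\<close>

lemma rotate_onto_coordinate_pos:
  fixes x :: "nat \<Rightarrow> 'x \<Rightarrow> real"
  assumes J: "finite J" "i \<notin> J"
  shows "\<exists>z. orth_equiv (insert i J) x z \<and> z i s = sqrt (gram (insert i J) x s s) \<and>
    (\<forall>t. z i s * z i t = gram (insert i J) x s t)"
proof -
  from rotate_onto_coordinate[OF J, of x s]
  obtain z where z: "orth_equiv (insert i J) x z" "\<forall>j\<in>J. z j s = 0" by blast
  have g: "z i s * z i t = gram (insert i J) x s t" for t
    using orth_equiv_gram[OF z(1), of s t] J z(2) by (simp add: gram_def)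
  have abs: "\<bar>z i s\<bar> = sqrt (gram (insert i J) x s s)"
    unfolding g[of s, symmetric] by (simp add: real_sqrt_abs2)
  show ?thesis
  proof (cases "z i s \<ge> 0")
    case True
    with z(1) g abs show ?thesis by (intro exI[of _ z]) simp
  next
    case False
    have "orth_equiv (insert i J) x (z(i := - z i))"
      by (rule rtranclp.rtrancl_into_rtrancl[OF z(1)]) (rule orth_step.flip, simp)
    moreover have "- z i s = sqrt (gram (insert i J) x s s)"
      using False abs by simp
    moreover have "- z i s * - z i t = gram (insert i J) x s t" for t
      using g[of t] by simp
    ultimately show ?thesis
      by (intro exI[of _ "z(i := - z i)"]) (simp only: fun_upd_same fun_Compl_def simp_thms)
  qed
qed

text \<open>
  Induction on the index set.  Both families are rotated so that only coordinate \<open>i\<close> is nonzero at a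
  point \<open>s\<close>; by the preceding lemma their functions at \<open>i\<close> then agree, and the remaining coordinates
  again have equal Gram matrices.
\<close>

lemma equal_gram_imp_common_rotation:
  fixes x y :: "nat \<Rightarrow> 'x \<Rightarrow> real"
  assumes "finite I" "\<And>s t. gram I x s t = gram I y s t"
  shows "\<exists>z w. orth_equiv I x z \<and> orth_equiv I y w \<and> (\<forall>i\<in>I. z i = w i)"
  using assms
proof (induction I arbitrary: x y)
  case (insert i I)
  show ?case
  proof (cases "\<exists>s. gram (insert i I) x s s \<noteq> 0")
    case True
    then obtain s where s: "gram (insert i I) x s s \<noteq> 0" by blast
    obtain x' where x': "orth_equiv (insert i I) x x'" "x' i s = sqrt (gram (insert i I) x s s)"
        "\<And>t. x' i s * x' i t = gram (insert i I) x s t"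
      using rotate_onto_coordinate_pos[OF insert(1,2), of x s] by blast
    obtain y' where y': "orth_equiv (insert i I) y y'" "y' i s = sqrt (gram (insert i I) y s s)"
        "\<And>t. y' i s * y' i t = gram (insert i I) y s t"
      using rotate_onto_coordinate_pos[OF insert(1,2), of y s] by blast
    have eq: "x' i = y' i"
    proof
      fix t
      have "x' i s = y' i s" "x' i s \<noteq> 0" using x'(2) y'(2) s insert.prems by auto
      with x'(3)[of t] y'(3)[of t] insert.prems[of s t] show "x' i t = y' i t"
        by (metis mult_left_cancel)
    qed
    have "gram I x' s t = gram I y' s t" for s t
    proof -
      have "gram (insert i I) x' s t = gram (insert i I) y' s t"
        using orth_equiv_gram[OF x'(1), of s t] orth_equiv_gram[OF y'(1), of s t]
          insert.prems[of s t] insert.hyps(1) by simp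
      with eq insert.hyps show ?thesis by (simp add: gram_def)
    qed
    from insert.IH[OF this] obtain z w where zw: "orth_equiv I x' z" "orth_equiv I y' w"
      "\<forall>k\<in>I. z k = w k" by blast
    moreover have "z i = w i"
      using orth_equiv_outside[OF zw(1) insert(2)] orth_equiv_outside[OF zw(2) insert(2)] eq by simp
    moreover have "orth_equiv (insert i I) x z" "orth_equiv (insert i I) y w"
      using x'(1) y'(1) zw orth_equiv_mono[of I _ _ "insert i I"] by (meson rtranclp_trans subset_insertI)+
    ultimately show ?thesis by blast
  next
    case False
    \<comment> \<open>the diagonals of the Gram matrices are sums of squares, so both families vanish\<close>
    have "x k = 0 \<and> y k = 0" if "k \<in> insert i I" for k
    proof -
      have "gram (insert i I) z s s = 0 \<longleftrightarrow> (\<forall>k\<in>insert i I. z k s = 0)" for z :: "nat \<Rightarrow> 'x \<Rightarrow> real" and s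
        unfolding gram_def using insert(1) by (subst sum_nonneg_eq_0_iff) auto
      with False insert.prems that show ?thesis by (metis ext zero_fun_apply)
    qed
    then show ?thesis by (intro exI[of _ x] exI[of _ y]) auto
  qed
qed auto

lemma sign_change_orth_equiv:
  assumes "finite I" "\<And>i. i \<in> I \<Longrightarrow> \<epsilon> i \<in> {-1, 1::real}"
  shows "\<exists>z. orth_equiv I x z \<and> (\<forall>i\<in>I. z i = \<epsilon> i *\<^sub>R x i)"
  using assms
proof (induction I)
  case (insert i I)
  then obtain z where z: "orth_equiv I x z" "\<forall>k\<in>I. z k = \<epsilon> k *\<^sub>R x k" by auto
  then have z1: "orth_equiv (insert i I) x z" by (auto intro: orth_equiv_mono)
  have zi: "z i = x i" using orth_equiv_outside[OF z(1)] insert by auto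
  have "\<epsilon> i = 1 \<or> \<epsilon> i = -1" using insert.prems by auto
  then show ?case
  proof
    assume "\<epsilon> i = 1"
    with z z1 zi show ?thesis by (intro exI[of _ z]) auto
  next
    assume "\<epsilon> i = -1"
    have "orth_equiv (insert i I) x (z(i := - z i))"
      by (rule rtranclp.rtrancl_into_rtrancl[OF z1]) (rule orth_step.flip, simp)
    moreover have "\<forall>k\<in>insert i I. (z(i := - z i)) k = \<epsilon> k *\<^sub>R x k"
      using \<open>\<epsilon> i = -1\<close> z(2) zi insert.hyps by auto
    ultimately show ?thesis by blast
  qed
qed auto

lemma orth_step_map:
  assumes "orth_step I x y" and x: "\<forall>i\<in>I. x i \<in> V" and V: "subspace V"
    and add: "\<And>f g. f \<in> V \<Longrightarrow> g \<in> V \<Longrightarrow> \<phi> (f + g) = \<phi> f + \<phi> g"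
    and scale: "\<And>c f. f \<in> V \<Longrightarrow> \<phi> (c *\<^sub>R f) = c *\<^sub>R \<phi> f"
  shows "orth_step I (\<lambda>i. \<phi> (x i)) (\<lambda>i. \<phi> (y i))"
  using assms(1)
proof cases
  case (rot i j c s)
  have V': "a *\<^sub>R x i \<in> V" "a *\<^sub>R x j \<in> V" "x i \<in> V" "x j \<in> V" for a
    using x V rot by (auto intro: subspace_scale)
  have "\<phi> (c *\<^sub>R x j + (- s) *\<^sub>R x i) = c *\<^sub>R \<phi> (x j) + (- s) *\<^sub>R \<phi> (x i)"
    using V' by (simp only: add scale)
  then have "(\<lambda>i. \<phi> (y i)) = rotate2 i j c s (\<lambda>i. \<phi> (x i))"
    unfolding rot(1) rotate2_def using V' rot(4) by (intro ext) (simp add: add scale)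
  then show ?thesis using orth_step.rot[OF rot(2-6)] by simp
next
  case (flip i)
  have "\<phi> ((-1) *\<^sub>R x i) = (-1) *\<^sub>R \<phi> (x i)" using x flip by (intro scale) auto
  then have "(\<lambda>i. \<phi> (y i)) = (\<lambda>i. \<phi> (x i))(i := - \<phi> (x i))"
    unfolding flip(1) by (intro ext) simp
  then show ?thesis using orth_step.flip[OF flip(2), of "\<lambda>i. \<phi> (x i)"] by simp
qed

text \<open>
  Applying \<open>\<phi>\<close> to every vector commutes with the steps, and \<open>\<Sum>i\<in>I. (\<phi> (x i))\<^sup>2\<close> is a Gram matrix with one
  entry.
\<close>

lemma equal_gram_functional:
  fixes x y :: "nat \<Rightarrow> 'x \<Rightarrow> real" and \<phi> :: "('x \<Rightarrow> real) \<Rightarrow> real"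
  assumes I: "finite I" and V: "subspace V" and x: "\<forall>i\<in>I. x i \<in> V" and y: "\<forall>i\<in>I. y i \<in> V"
    and gram: "\<And>s t. gram I x s t = gram I y s t"
    and add: "\<And>f g. f \<in> V \<Longrightarrow> g \<in> V \<Longrightarrow> \<phi> (f + g) = \<phi> f + \<phi> g"
    and scale: "\<And>c f. f \<in> V \<Longrightarrow> \<phi> (c *\<^sub>R f) = c * \<phi> f"
  shows "(\<Sum>i\<in>I. (\<phi> (x i))\<^sup>2) = (\<Sum>i\<in>I. (\<phi> (y i))\<^sup>2)"
proof -
  define \<Phi> where "\<Phi> x = gram I (\<lambda>i _. \<phi> (x i)) () ()" for x :: "nat \<Rightarrow> 'x \<Rightarrow> real"
  have step: "\<Phi> u = \<Phi> v" if "orth_step I u v" "\<forall>i\<in>I. u i \<in> V" for u v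
  proof -
    have "orth_step I (\<lambda>i (_::unit). \<phi> (u i)) (\<lambda>i _. \<phi> (v i))"
      by (rule orth_step_map[OF that V, where \<phi> = "\<lambda>f _. \<phi> f"])
        (simp_all add: add scale fun_eq_iff)
    then show ?thesis unfolding \<Phi>_def using I by (rule orth_step_gram)
  qed
  obtain z w where zw: "orth_equiv I x z" "orth_equiv I y w" "\<forall>i\<in>I. z i = w i"
    using equal_gram_imp_common_rotation[OF I gram] by blast
  have "\<Phi> z = \<Phi> x" "\<Phi> w = \<Phi> y"
    using orth_equiv_invariant[OF zw(1) V x, of \<Phi>] orth_equiv_invariant[OF zw(2) V y, of \<Phi>] step by blast+
  moreover have "\<Phi> z = \<Phi> w"
    using zw(3) by (simp add: \<Phi>_def gram_def cong: sum.cong)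
  ultimately show ?thesis by (simp add: \<Phi>_def gram_def power2_eq_square)
qed

section \<open>Gaussian averages and their rotation invariance\<close>

definition std_gauss :: "real measure" where
  "std_gauss = density lborel (\<lambda>x. ennreal (std_normal_density x))"

lemma sets_std_gauss [measurable_cong, simp]: "sets std_gauss = sets borel"
  by (simp add: std_gauss_def)

lemma space_std_gauss [simp]: "space std_gauss = UNIV"
  by (simp add: std_gauss_def)

lemma prob_space_std_gauss: "prob_space std_gauss"
  unfolding std_gauss_def by (rule prob_space_normal_density) simp

lemma nn_integral_std_gauss:
  "f \<in> borel_measurable borel \<Longrightarrow>
    (\<integral>\<^sup>+x. f x \<partial>std_gauss) = (\<integral>\<^sup>+x. ennreal (std_normal_density x) * f x \<partial>lborel)"
  unfolding std_gauss_def by (rule nn_integral_density) auto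

lemma nn_integral_std_gauss_square: "(\<integral>\<^sup>+x. ennreal (x\<^sup>2) \<partial>std_gauss) = 1"
proof -
  have "(\<integral>\<^sup>+x. ennreal (std_normal_density x * x\<^sup>2) \<partial>lborel) = ennreal 1"
    using std_normal_moment_even[of 1]
    by (subst nn_integral_eq_integral)
      (auto simp: has_bochner_integral_iff)
  then show ?thesis by (simp add: nn_integral_std_gauss ennreal_mult'')
qed

lemma nn_integral_std_gauss_abs: "(\<integral>\<^sup>+x. ennreal \<bar>x\<bar> \<partial>std_gauss) = ennreal (sqrt (2 / pi))"
proof -
  have "(\<integral>\<^sup>+x. ennreal (std_normal_density x * \<bar>x\<bar>) \<partial>lborel) = ennreal (sqrt (2 / pi))"
    using std_normal_moment_abs_odd[of 0]
    by (subst nn_integral_eq_integral) (auto simp: has_bochner_integral_iff)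
  then show ?thesis by (simp add: nn_integral_std_gauss ennreal_mult'')
qed

lemma nn_integral_std_gauss_uminus:
  assumes [measurable]: "f \<in> borel_measurable borel"
  shows "(\<integral>\<^sup>+x. f (- x) \<partial>std_gauss) = (\<integral>\<^sup>+x. f x \<partial>std_gauss)"
  using nn_integral_real_affine[of "\<lambda>x. ennreal (std_normal_density x) * f x" "-1" 0]
  by (simp add: nn_integral_std_gauss normal_density_def)

lemma nn_integral_lborel_shear:
  fixes f :: "real \<Rightarrow> real \<Rightarrow> ennreal"
  assumes f [measurable]: "(\<lambda>(x, y). f x y) \<in> borel_measurable (borel \<Otimes>\<^sub>M borel)"
  shows "(\<integral>\<^sup>+x. \<integral>\<^sup>+y. f x (y + t * x) \<partial>lborel \<partial>lborel) = (\<integral>\<^sup>+x. \<integral>\<^sup>+y. f x y \<partial>lborel \<partial>lborel)"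
proof (rule nn_integral_cong)
  fix x :: real
  have "f x \<in> borel_measurable borel" by measurable
  from nn_integral_real_affine[OF this, of 1 "t * x"]
  show "(\<integral>\<^sup>+y. f x (y + t * x) \<partial>lborel) = (\<integral>\<^sup>+y. f x y \<partial>lborel)"
    by (simp add: add.commute)
qed

lemma nn_integral_lborel_swap:
  fixes f :: "real \<Rightarrow> real \<Rightarrow> ennreal"
  assumes [measurable]: "(\<lambda>(x, y). f x y) \<in> borel_measurable (borel \<Otimes>\<^sub>M borel)"
  shows "(\<integral>\<^sup>+x. \<integral>\<^sup>+y. f x y \<partial>lborel \<partial>lborel) = (\<integral>\<^sup>+y. \<integral>\<^sup>+x. f x y \<partial>lborel \<partial>lborel)"
  by (rule lborel_pair.Fubini'[symmetric]) measurable

text \<open>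
  The rotation is the product of the three shears \<open>(x, y) \<mapsto> (x + t * y, y)\<close>,
  \<open>(x, y) \<mapsto> (x, y + s * x)\<close> and again the first, with \<open>t = (c - 1) / s\<close>; each of them is a translation
  in one of the variables.
\<close>

lemma nn_integral_lborel_rotation:
  fixes f :: "real \<Rightarrow> real \<Rightarrow> ennreal"
  assumes f [measurable]: "(\<lambda>(x, y). f x y) \<in> borel_measurable (borel \<Otimes>\<^sub>M borel)"
    and cs: "c\<^sup>2 + s\<^sup>2 = 1" and s: "s \<noteq> 0"
  shows "(\<integral>\<^sup>+x. \<integral>\<^sup>+y. f (c * x - s * y) (s * x + c * y) \<partial>lborel \<partial>lborel) =
    (\<integral>\<^sup>+x. \<integral>\<^sup>+y. f x y \<partial>lborel \<partial>lborel)"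
proof -
  define t where "t = (c - 1) / s"
  have t: "t * s = c - 1" "t * (1 + c) = - s"
    using cs s by (auto simp: t_def field_simps power2_eq_square)
  have shear': "(\<integral>\<^sup>+x. \<integral>\<^sup>+y. g (x + t * y) y \<partial>lborel \<partial>lborel) = (\<integral>\<^sup>+x. \<integral>\<^sup>+y. g x y \<partial>lborel \<partial>lborel)"
    if [measurable]: "(\<lambda>(x, y). g x y) \<in> borel_measurable (borel \<Otimes>\<^sub>M borel)"
    for g :: "real \<Rightarrow> real \<Rightarrow> ennreal"
  proof -
    have m: "(\<lambda>(x, y). g y x) \<in> borel_measurable (borel \<Otimes>\<^sub>M borel)" by measurable
    have "(\<integral>\<^sup>+x. \<integral>\<^sup>+y. g (x + t * y) y \<partial>lborel \<partial>lborel) = (\<integral>\<^sup>+y. \<integral>\<^sup>+x. g (x + t * y) y \<partial>lborel \<partial>lborel)"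
      by (rule nn_integral_lborel_swap) measurable
    also have "\<dots> = (\<integral>\<^sup>+y. \<integral>\<^sup>+x. g x y \<partial>lborel \<partial>lborel)"
      by (rule nn_integral_lborel_shear[OF m])
    also have "\<dots> = (\<integral>\<^sup>+x. \<integral>\<^sup>+y. g x y \<partial>lborel \<partial>lborel)"
      by (rule nn_integral_lborel_swap[symmetric]) measurable
    finally show ?thesis .
  qed
  define f1 where "f1 x y = f (x + t * y) y" for x y
  define f2 where "f2 x y = f1 x (y + s * x)" for x y
  have [measurable]: "(\<lambda>(x, y). f1 x y) \<in> borel_measurable (borel \<Otimes>\<^sub>M borel)"
    unfolding f1_def by measurable
  have [measurable]: "(\<lambda>(x, y). f2 x y) \<in> borel_measurable (borel \<Otimes>\<^sub>M borel)"
    unfolding f2_def by measurable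
  have "f2 (x + t * y) y = f (c * x - s * y) (s * x + c * y)" for x y
  proof -
    have 1: "y + s * (x + t * y) = s * x + (1 + t * s) * y" by (simp add: algebra_simps)
    have "x + t * y + t * (s * x + c * y) = (1 + t * s) * x + (t * (1 + c)) * y"
      by (simp add: algebra_simps)
    with 1 show ?thesis by (simp add: f2_def f1_def t)
  qed
  then have "(\<integral>\<^sup>+x. \<integral>\<^sup>+y. f (c * x - s * y) (s * x + c * y) \<partial>lborel \<partial>lborel) =
      (\<integral>\<^sup>+x. \<integral>\<^sup>+y. f2 (x + t * y) y \<partial>lborel \<partial>lborel)" by simp
  also have "\<dots> = (\<integral>\<^sup>+x. \<integral>\<^sup>+y. f2 x y \<partial>lborel \<partial>lborel)" by (rule shear') measurable
  also have "\<dots> = (\<integral>\<^sup>+x. \<integral>\<^sup>+y. f1 x y \<partial>lborel \<partial>lborel)"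
    unfolding f2_def by (rule nn_integral_lborel_shear) measurable
  also have "\<dots> = (\<integral>\<^sup>+x. \<integral>\<^sup>+y. f x y \<partial>lborel \<partial>lborel)"
    unfolding f1_def by (rule shear') measurable
  finally show ?thesis .
qed

text \<open>
  The density of two independent standard normal variables depends only on \<open>x\<^sup>2 + y\<^sup>2\<close>.
\<close>

lemma nn_integral_std_gauss_rotation:
  fixes f :: "real \<Rightarrow> real \<Rightarrow> ennreal"
  assumes f [measurable]: "(\<lambda>(x, y). f x y) \<in> borel_measurable (borel \<Otimes>\<^sub>M borel)"
    and cs: "c\<^sup>2 + s\<^sup>2 = 1" and s: "s \<noteq> 0"
  shows "(\<integral>\<^sup>+x. \<integral>\<^sup>+y. f (c * x - s * y) (s * x + c * y) \<partial>std_gauss \<partial>std_gauss) =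
    (\<integral>\<^sup>+x. \<integral>\<^sup>+y. f x y \<partial>std_gauss \<partial>std_gauss)"
proof -
  define d where "d x y = ennreal (std_normal_density x * std_normal_density y)" for x y
  have [measurable]: "(\<lambda>(x, y). d x y) \<in> borel_measurable (borel \<Otimes>\<^sub>M borel)"
    unfolding d_def by measurable
  have double: "(\<integral>\<^sup>+x. \<integral>\<^sup>+y. g x y \<partial>std_gauss \<partial>std_gauss) = (\<integral>\<^sup>+x. \<integral>\<^sup>+y. d x y * g x y \<partial>lborel \<partial>lborel)"
    if [measurable]: "(\<lambda>(x, y). g x y) \<in> borel_measurable (borel \<Otimes>\<^sub>M borel)"
    for g :: "real \<Rightarrow> real \<Rightarrow> ennreal"
    by (simp add: nn_integral_std_gauss d_def ennreal_mult mult.assoc nn_integral_cmult)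
  have "d (c * x - s * y) (s * x + c * y) = d x y" for x y
  proof -
    have "(c * x - s * y)\<^sup>2 + (s * x + c * y)\<^sup>2 = (c\<^sup>2 + s\<^sup>2) * (x\<^sup>2 + y\<^sup>2)"
      by (simp add: power2_eq_square algebra_simps)
    moreover have "d x y = ennreal (exp (- (x\<^sup>2 + y\<^sup>2) / 2) / (2 * pi))" for x y
      by (simp add: d_def normal_density_def add_divide_distrib exp_add[symmetric])
    ultimately show ?thesis using cs by simp
  qed
  then have "(\<integral>\<^sup>+x. \<integral>\<^sup>+y. f (c * x - s * y) (s * x + c * y) \<partial>std_gauss \<partial>std_gauss) =
      (\<integral>\<^sup>+x. \<integral>\<^sup>+y. d (c * x - s * y) (s * x + c * y) * f (c * x - s * y) (s * x + c * y) \<partial>lborel \<partial>lborel)"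
    by (subst double) auto
  also have "\<dots> = (\<integral>\<^sup>+x. \<integral>\<^sup>+y. d x y * f x y \<partial>lborel \<partial>lborel)"
    by (rule nn_integral_lborel_rotation[OF _ cs s]) measurable
  also have "\<dots> = (\<integral>\<^sup>+x. \<integral>\<^sup>+y. f x y \<partial>std_gauss \<partial>std_gauss)"
    by (rule double[symmetric]) measurable
  finally show ?thesis .
qed


definition gaussian :: "nat set \<Rightarrow> (nat \<Rightarrow> real) measure" where
  "gaussian I = (\<Pi>\<^sub>M i\<in>I. std_gauss)"

lemma prob_space_gaussian: "prob_space (gaussian I)"
  unfolding gaussian_def by (intro prob_space_PiM prob_space_std_gauss)

lemma measurable_gaussian_component: "i \<in> I \<Longrightarrow> (\<lambda>g. g i) \<in> borel_measurable (gaussian I)"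
  using measurable_component_singleton[of i I "\<lambda>_. std_gauss"]
  by (simp add: gaussian_def measurable_cong_sets[OF refl sets_std_gauss])

lemma nn_integral_gaussian_component:
  assumes "i \<in> I" and [measurable]: "f \<in> borel_measurable borel"
  shows "(\<integral>\<^sup>+g. f (g i) \<partial>gaussian I) = (\<integral>\<^sup>+x. f x \<partial>std_gauss)"
proof -
  have m: "(\<lambda>g. g i) \<in> gaussian I \<rightarrow>\<^sub>M std_gauss"
    unfolding gaussian_def by (rule measurable_component_singleton[OF assms(1)])
  have "(\<integral>\<^sup>+x. f x \<partial>std_gauss) = (\<integral>\<^sup>+x. f x \<partial>distr (gaussian I) std_gauss (\<lambda>g. g i))"
    unfolding gaussian_def
    by (subst distr_PiM_component) (rule prob_space_std_gauss, rule assms(1), rule refl)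
  also have "\<dots> = (\<integral>\<^sup>+g. f (g i) \<partial>gaussian I)"
    by (rule nn_integral_distr[OF m]) measurable
  finally show ?thesis by simp
qed

lemma nn_integral_gaussian_insert:
  assumes "finite I" "i \<notin> I" "f \<in> borel_measurable (gaussian (insert i I))"
  shows "(\<integral>\<^sup>+g. f g \<partial>gaussian (insert i I)) = (\<integral>\<^sup>+g. \<integral>\<^sup>+a. f (g(i := a)) \<partial>std_gauss \<partial>gaussian I)"
proof -
  interpret product_sigma_finite "\<lambda>_::nat. std_gauss"
    by (intro product_sigma_finite.intro prob_space_imp_sigma_finite prob_space_std_gauss)
  show ?thesis
    using product_nn_integral_insert[OF assms(1,2)] assms(3) by (simp add: gaussian_def)
qed

text \<open>
  The norm of a finite combination is a Lipschitz function of its coefficients.  One statement with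
  arbitrary measurable coefficients \<open>u i\<close> serves the Gaussian product, its sections and its product
  with the sequence of signs.
\<close>

lemma borel_measurable_nrm_combination:
  fixes x :: "nat \<Rightarrow> 'a::real_vector"
  assumes E: "normed_space E" and I: "finite I" and v: "v \<in> vecs E"
    and x: "\<And>i. i \<in> I \<Longrightarrow> x i \<in> vecs E" and u: "\<And>i. i \<in> I \<Longrightarrow> u i \<in> borel_measurable M"
  shows "(\<lambda>\<omega>. nrm E (v + (\<Sum>i\<in>I. u i \<omega> *\<^sub>R x i))) \<in> borel_measurable M"
proof -
  define h where "h a = nrm E (v + (\<Sum>i\<in>I. a i *\<^sub>R x i))" for a :: "nat \<Rightarrow> real"
  define w where "w \<omega> i = (if i \<in> I then u i \<omega> else 0)" for \<omega> i
  have mem: "v + (\<Sum>i\<in>I. a i *\<^sub>R x i) \<in> vecs E" for a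
    using x by (intro normed_space_add[OF E] v normed_space_sum[OF E] normed_space_scale[OF E])
  have bound: "\<bar>h a - h b\<bar> \<le> (\<Sum>i\<in>I. \<bar>a i - b i\<bar> * nrm E (x i))" for a b
  proof -
    have "\<bar>h a - h b\<bar> \<le> nrm E ((v + (\<Sum>i\<in>I. a i *\<^sub>R x i)) - (v + (\<Sum>i\<in>I. b i *\<^sub>R x i)))"
      unfolding h_def by (rule abs_nrm_diff_le[OF E mem mem])
    also have "(v + (\<Sum>i\<in>I. a i *\<^sub>R x i)) - (v + (\<Sum>i\<in>I. b i *\<^sub>R x i)) = (\<Sum>i\<in>I. (a i - b i) *\<^sub>R x i)"
      by (simp add: scaleR_diff_left sum_subtractf)
    also have "nrm E \<dots> \<le> (\<Sum>i\<in>I. nrm E ((a i - b i) *\<^sub>R x i))"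
      using x by (intro nrm_sum_le[OF E] normed_space_scale[OF E])
    also have "\<dots> = (\<Sum>i\<in>I. \<bar>a i - b i\<bar> * nrm E (x i))"
      using x by (intro sum.cong refl nrm_scale[OF E])
    finally show ?thesis .
  qed
  have "isCont h b" for b
    unfolding isCont_def
  proof (rule LIM_zero_cancel, rule Lim_null_comparison)
    show "eventually (\<lambda>a. norm (h a - h b) \<le> (\<Sum>i\<in>I. \<bar>a i - b i\<bar> * nrm E (x i))) (at b)"
      using bound by (auto intro: always_eventually)
    have coord: "((\<lambda>a. a i) \<longlongrightarrow> b i) (at b)" for i
    proof -
      have "continuous_on UNIV (\<lambda>a::nat \<Rightarrow> real. a i)" by (rule continuous_on_product_coordinates)
      then show ?thesis by (auto simp: continuous_on_def)
    qed
    have "((\<lambda>a. \<Sum>i\<in>I. \<bar>a i - b i\<bar> * nrm E (x i)) \<longlongrightarrow> (\<Sum>i\<in>I. \<bar>b i - b i\<bar> * nrm E (x i))) (at b)"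
      by (intro tendsto_intros coord)
    then show "((\<lambda>a. \<Sum>i\<in>I. \<bar>a i - b i\<bar> * nrm E (x i)) \<longlongrightarrow> 0) (at b)" by simp
  qed
  then have "h \<in> borel_measurable borel"
    by (intro borel_measurable_continuous_onI continuous_at_imp_continuous_on) auto
  moreover have "w \<in> borel_measurable M"
  proof (rule measurable_coordinatewise_then_product)
    fix i show "(\<lambda>\<omega>. w \<omega> i) \<in> borel_measurable M"
      unfolding w_def using u by (cases "i \<in> I") auto
  qed
  ultimately have "(\<lambda>\<omega>. h (w \<omega>)) \<in> borel_measurable M" by (rule measurable_compose_rev)
  then show ?thesis by (simp add: h_def w_def cong: sum.cong)
qed

definition gaussian_average :: "'a::real_vector nspace \<Rightarrow> nat set \<Rightarrow> (nat \<Rightarrow> 'a) \<Rightarrow> ennreal" where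
  "gaussian_average E I x = (\<integral>\<^sup>+g. ennreal (nrm E (\<Sum>i\<in>I. g i *\<^sub>R x i)) \<partial>gaussian I)"

lemma gaussian_average_cong:
  "(\<And>i. i \<in> I \<Longrightarrow> x i = y i) \<Longrightarrow> gaussian_average E I x = gaussian_average E I y"
  by (simp add: gaussian_average_def cong: sum.cong)

lemma borel_measurable_nrm_gaussian_combination:
  fixes x :: "nat \<Rightarrow> 'a::real_vector"
  assumes "normed_space E" "finite I" "\<And>i. i \<in> I \<Longrightarrow> x i \<in> vecs E"
  shows "(\<lambda>g. nrm E (\<Sum>i\<in>I. g i *\<^sub>R x i)) \<in> borel_measurable (gaussian I)"
  using borel_measurable_nrm_combination[of E I 0 x "\<lambda>i g. g i" "gaussian I"] assms
  by (simp add: measurable_gaussian_component normed_space_zero)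

lemma gaussian_average_insert:
  fixes x :: "nat \<Rightarrow> 'a::real_vector"
  assumes E: "normed_space E" and K: "finite K" "i \<notin> K" and x: "\<forall>k\<in>insert i K. x k \<in> vecs E"
  shows "gaussian_average E (insert i K) x =
    (\<integral>\<^sup>+g. \<integral>\<^sup>+a. ennreal (nrm E ((\<Sum>k\<in>K. g k *\<^sub>R x k) + a *\<^sub>R x i)) \<partial>std_gauss \<partial>gaussian K)"
proof -
  have eq: "(\<Sum>k\<in>insert i K. (g(i := a)) k *\<^sub>R x k) = (\<Sum>k\<in>K. g k *\<^sub>R x k) + a *\<^sub>R x i" for g :: "nat \<Rightarrow> real" and a
    using K by (simp add: add.commute) (intro sum.cong, auto)
  have "(\<lambda>g. ennreal (nrm E (\<Sum>k\<in>insert i K. g k *\<^sub>R x k))) \<in> borel_measurable (gaussian (insert i K))"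
    using K x
    by (intro measurable_compose[OF borel_measurable_nrm_gaussian_combination[OF E] measurable_ennreal]) auto
  from nn_integral_gaussian_insert[OF K this] show ?thesis
    unfolding gaussian_average_def eq .
qed

text \<open>
  Separates two coordinates by Fubini, so that a rotation of the vectors \<open>x i\<close> and \<open>x j\<close> can be moved to
  the two Gaussian variables.
\<close>

lemma gaussian_average_insert2:
  fixes x :: "nat \<Rightarrow> 'a::real_vector"
  assumes E: "normed_space E" and K: "finite K" "i \<notin> K" "j \<notin> K" "i \<noteq> j"
    and x: "\<forall>k\<in>insert i (insert j K). x k \<in> vecs E"
  shows "gaussian_average E (insert i (insert j K)) x =
    (\<integral>\<^sup>+g. \<integral>\<^sup>+b. \<integral>\<^sup>+a. ennreal (nrm E ((\<Sum>k\<in>K. g k *\<^sub>R x k) + a *\<^sub>R x i + b *\<^sub>R x j))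
      \<partial>std_gauss \<partial>std_gauss \<partial>gaussian K)"
proof -
  define F where "F g = (\<integral>\<^sup>+a. ennreal (nrm E ((\<Sum>k\<in>insert j K. g k *\<^sub>R x k) + a *\<^sub>R x i)) \<partial>std_gauss)"
    for g :: "nat \<Rightarrow> real"
  have sum: "(\<Sum>k\<in>insert j K. (g(j := b)) k *\<^sub>R x k) = (\<Sum>k\<in>K. g k *\<^sub>R x k) + b *\<^sub>R x j" for g :: "nat \<Rightarrow> real" and b
    using K by (simp add: add.commute) (intro sum.cong, auto)
  have meas: "F \<in> borel_measurable (gaussian (insert j K))"
  proof -
    interpret sigma_finite_measure std_gauss
      by (intro prob_space_imp_sigma_finite prob_space_std_gauss)
    have snd: "snd \<in> borel_measurable (gaussian (insert j K) \<Otimes>\<^sub>M std_gauss)"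
      using measurable_snd[of "gaussian (insert j K)" std_gauss]
      by (simp add: measurable_cong_sets[OF refl sets_std_gauss])
    have comp: "(\<lambda>p. if k = i then snd p else fst p k) \<in> borel_measurable (gaussian (insert j K) \<Otimes>\<^sub>M std_gauss)"
      if "k \<in> insert i (insert j K)" for k
    proof (cases "k = i")
      case False
      with that have "k \<in> insert j K" by blast
      from measurable_compose[OF measurable_fst measurable_gaussian_component[OF this]] False
      show ?thesis by simp
    qed (simp add: snd)
    have "(\<lambda>p. nrm E (0 + (\<Sum>k\<in>insert i (insert j K). (if k = i then snd p else fst p k) *\<^sub>R x k)))
        \<in> borel_measurable (gaussian (insert j K) \<Otimes>\<^sub>M std_gauss)"
      by (rule borel_measurable_nrm_combination[OF E _ normed_space_zero[OF E] _ comp]) (use x K in auto)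
    moreover have "(\<Sum>k\<in>insert i (insert j K). (if k = i then snd p else fst p k) *\<^sub>R x k)
        = (\<Sum>k\<in>insert j K. fst p k *\<^sub>R x k) + snd p *\<^sub>R x i" for p :: "(nat \<Rightarrow> real) \<times> real"
    proof -
      have "(\<Sum>k\<in>insert j K. (if k = i then snd p else fst p k) *\<^sub>R x k) = (\<Sum>k\<in>insert j K. fst p k *\<^sub>R x k)"
        using K by (intro sum.cong) auto
      then show ?thesis
        using K by (subst sum.insert) (auto simp: add.commute)
    qed
    ultimately have "(\<lambda>(g, a). ennreal (nrm E ((\<Sum>k\<in>insert j K. g k *\<^sub>R x k) + a *\<^sub>R x i)))
        \<in> borel_measurable (gaussian (insert j K) \<Otimes>\<^sub>M std_gauss)"
      by (simp add: case_prod_beta)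
    from borel_measurable_nn_integral[OF this] show ?thesis unfolding F_def[abs_def] .
  qed
  have "gaussian_average E (insert i (insert j K)) x = (\<integral>\<^sup>+g. F g \<partial>gaussian (insert j K))"
    unfolding F_def using K x by (intro gaussian_average_insert[OF E]) auto
  also have "\<dots> = (\<integral>\<^sup>+g. \<integral>\<^sup>+b. F (g(j := b)) \<partial>std_gauss \<partial>gaussian K)"
    using K meas by (intro nn_integral_gaussian_insert) auto
  finally show ?thesis
    unfolding F_def sum by (simp add: add_ac)
qed

lemma orth_step_gaussian_average:
  fixes x :: "nat \<Rightarrow> 'a::real_vector"
  assumes "orth_step I x y" and E: "normed_space E" and I: "finite I" and x: "\<forall>i\<in>I. x i \<in> vecs E"
  shows "gaussian_average E I x = gaussian_average E I y"
  using assms(1) x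
proof cases
  case (rot i j c s)
  define K where "K = I - {i, j}"
  have K: "finite K" "i \<notin> K" "j \<notin> K" "I = insert i (insert j K)"
    using rot I by (auto simp: K_def)
  have y: "\<forall>k\<in>I. y k \<in> vecs E"
    using orth_step_in_subspace[OF assms(1) normed_space_subspace[OF E] x] .
  have "(\<integral>\<^sup>+b. \<integral>\<^sup>+a. ennreal (nrm E (v + a *\<^sub>R y i + b *\<^sub>R y j)) \<partial>std_gauss \<partial>std_gauss) =
      (\<integral>\<^sup>+b. \<integral>\<^sup>+a. ennreal (nrm E (v + a *\<^sub>R x i + b *\<^sub>R x j)) \<partial>std_gauss \<partial>std_gauss)"
    if v: "v \<in> vecs E" for v
  proof -
    define f where "f b a = ennreal (nrm E (v + a *\<^sub>R x i + b *\<^sub>R x j))" for b a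
    have "(\<lambda>p. nrm E (v + (\<Sum>k\<in>{i, j}. (if k = i then snd p else fst p) *\<^sub>R x k)))
        \<in> borel_measurable (borel \<Otimes>\<^sub>M borel)"
      using x rot by (intro borel_measurable_nrm_combination[OF E _ v]) auto
    then have f: "(\<lambda>(b, a). f b a) \<in> borel_measurable (borel \<Otimes>\<^sub>M borel)"
      using rot(4) by (simp add: f_def case_prod_beta add.assoc)
    have "v + a *\<^sub>R y i + b *\<^sub>R y j = v + ((- s) * b + c * a) *\<^sub>R x i + (c * b - (- s) * a) *\<^sub>R x j" for a b
      using rot(1,4) by (simp add: rotate2_def algebra_simps)
    then have "ennreal (nrm E (v + a *\<^sub>R y i + b *\<^sub>R y j)) = f (c * b - (- s) * a) ((- s) * b + c * a)" for a b
      by (simp only: f_def)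
    then show ?thesis
      using nn_integral_std_gauss_rotation[OF f, of c "- s"] rot by (simp add: f_def)
  qed
  moreover have "(\<Sum>k\<in>K. g k *\<^sub>R y k) = (\<Sum>k\<in>K. g k *\<^sub>R x k)" for g
    using K rot(1) by (intro sum.cong) (auto simp: rotate2_def)
  moreover have "(\<Sum>k\<in>K. g k *\<^sub>R x k) \<in> vecs E" for g
    using x K by (intro normed_space_sum[OF E] normed_space_scale[OF E]) auto
  ultimately show ?thesis
    using x y rot(4) K by (simp add: gaussian_average_insert2[OF E])
next
  case (flip i)
  define K where "K = I - {i}"
  have K: "finite K" "i \<notin> K" "I = insert i K"
    using flip I by (auto simp: K_def)
  have y: "\<forall>k\<in>I. y k \<in> vecs E"
    using orth_step_in_subspace[OF assms(1) normed_space_subspace[OF E] x] .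
  have "(\<integral>\<^sup>+a. ennreal (nrm E (v + a *\<^sub>R y i)) \<partial>std_gauss) = (\<integral>\<^sup>+a. ennreal (nrm E (v + a *\<^sub>R x i)) \<partial>std_gauss)"
    if v: "v \<in> vecs E" for v
  proof -
    have "(\<lambda>a. nrm E (v + (\<Sum>k\<in>{i}. a *\<^sub>R x k))) \<in> borel_measurable borel"
      using x flip by (intro borel_measurable_nrm_combination[OF E _ v]) auto
    then show ?thesis
      using nn_integral_std_gauss_uminus[of "\<lambda>a. ennreal (nrm E (v + a *\<^sub>R x i))"] flip(1) by simp
  qed
  moreover have "(\<Sum>k\<in>K. g k *\<^sub>R y k) = (\<Sum>k\<in>K. g k *\<^sub>R x k)" for g
    using K flip(1) by (intro sum.cong) auto
  moreover have "(\<Sum>k\<in>K. g k *\<^sub>R x k) \<in> vecs E" for g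
    using x K by (intro normed_space_sum[OF E] normed_space_scale[OF E]) auto
  ultimately show ?thesis
    using x y K by (simp add: gaussian_average_insert[OF E])
qed

lemma orth_equiv_gaussian_average:
  fixes x :: "nat \<Rightarrow> 'a::real_vector"
  assumes "orth_equiv I x y" "normed_space E" "finite I" "\<forall>i\<in>I. x i \<in> vecs E"
  shows "gaussian_average E I y = gaussian_average E I x"
  using orth_equiv_invariant[OF assms(1) normed_space_subspace[OF assms(2)] assms(4),
      of "gaussian_average E I"] orth_step_gaussian_average[OF _ assms(2,3)] by blast

lemma equal_gram_gaussian_average:
  fixes x y :: "nat \<Rightarrow> 'x \<Rightarrow> real"
  assumes E: "normed_space E" and I: "finite I"
    and x: "\<forall>i\<in>I. x i \<in> vecs E" and y: "\<forall>i\<in>I. y i \<in> vecs E"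
    and gram: "\<And>s t. gram I x s t = gram I y s t"
  shows "gaussian_average E I x = gaussian_average E I y"
proof -
  obtain z w where zw: "orth_equiv I x z" "orth_equiv I y w" "\<forall>i\<in>I. z i = w i"
    using equal_gram_imp_common_rotation[OF I gram] by blast
  have "gaussian_average E I x = gaussian_average E I z"
    using orth_equiv_gaussian_average[OF zw(1) E I x] by simp
  also have "\<dots> = gaussian_average E I w" using zw(3) by (intro gaussian_average_cong) auto
  also have "\<dots> = gaussian_average E I y" by (rule orth_equiv_gaussian_average[OF zw(2) E I y])
  finally show ?thesis .
qed

section \<open>Rademacher averages, type and cotype\<close>

lemma space_rademacher: "\<omega> \<in> space rademacher \<Longrightarrow> \<omega> i \<in> {-1, 1}"
  by (auto simp: rademacher_def space_PiM space_uniform_count_measure)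

lemma borel_measurable_rademacher: "(\<lambda>\<omega>. \<omega> i) \<in> borel_measurable rademacher"
proof -
  have "(\<lambda>x. x) \<in> uniform_count_measure {-1, 1 :: real} \<rightarrow>\<^sub>M borel"
    by (rule measurableI) (simp_all add: space_uniform_count_measure sets_uniform_count_measure)
  from measurable_compose[OF measurable_rademacher this] show ?thesis .
qed

lemma gaussian_average_sign_change:
  fixes x :: "nat \<Rightarrow> 'a::real_vector"
  assumes "normed_space E" "finite I" "\<forall>i\<in>I. x i \<in> vecs E" "\<And>i. i \<in> I \<Longrightarrow> \<epsilon> i \<in> {-1, 1}"
  shows "gaussian_average E I (\<lambda>i. \<epsilon> i *\<^sub>R x i) = gaussian_average E I x"
proof -
  obtain z where z: "orth_equiv I x z" "\<forall>i\<in>I. z i = \<epsilon> i *\<^sub>R x i"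
    using sign_change_orth_equiv[of I \<epsilon> x] assms by blast
  have "gaussian_average E I (\<lambda>i. \<epsilon> i *\<^sub>R x i) = gaussian_average E I z"
    using z(2) by (intro gaussian_average_cong) auto
  also have "\<dots> = gaussian_average E I x"
    by (rule orth_equiv_gaussian_average[OF z(1) assms(1-3)])
  finally show ?thesis .
qed

text \<open>
  By Tonelli the signs can be fixed before the Gaussian variables are integrated, and for fixed signs
  the Gaussian average is unchanged.
\<close>

lemma gaussian_average_eq_rademacher:
  fixes x :: "nat \<Rightarrow> 'a::real_vector"
  assumes E: "normed_space E" and x: "\<And>i. i < n \<Longrightarrow> x i \<in> vecs E"
  shows "(\<integral>\<^sup>+g. ennreal (\<integral>\<omega>. nrm E (\<Sum>i<n. \<omega> i *\<^sub>R g i *\<^sub>R x i) \<partial>rademacher) \<partial>gaussian {..<n}) =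
    gaussian_average E {..<n} x"
proof -
  interpret R: prob_space rademacher by (rule prob_space_rademacher)
  interpret G: prob_space "gaussian {..<n}" by (rule prob_space_gaussian)
  interpret P: pair_sigma_finite "gaussian {..<n}" rademacher ..
  define f where "f g \<omega> = nrm E (\<Sum>i<n. \<omega> i *\<^sub>R g i *\<^sub>R x i)" for g \<omega> :: "nat \<Rightarrow> real"
  have mem: "\<omega> i *\<^sub>R g i *\<^sub>R x i \<in> vecs E" if "i < n" for \<omega> g :: "nat \<Rightarrow> real" and i
    using that by (intro normed_space_scale[OF E] x)
  have inner: "ennreal (\<integral>\<omega>. f g \<omega> \<partial>rademacher) = (\<integral>\<^sup>+\<omega>. ennreal (f g \<omega>) \<partial>rademacher)" for g
  proof (rule nn_integral_eq_integral[symmetric])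
    have pos: "0 \<le> f g \<omega>" for \<omega>
      unfolding f_def using mem by (intro nrm_nonneg[OF E] normed_space_sum[OF E]) auto
    have bound: "f g \<omega> \<le> (\<Sum>i<n. \<bar>g i\<bar> * nrm E (x i))" if "\<omega> \<in> space rademacher" for \<omega>
    proof -
      have "f g \<omega> \<le> (\<Sum>i<n. nrm E (\<omega> i *\<^sub>R g i *\<^sub>R x i))"
        unfolding f_def using mem by (intro nrm_sum_le[OF E]) auto
      also have "\<dots> = (\<Sum>i<n. \<bar>g i\<bar> * nrm E (x i))"
      proof (rule sum.cong)
        fix i assume "i \<in> {..<n}"
        then have "nrm E (\<omega> i *\<^sub>R g i *\<^sub>R x i) = \<bar>\<omega> i\<bar> * (\<bar>g i\<bar> * nrm E (x i))"
          by (simp add: nrm_scale[OF E] normed_space_scale[OF E] x abs_mult)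
        then show "nrm E (\<omega> i *\<^sub>R g i *\<^sub>R x i) = \<bar>g i\<bar> * nrm E (x i)"
          using space_rademacher[OF that, of i] by auto
      qed simp
      finally show ?thesis .
    qed
    have "f g \<in> borel_measurable rademacher"
      using borel_measurable_nrm_combination[OF E _ normed_space_zero[OF E], of "{..<n}"
          "\<lambda>i. g i *\<^sub>R x i" "\<lambda>i \<omega>. \<omega> i" rademacher]
      by (simp add: f_def[abs_def] borel_measurable_rademacher normed_space_scale[OF E] x)
    then show "integrable rademacher (f g)"
      using pos bound by (intro R.integrable_const_bound) auto
    show "AE \<omega> in rademacher. 0 \<le> f g \<omega>" using pos by simp
  qed
  have "(\<lambda>p. nrm E (0 + (\<Sum>i<n. (snd p i * fst p i) *\<^sub>R x i))) \<in> borel_measurable (gaussian {..<n} \<Otimes>\<^sub>M rademacher)"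
    by (rule borel_measurable_nrm_combination[OF E _ normed_space_zero[OF E]])
      (auto intro!: x borel_measurable_times
        measurable_compose[OF measurable_fst measurable_gaussian_component]
        measurable_compose[OF measurable_snd borel_measurable_rademacher])
  then have meas: "(\<lambda>(g, \<omega>). ennreal (f g \<omega>)) \<in> borel_measurable (gaussian {..<n} \<Otimes>\<^sub>M rademacher)"
    by (simp add: f_def case_prod_beta)
  have "(\<integral>\<^sup>+g. ennreal (\<integral>\<omega>. f g \<omega> \<partial>rademacher) \<partial>gaussian {..<n}) =
      (\<integral>\<^sup>+\<omega>. \<integral>\<^sup>+g. ennreal (f g \<omega>) \<partial>gaussian {..<n} \<partial>rademacher)"
    unfolding inner by (rule P.Fubini'[OF meas, symmetric])
  also have "\<dots> = (\<integral>\<^sup>+\<omega>. gaussian_average E {..<n} x \<partial>rademacher)"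
  proof (rule nn_integral_cong)
    fix \<omega> assume \<omega>: "\<omega> \<in> space rademacher"
    have "(\<integral>\<^sup>+g. ennreal (f g \<omega>) \<partial>gaussian {..<n}) = gaussian_average E {..<n} (\<lambda>i. \<omega> i *\<^sub>R x i)"
      by (simp add: f_def gaussian_average_def mult.commute)
    also have "\<dots> = gaussian_average E {..<n} x"
      using x space_rademacher[OF \<omega>] by (intro gaussian_average_sign_change[OF E]) auto
    finally show "(\<integral>\<^sup>+g. ennreal (f g \<omega>) \<partial>gaussian {..<n}) = gaussian_average E {..<n} x" .
  qed
  also have "\<dots> = gaussian_average E {..<n} x" by (simp add: R.emeasure_space_1)
  finally show ?thesis by (simp only: f_def)
qed

lemma nn_integral_gaussian_sum:
  fixes n :: nat
  assumes [measurable]: "\<phi> \<in> borel_measurable borel" and pos: "\<And>x. 0 \<le> \<phi> x" and c: "\<And>i. i < n \<Longrightarrow> 0 \<le> c i"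
    and int: "(\<integral>\<^sup>+x. ennreal (\<phi> x) \<partial>std_gauss) = ennreal m" and m: "0 \<le> m"
  shows "(\<integral>\<^sup>+g. ennreal (\<Sum>i<n. c i * \<phi> (g i)) \<partial>gaussian {..<n}) = ennreal (m * (\<Sum>i<n. c i))"
proof -
  have meas: "(\<lambda>g. ennreal (\<phi> (g i))) \<in> borel_measurable (gaussian {..<n})" if "i < n" for i
    using measurable_compose[OF measurable_gaussian_component[of i "{..<n}"], of "\<lambda>x. ennreal (\<phi> x)" borel] that
    by simp
  have "(\<integral>\<^sup>+g. ennreal (\<Sum>i<n. c i * \<phi> (g i)) \<partial>gaussian {..<n}) =
      (\<integral>\<^sup>+g. (\<Sum>i<n. ennreal (c i) * ennreal (\<phi> (g i))) \<partial>gaussian {..<n})"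
    using pos c by (intro nn_integral_cong) (subst sum_ennreal[symmetric], auto simp: ennreal_mult)
  also have "\<dots> = (\<Sum>i<n. ennreal (c i) * (\<integral>\<^sup>+g. ennreal (\<phi> (g i)) \<partial>gaussian {..<n}))"
    using meas by (subst nn_integral_sum) (auto intro!: sum.cong nn_integral_cmult borel_measurable_times_ennreal)
  also have "\<dots> = (\<Sum>i<n. ennreal (c i) * ennreal m)"
    by (intro sum.cong refl) (simp add: nn_integral_gaussian_component[where f = "\<lambda>x. ennreal (\<phi> x)"] int)
  also have "\<dots> = ennreal (m * (\<Sum>i<n. c i))"
    unfolding sum_distrib_left using c m by (subst sum_ennreal[symmetric]) (auto simp: ennreal_mult mult.commute)
  finally show ?thesis .
qed

text \<open>
  With \<open>\<alpha>\<close> the right-hand side, \<open>sqrt s \<le> s / (2 * \<alpha>) + \<alpha> / 2\<close> makes the integrand quadratic in the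
  Gaussian variables, which have variance 1.
\<close>

lemma nn_integral_gaussian_l2_le:
  fixes b :: "nat \<Rightarrow> real"
  shows "(\<integral>\<^sup>+g. ennreal (sqrt (\<Sum>i<n. (g i * b i)\<^sup>2)) \<partial>gaussian {..<n}) \<le> ennreal (sqrt (\<Sum>i<n. (b i)\<^sup>2))"
proof (cases "(\<Sum>i<n. (b i)\<^sup>2) = 0")
  case True
  then have "\<forall>i\<in>{..<n}. b i = 0" by (subst (asm) sum_nonneg_eq_0_iff) auto
  then show ?thesis by simp
next
  case False
  interpret G: prob_space "gaussian {..<n}" by (rule prob_space_gaussian)
  define \<alpha> where "\<alpha> = sqrt (\<Sum>i<n. (b i)\<^sup>2)"
  have \<alpha>: "\<alpha> > 0" "\<alpha>\<^sup>2 = (\<Sum>i<n. (b i)\<^sup>2)"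
    using False sum_nonneg[of "{..<n}" "\<lambda>i. (b i)\<^sup>2"] by (auto simp: \<alpha>_def)
  have "sqrt (\<Sum>i<n. (g i * b i)\<^sup>2) \<le> (\<Sum>i<n. (b i)\<^sup>2 / (2 * \<alpha>) * (g i)\<^sup>2) + \<alpha> / 2" for g :: "nat \<Rightarrow> real"
  proof -
    define S where "S = sqrt (\<Sum>i<n. (g i * b i)\<^sup>2)"
    have S: "S\<^sup>2 = (\<Sum>i<n. (g i * b i)\<^sup>2)" by (simp add: S_def sum_nonneg)
    have "0 \<le> (S - \<alpha>)\<^sup>2 / (2 * \<alpha>)" using \<alpha> by simp
    also have "(S - \<alpha>)\<^sup>2 / (2 * \<alpha>) = S\<^sup>2 / (2 * \<alpha>) + \<alpha> / 2 - S"
      using \<alpha>(1) by (simp add: power2_diff field_simps power2_eq_square)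
    finally have "S \<le> S\<^sup>2 / (2 * \<alpha>) + \<alpha> / 2" by simp
    also have "S\<^sup>2 / (2 * \<alpha>) = (\<Sum>i<n. (b i)\<^sup>2 / (2 * \<alpha>) * (g i)\<^sup>2)"
      by (simp add: S sum_divide_distrib power_mult_distrib mult.commute)
    finally show ?thesis by (simp only: S_def)
  qed
  then have "(\<integral>\<^sup>+g. ennreal (sqrt (\<Sum>i<n. (g i * b i)\<^sup>2)) \<partial>gaussian {..<n}) \<le>
      (\<integral>\<^sup>+g. ennreal (\<Sum>i<n. (b i)\<^sup>2 / (2 * \<alpha>) * (g i)\<^sup>2) + ennreal (\<alpha> / 2) \<partial>gaussian {..<n})"
    using \<alpha> by (intro nn_integral_mono) (simp add: ennreal_plus[symmetric] sum_nonneg ennreal_leI del: ennreal_plus)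
  also have "\<dots> = (\<integral>\<^sup>+g. ennreal (\<Sum>i<n. (b i)\<^sup>2 / (2 * \<alpha>) * (g i)\<^sup>2) \<partial>gaussian {..<n}) + ennreal (\<alpha> / 2)"
  proof (subst nn_integral_add)
    show "(\<lambda>g. ennreal (\<Sum>i<n. (b i)\<^sup>2 / (2 * \<alpha>) * (g i)\<^sup>2)) \<in> borel_measurable (gaussian {..<n})"
      using measurable_gaussian_component[of _ "{..<n}"] by measurable
  qed (auto simp: G.emeasure_space_1)
  also have "\<dots> = ennreal (1 * (\<Sum>i<n. (b i)\<^sup>2 / (2 * \<alpha>))) + ennreal (\<alpha> / 2)"
    using \<alpha> by (subst nn_integral_gaussian_sum[where \<phi> = "\<lambda>x. x\<^sup>2" and m = 1])
      (auto simp: nn_integral_std_gauss_square)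
  also have "\<dots> = ennreal (1 * (\<Sum>i<n. (b i)\<^sup>2 / (2 * \<alpha>)) + \<alpha> / 2)"
    using \<alpha>(1) by (intro ennreal_plus[symmetric]) (auto intro: sum_nonneg)
  also have "1 * (\<Sum>i<n. (b i)\<^sup>2 / (2 * \<alpha>)) + \<alpha> / 2 = \<alpha>"
    unfolding sum_divide_distrib[symmetric] \<alpha>(2)[symmetric] using \<alpha>(1) by (simp add: power2_eq_square)
  finally show ?thesis by (simp only: \<alpha>_def)
qed

text \<open>
  By Cauchy--Schwarz the integrand is at least \<open>(\<Sum>i<n. (b i)\<^sup>2 * \<bar>g i\<bar>) / \<beta>\<close>, where \<open>\<beta>\<close> is the \<open>l\<^sup>2\<close> norm
  of \<open>b\<close>, and \<open>sqrt (2 / pi)\<close> is the mean of \<open>\<bar>g i\<bar>\<close>.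
\<close>

lemma nn_integral_gaussian_l2_ge:
  fixes b :: "nat \<Rightarrow> real"
  shows "ennreal (sqrt (2 / pi) * sqrt (\<Sum>i<n. (b i)\<^sup>2)) \<le>
    (\<integral>\<^sup>+g. ennreal (sqrt (\<Sum>i<n. (g i * b i)\<^sup>2)) \<partial>gaussian {..<n})"
proof (cases "(\<Sum>i<n. (b i)\<^sup>2) = 0")
  case False
  define \<beta> where "\<beta> = sqrt (\<Sum>i<n. (b i)\<^sup>2)"
  have \<beta>: "\<beta> > 0" "\<beta>\<^sup>2 = (\<Sum>i<n. (b i)\<^sup>2)"
    using False sum_nonneg[of "{..<n}" "\<lambda>i. (b i)\<^sup>2"] by (auto simp: \<beta>_def)
  have "(\<Sum>i<n. (b i)\<^sup>2 / \<beta> * \<bar>g i\<bar>) \<le> sqrt (\<Sum>i<n. (g i * b i)\<^sup>2)" for g :: "nat \<Rightarrow> real"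
  proof -
    have "(\<Sum>i<n. (\<bar>g i\<bar> * \<bar>b i\<bar>) * \<bar>b i\<bar>)\<^sup>2 \<le> (\<Sum>i<n. (\<bar>g i\<bar> * \<bar>b i\<bar>)\<^sup>2) * (\<Sum>i<n. \<bar>b i\<bar>\<^sup>2)"
      by (rule Cauchy_Schwarz_ineq_sum)
    moreover have "(\<bar>g i\<bar> * \<bar>b i\<bar>) * \<bar>b i\<bar> = (b i)\<^sup>2 * \<bar>g i\<bar>" "(\<bar>g i\<bar> * \<bar>b i\<bar>)\<^sup>2 = (g i * b i)\<^sup>2" for i
      by (simp_all add: power_mult_distrib power2_eq_square)
    ultimately have "(\<Sum>i<n. (b i)\<^sup>2 * \<bar>g i\<bar>)\<^sup>2 \<le> (\<Sum>i<n. (g i * b i)\<^sup>2) * \<beta>\<^sup>2"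
      by (simp only: \<beta>(2) power2_abs)
    then have "(\<Sum>i<n. (b i)\<^sup>2 * \<bar>g i\<bar>) \<le> sqrt ((\<Sum>i<n. (g i * b i)\<^sup>2) * \<beta>\<^sup>2)"
      by (rule real_le_rsqrt)
    also have "\<dots> = sqrt (\<Sum>i<n. (g i * b i)\<^sup>2) * \<beta>" using \<beta>(1) by (simp add: real_sqrt_mult)
    finally show ?thesis
      using \<beta>(1) by (simp add: sum_divide_distrib[symmetric] pos_divide_le_eq)
  qed
  then have "(\<integral>\<^sup>+g. ennreal (\<Sum>i<n. (b i)\<^sup>2 / \<beta> * \<bar>g i\<bar>) \<partial>gaussian {..<n}) \<le>
      (\<integral>\<^sup>+g. ennreal (sqrt (\<Sum>i<n. (g i * b i)\<^sup>2)) \<partial>gaussian {..<n})"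
    by (intro nn_integral_mono ennreal_leI)
  also have "(\<integral>\<^sup>+g. ennreal (\<Sum>i<n. (b i)\<^sup>2 / \<beta> * \<bar>g i\<bar>) \<partial>gaussian {..<n}) =
      ennreal (sqrt (2 / pi) * (\<Sum>i<n. (b i)\<^sup>2 / \<beta>))"
    using \<beta> by (intro nn_integral_gaussian_sum) (auto simp: nn_integral_std_gauss_abs)
  also have "(\<Sum>i<n. (b i)\<^sup>2 / \<beta>) = \<beta>"
    unfolding sum_divide_distrib[symmetric] \<beta>(2)[symmetric] using \<beta>(1) by (simp add: power2_eq_square)
  finally show ?thesis by (simp only: \<beta>_def)
qed simp

text \<open>
  The type 2 inequality is applied to \<open>g i *\<^sub>R x i\<close> and integrated over \<open>g\<close>.
\<close>

lemma type_2_gaussian_average: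
  assumes "normed_space E" "type_2 E"
  shows "\<exists>T\<ge>0. \<forall>n x. (\<forall>i<n. x i \<in> vecs E) \<longrightarrow>
    gaussian_average E {..<n} x \<le> ennreal (T * sqrt (\<Sum>i<n. (nrm E (x i))\<^sup>2))"
proof -
  note E = assms(1)
  from assms(2) obtain T where T: "T \<ge> 0" and type: "\<And>n x. (\<forall>i<n. x i \<in> vecs E) \<Longrightarrow>
      (\<integral>\<omega>. nrm E (\<Sum>i<n. \<omega> i *\<^sub>R x i) \<partial>rademacher) \<le> T * sqrt (\<Sum>i<n. (nrm E (x i))\<^sup>2)"
    unfolding type_2_def type_2_operator_def id_def by blast
  have "gaussian_average E {..<n} x \<le> ennreal (T * sqrt (\<Sum>i<n. (nrm E (x i))\<^sup>2))"
    if x: "\<forall>i<n. x i \<in> vecs E" for n x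
  proof -
    have "(\<integral>\<omega>. nrm E (\<Sum>i<n. \<omega> i *\<^sub>R g i *\<^sub>R x i) \<partial>rademacher) \<le> T * sqrt (\<Sum>i<n. (g i * nrm E (x i))\<^sup>2)"
      for g :: "nat \<Rightarrow> real"
    proof -
      have "(\<integral>\<omega>. nrm E (\<Sum>i<n. \<omega> i *\<^sub>R g i *\<^sub>R x i) \<partial>rademacher) \<le> T * sqrt (\<Sum>i<n. (nrm E (g i *\<^sub>R x i))\<^sup>2)"
        using x by (intro type) (simp add: normed_space_scale[OF E])
      also have "(\<Sum>i<n. (nrm E (g i *\<^sub>R x i))\<^sup>2) = (\<Sum>i<n. (g i * nrm E (x i))\<^sup>2)"
        using x by (intro sum.cong) (auto simp: nrm_scale[OF E] power_mult_distrib)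
      finally show ?thesis .
    qed
    then have "gaussian_average E {..<n} x \<le>
        (\<integral>\<^sup>+g. ennreal (T * sqrt (\<Sum>i<n. (g i * nrm E (x i))\<^sup>2)) \<partial>gaussian {..<n})"
      using x by (subst gaussian_average_eq_rademacher[OF E, symmetric])
        (auto intro!: nn_integral_mono ennreal_leI)
    also have "\<dots> = ennreal T * (\<integral>\<^sup>+g. ennreal (sqrt (\<Sum>i<n. (g i * nrm E (x i))\<^sup>2)) \<partial>gaussian {..<n})"
    proof -
      have "(\<lambda>g. ennreal (sqrt (\<Sum>i<n. (g i * nrm E (x i))\<^sup>2))) \<in> borel_measurable (gaussian {..<n})"
        using measurable_gaussian_component[of _ "{..<n}"] by measurable
      then show ?thesis using T by (simp add: ennreal_mult sum_nonneg nn_integral_cmult)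
    qed
    also have "\<dots> \<le> ennreal T * ennreal (sqrt (\<Sum>i<n. (nrm E (x i))\<^sup>2))"
      by (intro mult_left_mono nn_integral_gaussian_l2_le) simp
    finally show ?thesis using T by (simp add: ennreal_mult sum_nonneg)
  qed
  with T show ?thesis by blast
qed

text \<open>
  The cotype 2 inequality is applied to \<open>g i *\<^sub>R y i\<close> and integrated over \<open>g\<close>.  Its constant is moved
  to the left-hand side as the factor \<open>c\<close>.
\<close>

lemma cotype_2_gaussian_average:
  assumes "normed_space F" "cotype_2 F"
  shows "\<exists>c>0. \<forall>n y. (\<forall>i<n. y i \<in> vecs F) \<longrightarrow>
    ennreal (c * sqrt (\<Sum>i<n. (nrm F (y i))\<^sup>2)) \<le> gaussian_average F {..<n} y"
proof -
  note F = assms(1)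
  from assms(2) obtain C where C: "C \<ge> 0" and cotype: "\<And>n x. (\<forall>i<n. x i \<in> vecs F) \<Longrightarrow>
      sqrt (\<Sum>i<n. (nrm F (x i))\<^sup>2) \<le> C * (\<integral>\<omega>. nrm F (\<Sum>i<n. \<omega> i *\<^sub>R x i) \<partial>rademacher)"
    unfolding cotype_2_def cotype_2_operator_def id_def by blast
  \<comment> \<open>the denominator is positive also for \<open>C = 0\<close>\<close>
  define c where "c = 1 / (C + 1)"
  have c: "c > 0" "c * C \<le> 1" using C by (auto simp: c_def)
  have "ennreal (sqrt (2 / pi) * c * sqrt (\<Sum>i<n. (nrm F (y i))\<^sup>2)) \<le> gaussian_average F {..<n} y"
    if y: "\<forall>i<n. y i \<in> vecs F" for n y
  proof -
    define r where "r g = (\<integral>\<omega>. nrm F (\<Sum>i<n. \<omega> i *\<^sub>R g i *\<^sub>R y i) \<partial>rademacher)" for g :: "nat \<Rightarrow> real"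
    have scaled: "sqrt (\<Sum>i<n. (g i * (c * nrm F (y i)))\<^sup>2) = c * sqrt (\<Sum>i<n. (g i * nrm F (y i))\<^sup>2)"
      for g :: "nat \<Rightarrow> real"
    proof -
      have "(\<Sum>i<n. (g i * (c * nrm F (y i)))\<^sup>2) = c\<^sup>2 * (\<Sum>i<n. (g i * nrm F (y i))\<^sup>2)"
        by (simp add: sum_distrib_left power_mult_distrib mult_ac)
      with c(1) show ?thesis by (simp add: real_sqrt_mult)
    qed
    have "sqrt (\<Sum>i<n. (g i * (c * nrm F (y i)))\<^sup>2) \<le> r g" for g
    proof -
      have "(\<Sum>i<n. (g i * nrm F (y i))\<^sup>2) = (\<Sum>i<n. (nrm F (g i *\<^sub>R y i))\<^sup>2)"
        using y by (intro sum.cong) (auto simp: nrm_scale[OF F] power_mult_distrib)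
      also have "sqrt \<dots> \<le> C * r g"
        unfolding r_def using y by (intro cotype) (simp add: normed_space_scale[OF F])
      finally have "c * sqrt (\<Sum>i<n. (g i * nrm F (y i))\<^sup>2) \<le> c * (C * r g)"
        using c(1) by (intro mult_left_mono) auto
      also have "c * (C * r g) \<le> r g"
      proof -
        have "0 \<le> r g"
          unfolding r_def using y
          by (intro Bochner_Integration.integral_nonneg nrm_nonneg[OF F] normed_space_sum[OF F] normed_space_scale[OF F]) auto
        from mult_right_mono[OF c(2) this] show ?thesis by (simp add: mult.assoc)
      qed
      finally show ?thesis unfolding scaled .
    qed
    then have "(\<integral>\<^sup>+g. ennreal (sqrt (\<Sum>i<n. (g i * (c * nrm F (y i)))\<^sup>2)) \<partial>gaussian {..<n}) \<le>
        (\<integral>\<^sup>+g. ennreal (r g) \<partial>gaussian {..<n})"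
      by (intro nn_integral_mono ennreal_leI)
    with nn_integral_gaussian_l2_ge
    have "ennreal (sqrt (2 / pi) * sqrt (\<Sum>i<n. (c * nrm F (y i))\<^sup>2)) \<le> (\<integral>\<^sup>+g. ennreal (r g) \<partial>gaussian {..<n})"
      by (rule order_trans)
    also have "(\<integral>\<^sup>+g. ennreal (r g) \<partial>gaussian {..<n}) = gaussian_average F {..<n} y"
      unfolding r_def using y by (intro gaussian_average_eq_rademacher[OF F]) auto
    finally show ?thesis
      using scaled[of "\<lambda>_. 1"] by (simp add: mult.assoc)
  qed
  with c(1) show ?thesis by (intro exI[of _ "sqrt (2 / pi) * c"]) auto
qed

section \<open>Gram domination and the factorization theorem\<close>

definition gram_dominated :: "('x \<Rightarrow> real) nspace \<Rightarrow> ('x \<Rightarrow> real) nspace \<Rightarrow> real \<Rightarrow> bool" where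
  "gram_dominated E F K \<longleftrightarrow> (\<forall>n x y. (\<forall>i<n. x i \<in> vecs E) \<and> (\<forall>i<n. y i \<in> vecs E) \<and>
      (\<forall>s t. gram {..<n} x s t = gram {..<n} y s t) \<longrightarrow>
      (\<Sum>i<n. (nrm F (y i))\<^sup>2) \<le> K * (\<Sum>i<n. (nrm E (x i))\<^sup>2))"

lemma gram_dominatedI:
  assumes "\<And>n x y. \<lbrakk>\<forall>i<n. x i \<in> vecs E; \<forall>i<n. y i \<in> vecs E;
      \<And>s t. gram {..<n} x s t = gram {..<n} y s t\<rbrakk>
    \<Longrightarrow> (\<Sum>i<n. (nrm F (y i))\<^sup>2) \<le> K * (\<Sum>i<n. (nrm E (x i))\<^sup>2)"
  shows "gram_dominated E F K"
  unfolding gram_dominated_def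
  by (intro allI impI, elim conjE, rule assms) simp_all

text \<open>
  The supremum that defines the dual norm is finite because functionals of the dual are bounded.
\<close>

lemma abs_le_of_dual_norm_le_1:
  assumes E: "normed_space E" and \<phi>: "\<phi> \<in> dual E" "dual_norm E \<phi> \<le> 1" and f: "f \<in> vecs E"
  shows "\<bar>\<phi> f\<bar> \<le> nrm E f"
proof -
  from \<phi>(1) obtain C where C: "\<And>f. f \<in> vecs E \<Longrightarrow> \<bar>\<phi> f\<bar> \<le> C * nrm E f"
    and sc: "\<And>c f. f \<in> vecs E \<Longrightarrow> \<phi> (c *\<^sub>R f) = c * \<phi> f"
    unfolding dual_def bounded_operator_def by fastforce
  show ?thesis
  proof (cases "f = 0")
    case True
    with sc[OF normed_space_zero[OF E], of 0] show ?thesis by (simp add: nrm_zero[OF E])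
  next
    case False
    then have pos: "nrm E f > 0" using nrm_nonneg[OF E f] nrm_eq_0[OF E f] by linarith
    define g where "g = inverse (nrm E f) *\<^sub>R f"
    have g: "g \<in> vecs E" "nrm E g \<le> 1"
      using pos f by (auto simp: g_def nrm_scale[OF E] normed_space_scale[OF E])
    have "\<bar>\<phi> h\<bar> \<le> \<bar>C\<bar>" if "h \<in> vecs E" "nrm E h \<le> 1" for h
    proof -
      have "C * nrm E h \<le> \<bar>C\<bar> * 1"
        using that nrm_nonneg[OF E that(1)] by (intro mult_mono) auto
      with C[OF that(1)] show ?thesis by simp
    qed
    then have "bdd_above ((\<lambda>f. \<bar>\<phi> f\<bar>) ` {f \<in> vecs E. nrm E f \<le> 1})"
      by (intro bdd_aboveI2[of _ _ "\<bar>C\<bar>"]) auto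
    then have "\<bar>\<phi> g\<bar> \<le> dual_norm E \<phi>"
      unfolding dual_norm_def using g by (intro cSUP_upper) auto
    with \<phi>(2) have "\<bar>\<phi> g\<bar> \<le> 1" by simp
    with pos show ?thesis
      by (simp add: g_def sc[OF f] abs_mult field_simps)
  qed
qed

lemma two_summing_imp_gram_dominated:
  fixes E F :: "('x \<Rightarrow> real) nspace"
  assumes E: "normed_space E" and "two_summing E F id"
  shows "\<exists>K. gram_dominated E F K"
proof -
  define S where "S n x = (SUP \<phi>\<in>{\<phi>\<in>dual E. dual_norm E \<phi> \<le> 1}. sqrt (\<Sum>i<n. \<bar>\<phi> (x i)\<bar>\<^sup>2))"
    for n :: nat and x
  from assms(2) have "\<exists>C\<ge>0. \<forall>(n::nat) x. (\<forall>i<n. x i \<in> vecs E) \<longrightarrow>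
      sqrt (\<Sum>i<n. (nrm F (x i))\<^sup>2) \<le> C * S n x"
    unfolding two_summing_def id_def S_def by (rule conjunct2)
  then obtain C where C: "C \<ge> 0" and summing: "\<And>n x. (\<forall>i<n. x i \<in> vecs E) \<Longrightarrow>
      sqrt (\<Sum>i<n. (nrm F (x i))\<^sup>2) \<le> C * S n x"
    by blast
  have "gram_dominated E F (C\<^sup>2)"
  proof (rule gram_dominatedI)
    fix n and x y :: "nat \<Rightarrow> 'x \<Rightarrow> real"
    assume x: "\<forall>i<n. x i \<in> vecs E" and y: "\<forall>i<n. y i \<in> vecs E"
      and gram: "\<And>s t. gram {..<n} x s t = gram {..<n} y s t"
    let ?U = "{\<phi>\<in>dual E. dual_norm E \<phi> \<le> 1}"
    have "(\<lambda>_. 0) \<in> ?U"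
    proof -
      have "dual_norm E (\<lambda>_. 0) = 0"
        unfolding dual_norm_def using normed_space_zero[OF E] nrm_zero[OF E] by (subst cSUP_const) auto
      moreover have "(\<lambda>_. 0) \<in> dual E"
        by (auto simp: dual_def bounded_operator_def intro: exI[of _ 0])
      ultimately show ?thesis by simp
    qed
    then have "?U \<noteq> {}" by blast
    have le: "sqrt (\<Sum>i<n. \<bar>\<phi> (y i)\<bar>\<^sup>2) \<le> sqrt (\<Sum>i<n. (nrm E (x i))\<^sup>2)" if \<phi>: "\<phi> \<in> ?U" for \<phi>
    proof -
      have "(\<Sum>i<n. (\<phi> (x i))\<^sup>2) = (\<Sum>i<n. (\<phi> (y i))\<^sup>2)"
        using \<phi> x y by (intro equal_gram_functional[where \<phi> = \<phi>, OF _ normed_space_subspace[OF E] _ _ gram])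
          (auto simp: dual_def bounded_operator_def)
      moreover have "(\<Sum>i<n. (\<phi> (x i))\<^sup>2) \<le> (\<Sum>i<n. (nrm E (x i))\<^sup>2)"
      proof (rule sum_mono)
        fix i assume "i \<in> {..<n}"
        then have "\<bar>\<phi> (x i)\<bar> \<le> nrm E (x i)"
          using \<phi> x by (intro abs_le_of_dual_norm_le_1[OF E]) auto
        from power_mono[OF this, of 2] show "(\<phi> (x i))\<^sup>2 \<le> (nrm E (x i))\<^sup>2" by simp
      qed
      ultimately show ?thesis by simp
    qed
    have "sqrt (\<Sum>i<n. (nrm F (y i))\<^sup>2) \<le> C * (SUP \<phi>\<in>?U. sqrt (\<Sum>i<n. \<bar>\<phi> (y i)\<bar>\<^sup>2))"
      using summing[OF y] by (simp only: S_def)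
    also have "\<dots> \<le> C * sqrt (\<Sum>i<n. (nrm E (x i))\<^sup>2)"
      by (intro mult_left_mono[OF _ C] cSUP_least \<open>?U \<noteq> {}\<close> le)
    finally have "sqrt (\<Sum>i<n. (nrm F (y i))\<^sup>2) \<le> sqrt (C\<^sup>2 * (\<Sum>i<n. (nrm E (x i))\<^sup>2))"
      using C by (simp add: real_sqrt_mult)
    then show "(\<Sum>i<n. (nrm F (y i))\<^sup>2) \<le> C\<^sup>2 * (\<Sum>i<n. (nrm E (x i))\<^sup>2)" by simp
  qed
  then show ?thesis ..
qed

lemma type_cotype_imp_gram_dominated:
  fixes E F :: "('x \<Rightarrow> real) nspace"
  assumes E: "normed_space E" and F: "normed_space F" and sub: "vecs E \<subseteq> vecs F"
    and bounded: "\<And>f. f \<in> vecs E \<Longrightarrow> nrm F f \<le> b * nrm E f" and b: "b \<ge> 0"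
    and type: "type_2 E" and cotype: "cotype_2 F"
  shows "\<exists>K. gram_dominated E F K"
proof -
  obtain T where T: "T \<ge> 0" "\<And>n x. (\<forall>i<n. x i \<in> vecs E) \<Longrightarrow>
      gaussian_average E {..<n} x \<le> ennreal (T * sqrt (\<Sum>i<n. (nrm E (x i))\<^sup>2))"
    using type_2_gaussian_average[OF E type] by (elim conjE exE) (rule that, assumption, simp)
  obtain c where c: "c > 0" "\<And>n y. (\<forall>i<n. y i \<in> vecs F) \<Longrightarrow>
      ennreal (c * sqrt (\<Sum>i<n. (nrm F (y i))\<^sup>2)) \<le> gaussian_average F {..<n} y"
    using cotype_2_gaussian_average[OF F cotype] by (elim conjE exE) (rule that, assumption, simp)
  have "gram_dominated E F ((b * T / c)\<^sup>2)"
  proof (rule gram_dominatedI)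
    fix n and x y :: "nat \<Rightarrow> 'x \<Rightarrow> real"
    assume x: "\<forall>i<n. x i \<in> vecs E" and y: "\<forall>i<n. y i \<in> vecs E"
      and gram: "\<And>s t. gram {..<n} x s t = gram {..<n} y s t"
    have comb: "(\<Sum>i<n. g i *\<^sub>R x i) \<in> vecs E" for g
      using x by (intro normed_space_sum[OF E] normed_space_scale[OF E]) auto
    have "ennreal (c * sqrt (\<Sum>i<n. (nrm F (y i))\<^sup>2)) \<le> gaussian_average F {..<n} y"
      using y sub by (intro c(2)) auto
    also have "\<dots> = gaussian_average F {..<n} x"
      using x y sub gram by (intro equal_gram_gaussian_average[OF F]) auto
    also have "\<dots> \<le> (\<integral>\<^sup>+g. ennreal b * ennreal (nrm E (\<Sum>i<n. g i *\<^sub>R x i)) \<partial>gaussian {..<n})"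
      unfolding gaussian_average_def
      using bounded[OF comb] b nrm_nonneg[OF E comb]
      by (intro nn_integral_mono) (simp add: ennreal_mult[symmetric] ennreal_leI)
    also have "\<dots> = ennreal b * gaussian_average E {..<n} x"
      unfolding gaussian_average_def using x
      by (intro nn_integral_cmult measurable_compose[OF borel_measurable_nrm_gaussian_combination[OF E] measurable_ennreal]) auto
    also have "\<dots> \<le> ennreal b * ennreal (T * sqrt (\<Sum>i<n. (nrm E (x i))\<^sup>2))"
      using x by (intro mult_left_mono T(2)) auto
    also have "\<dots> = ennreal (b * (T * sqrt (\<Sum>i<n. (nrm E (x i))\<^sup>2)))"
      using b T(1) by (intro ennreal_mult[symmetric]) (auto simp: sum_nonneg)
    finally have "c * sqrt (\<Sum>i<n. (nrm F (y i))\<^sup>2) \<le> b * (T * sqrt (\<Sum>i<n. (nrm E (x i))\<^sup>2))"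
      using b T(1) by (simp add: ennreal_le_iff sum_nonneg)
    then have "sqrt (\<Sum>i<n. (nrm F (y i))\<^sup>2) \<le> b * T / c * sqrt (\<Sum>i<n. (nrm E (x i))\<^sup>2)"
      using c(1) by (simp add: field_simps)
    also have "\<dots> = sqrt ((b * T / c)\<^sup>2 * (\<Sum>i<n. (nrm E (x i))\<^sup>2))"
      using b T(1) c(1) by (simp add: real_sqrt_mult)
    finally show "(\<Sum>i<n. (nrm F (y i))\<^sup>2) \<le> (b * T / c)\<^sup>2 * (\<Sum>i<n. (nrm E (x i))\<^sup>2)" by simp
  qed
  then show ?thesis ..
qed

definition tensor :: "('x \<Rightarrow> real) \<Rightarrow> ('x \<Rightarrow> real) \<Rightarrow> 'x \<Rightarrow> 'x \<Rightarrow> real" where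
  "tensor f g = (\<lambda>s t. f s * g t)"

lemma tensor_simps:
  "tensor (f + g) h = tensor f h + tensor g h" "tensor h (f + g) = tensor h f + tensor h g"
  "tensor (c *\<^sub>R f) g = c *\<^sub>R tensor f g" "tensor f (c *\<^sub>R g) = c *\<^sub>R tensor f g"
  "tensor 0 f = 0" "tensor f 0 = 0"
  by (simp_all add: tensor_def fun_eq_iff algebra_simps)

text \<open>
  The convex cone consists of the pairs of a kernel \<open>\<Sum>(f, g). tensor f f - tensor g g\<close> and the number
  \<open>\<Sum>(f, g). K * (nrm E f)\<^sup>2 - (nrm F g)\<^sup>2\<close>, over finite lists of pairs of elements of \<open>E\<close>.  Gram domination says
  that the number is nonnegative when the kernel vanishes.  Singleton lists with \<open>g = 0\<close> or \<open>f = 0\<close>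
  give the two bounds.
\<close>

lemma gram_dominated_imp_quadratic_form:
  fixes E F :: "('x \<Rightarrow> real) nspace"
  assumes E: "normed_space E" and F: "normed_space F" and sub: "vecs E \<subseteq> vecs F"
    and dom: "gram_dominated E F K"
  obtains L where "linear L" "\<And>f. f \<in> vecs E \<Longrightarrow> L (tensor f f) \<le> K * (nrm E f)\<^sup>2"
    "\<And>f. f \<in> vecs E \<Longrightarrow> (nrm F f)\<^sup>2 \<le> L (tensor f f)"
proof -
  define T where "T zs = (\<Sum>p\<leftarrow>zs. tensor (fst p) (fst p) - tensor (snd p) (snd p))" for zs :: "(('x \<Rightarrow> real) \<times> ('x \<Rightarrow> real)) list"
  define R where "R zs = (\<Sum>p\<leftarrow>zs. K * (nrm E (fst p))\<^sup>2 - (nrm F (snd p))\<^sup>2)" for zs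
  define C where "C = {(T zs, R zs) | zs. set zs \<subseteq> vecs E \<times> vecs E}"
  have CI: "(T zs, R zs) \<in> C" if "set zs \<subseteq> vecs E \<times> vecs E" for zs
    using that by (auto simp: C_def)
  have T_apply: "T zs s t = (\<Sum>p\<leftarrow>zs. fst p s * fst p t - snd p s * snd p t)" for zs s t
    by (induction zs) (auto simp: T_def tensor_def)
  obtain L where L: "linear L" "\<And>t r. (t, r) \<in> C \<Longrightarrow> L t \<le> r"
  proof (rule linear_below_convex_cone[of C])
    fix t r t' r' assume "(t, r) \<in> C" "(t', r') \<in> C"
    then obtain zs zs' where z: "set zs \<subseteq> vecs E \<times> vecs E" "set zs' \<subseteq> vecs E \<times> vecs E"
      "t = T zs" "r = R zs" "t' = T zs'" "r' = R zs'" by (auto simp: C_def)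
    with CI[of "zs @ zs'"] show "(t + t', r + r') \<in> C" by (simp add: T_def R_def)
  next
    fix c :: real and t r assume c: "c > 0" and "(t, r) \<in> C"
    then obtain zs where z: "set zs \<subseteq> vecs E \<times> vecs E" "t = T zs" "r = R zs" by (auto simp: C_def)
    \<comment> \<open>both entries of the cone are quadratic in the vectors of the list\<close>
    define zs' where "zs' = map (\<lambda>p. (sqrt c *\<^sub>R fst p, sqrt c *\<^sub>R snd p)) zs"
    have "T zs' = c *\<^sub>R T zs"
      unfolding zs'_def T_def using c
      by (induction zs) (auto simp: tensor_simps scaleR_add_right scaleR_diff_right)
    moreover have "R zs' = c * R zs"
    proof -
      have "K * (nrm E (sqrt c *\<^sub>R fst p))\<^sup>2 - (nrm F (sqrt c *\<^sub>R snd p))\<^sup>2 =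
          c * (K * (nrm E (fst p))\<^sup>2 - (nrm F (snd p))\<^sup>2)" if "p \<in> set zs" for p
      proof -
        have "p \<in> vecs E \<times> vecs E" using that z(1) by blast
        then have "fst p \<in> vecs E" "snd p \<in> vecs F" using sub by (auto simp: mem_Times_iff)
        then have "nrm E (sqrt c *\<^sub>R fst p) = sqrt c * nrm E (fst p)"
          "nrm F (sqrt c *\<^sub>R snd p) = sqrt c * nrm F (snd p)"
          using nrm_scale[OF E, of "fst p" "sqrt c"] nrm_scale[OF F, of "snd p" "sqrt c"] c by auto
        then show ?thesis using c by (simp only: power_mult_distrib) (simp add: algebra_simps)
      qed
      then have "(\<Sum>p\<leftarrow>zs. K * (nrm E (sqrt c *\<^sub>R fst p))\<^sup>2 - (nrm F (sqrt c *\<^sub>R snd p))\<^sup>2) =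
          (\<Sum>p\<leftarrow>zs. c * (K * (nrm E (fst p))\<^sup>2 - (nrm F (snd p))\<^sup>2))"
        by (intro arg_cong[where f = sum_list] map_cong refl)
      then show ?thesis
        unfolding R_def zs'_def map_map comp_def fst_conv snd_conv by (simp only: sum_list_const_mult)
    qed
    moreover have "set zs' \<subseteq> vecs E \<times> vecs E"
      using z(1) by (auto simp: zs'_def normed_space_scale[OF E])
    ultimately show "(c *\<^sub>R t, c * r) \<in> C" using CI[of zs'] z by simp
  next
    show "(0, 0) \<in> C" using CI[of "[]"] by (simp add: T_def R_def)
  next
    fix r assume "(0, r) \<in> C"
    then obtain zs where z: "set zs \<subseteq> vecs E \<times> vecs E" "T zs = 0" "r = R zs" by (auto simp: C_def)
    define n where "n = length zs"
    define x where "x i = fst (zs ! i)" for i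
    define y where "y i = snd (zs ! i)" for i
    have sum: "(\<Sum>p\<leftarrow>zs. h (fst p) (snd p)) = (\<Sum>i<n. h (x i) (y i))" for h :: "('x \<Rightarrow> real) \<Rightarrow> ('x \<Rightarrow> real) \<Rightarrow> real"
      by (simp add: sum_list_sum_nth n_def x_def y_def case_prod_beta atLeast0LessThan)
    have "x i \<in> vecs E \<and> y i \<in> vecs E" if "i < n" for i
    proof -
      have "zs ! i \<in> vecs E \<times> vecs E" using z(1) nth_mem[of i zs] that unfolding n_def by blast
      then show ?thesis by (simp add: mem_Times_iff x_def y_def)
    qed
    moreover have "gram {..<n} x s t = gram {..<n} y s t" for s t
      using T_apply[of zs s t] sum[of "\<lambda>f g. f s * f t - g s * g t"]
      by (simp add: z(2) gram_def sum_subtractf)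
    ultimately have "(\<Sum>i<n. (nrm F (y i))\<^sup>2) \<le> K * (\<Sum>i<n. (nrm E (x i))\<^sup>2)"
      using dom unfolding gram_dominated_def by blast
    then show "0 \<le> r"
      using sum[of "\<lambda>f g. K * (nrm E f)\<^sup>2 - (nrm F g)\<^sup>2"]
      by (simp add: z(3) R_def sum_subtractf sum_distrib_left)
  next
    fix t r assume "(t, r) \<in> C"
    then obtain zs where z: "set zs \<subseteq> vecs E \<times> vecs E" "t = T zs" by (auto simp: C_def)
    have "T (map prod.swap zs) = - T zs"
      unfolding T_def by (induction zs) auto
    moreover have "set (map prod.swap zs) \<subseteq> vecs E \<times> vecs E" using z(1) by auto
    ultimately show "\<exists>r'. (- t, r') \<in> C" using CI[of "map prod.swap zs"] z(2) by auto
  qed blast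
  show thesis
  proof (rule that[OF L(1)])
    fix f assume f: "f \<in> vecs E"
    show "L (tensor f f) \<le> K * (nrm E f)\<^sup>2"
      using L(2)[OF CI[of "[(f, 0)]"]] f by (simp add: T_def R_def tensor_simps normed_space_zero[OF E] nrm_zero[OF F])
    show "(nrm F f)\<^sup>2 \<le> L (tensor f f)"
      using L(2)[OF CI[of "[(0, f)]"]] f
      by (simp add: T_def R_def tensor_simps normed_space_zero[OF E] nrm_zero[OF E] linear_neg[OF L(1)])
  qed
qed

text \<open>
  Symmetrizing the functional makes it a symmetric form; the envelope of this form is the
  RKHS.
\<close>

lemma gram_dominated_imp_rkhs:
  fixes E F :: "('x \<Rightarrow> real) nspace"
  assumes E: "normed_space E" and PF: "proper_bsf F" and sub: "vecs E \<subseteq> vecs F"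
    and dom: "gram_dominated E F K"
  shows "\<exists>H :: ('x \<Rightarrow> real) nspace. rkhs H \<and> E \<hookrightarrow> H \<and> H \<hookrightarrow> F"
proof -
  have BF: "banach_space F" and NF: "normed_space F"
    using PF by (auto simp: proper_bsf_def banach_space_def)
  obtain L where L: "linear L" "\<And>f. f \<in> vecs E \<Longrightarrow> L (tensor f f) \<le> K * (nrm E f)\<^sup>2"
    "\<And>f. f \<in> vecs E \<Longrightarrow> (nrm F f)\<^sup>2 \<le> L (tensor f f)"
    using gram_dominated_imp_quadratic_form[OF E NF sub dom] by blast
  define B where "B f g = (L (tensor f g) + L (tensor g f)) / 2" for f g
  interpret dominating_form F "vecs E" B
  proof
    show "banach_space F" "subspace (vecs E)" "vecs E \<subseteq> vecs F"
      using BF sub normed_space_subspace[OF E] by auto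
    show "B f g = B g f" "B (f + g) h = B f h + B g h" "B (c *\<^sub>R f) g = c * B f g" for f g h c
      by (simp_all add: B_def tensor_simps linear_add[OF L(1)] linear_scale[OF L(1)] field_simps)
    show "(nrm F f)\<^sup>2 \<le> B f f" if "f \<in> vecs E" for f
      using L(3)[OF that] by (simp add: B_def)
  qed
  have Hspace_F: "Hspace \<hookrightarrow> F"
  proof (rule embeddedI[OF normed_space_Hspace NF])
    show "vecs Hspace \<subseteq> vecs F" using HF by auto
    show "nrm F f \<le> 1 * nrm Hspace f" if "f \<in> vecs Hspace" for f
      using real_le_rsqrt[OF nrm_le_N[of f]] that by simp
  qed
  have "E \<hookrightarrow> Hspace"
  proof (rule embeddedI[OF E normed_space_Hspace])
    show "vecs E \<subseteq> vecs Hspace" using VH by auto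
    show "nrm Hspace f \<le> sqrt K * nrm E f" if f: "f \<in> vecs E" for f
    proof -
      have "N f \<le> K * (nrm E f)\<^sup>2" using N_le_Q[OF f] L(2)[OF f] by (simp add: B_def)
      then have "sqrt (N f) \<le> sqrt (K * (nrm E f)\<^sup>2)" by simp
      then show ?thesis using nrm_nonneg[OF E f] by (simp add: real_sqrt_mult)
    qed
  qed
  moreover have "rkhs Hspace"
    unfolding rkhs_def
    using proper_bsf_embedded[OF PF banach_space_Hspace Hspace_F] hilbert_norm_Hspace by blast
  ultimately show ?thesis using Hspace_F by blast
qed

theorem theorem7:
  fixes E F :: "('x \<Rightarrow> real) nspace"
  assumes "proper_bsf E" and "proper_bsf F" and "vecs E \<subseteq> vecs F"
    and "two_summing E F id \<or> (type_2 E \<and> cotype_2 F)"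
  shows "\<exists>H :: ('x \<Rightarrow> real) nspace. rkhs H \<and> E \<hookrightarrow> H \<and> H \<hookrightarrow> F"
proof -
  have E: "normed_space E" and F: "normed_space F"
    using assms(1,2) by (auto simp: proper_bsf_def banach_space_def)
  have "\<exists>K. gram_dominated E F K"
    using assms(4)
  proof
    assume "two_summing E F id"
    then show ?thesis by (rule two_summing_imp_gram_dominated[OF E])
  next
    assume "type_2 E \<and> cotype_2 F"
    moreover obtain b where "b \<ge> 0" "\<And>f. f \<in> vecs E \<Longrightarrow> nrm F f \<le> b * nrm E f"
      using inclusion_bounded[OF assms(1-3)] by blast
    ultimately show ?thesis
      by (intro type_cotype_imp_gram_dominated[OF E F assms(3)]) auto
  qed
  then show ?thesis
    using gram_dominated_imp_rkhs[OF E assms(2,3)] by blast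
qed

end
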